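(* Let $r\in\mathbb{N}$ and let $m$ be a nonnegative integer with $m\ge r-1$. Assume that the Hermite subdivision scheme of order $r$ associated with a mask $a\in (l_0(\mathbb{Z}))^{r\times r}$ is convergent with limiting functions in $\mathscr{C}^m(\mathbb{R})$. Let the compactly supported vector function $\phi=(\phi_1,\ldots,\phi_r)^{\mathsf T}\in(\mathscr{C}^m(\mathbb{R}))^r$ be its limiting basis vector function, i.e., the one determined by $$\lim_{n\to\infty}\ \sup_{k\in\mathbb{Z}}\Big\|(\mathcal{S}_a^n(\boldsymbol{\delta}I_r))(k)\,\mathsf{D}^{-n}-[\phi,\phi',\ldots,\phi^{(r-1)}](2^{-n}k)\Big\|=0 .$$ If $$\mathrm{span}\{\widehat{\phi}(2\pi k): k\in\mathbb{Z}\}=\mathbb{C}^r\quad\text{and}\quad \mathrm{span}\{\widehat{\phi}(\pi+2\pi k): k\in\mathbb{Z}\}=\mathbb{C}^r,$$ then the following statements hold: (1) $1$ is a simple eigenvalue of $\widehat{a}(0)$ and all other eigenvalues of $\widehat{a}(0)$ are less than $2^{-m}$ in modulus. (2) The mask $a$ is a Hermite mask of accuracy order $m+1$, that is, $a$ has order $m+1$ sum rules with respect to some $\upsilon_a\in (l_0(\mathbb{Z}))^{1\times r}$ such that $$\widehat{\upsilon_a}(\xi)=\big(1+O(|\xi|),\,i\xi+O(|\xi|^2),\ldots,(i\xi)^{r-1}+O(|\xi|^r)\big),\quad \xi\to0,$$ that is, for some $c_1,\ldots,c_r\in l_0(\mathbb{Z})$ satisfying $\widehat{c_1}(0)=\cdots=\widehat{c_r}(0)=1$,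 $$\widehat{\upsilon_a}(\xi)=\big(\widehat{c_1}(\xi),\,i\xi\,\widehat{c_2}(\xi),\ldots,(i\xi)^{r-1}\widehat{c_r}(\xi)\big)+O(|\xi|^{m+1}),\quad \xi\to0.$$ (3) $\phi=2\sum_{k\in\mathbb{Z}}a(k)\phi(2\cdot-k)$ with $e_1^{\mathsf T}\widehat{\phi}(0)=1$, and $\widehat{\phi}(\xi)=\lim_{n\to\infty}\big[\prod_{j=1}^n\widehat{a}(2^{-j}\xi)\big]e_1$ for $\xi\in\mathbb{R}$.
   Context: Notation. $(l(\mathbb{Z}))^{s\times r}$ is the space of all sequences $u:\mathbb{Z}\to\mathbb{C}^{s\times r}$, $(l_0(\mathbb{Z}))^{s\times r}$ the finitely supported ones, $l_0(\mathbb{Z})$ the case $s=r=1$. For finitely supported $u$, $\widehat{u}(\xi):=\sum_{k}u(k)e^{-ik\xi}$. For a function $f\in L_1(\mathbb{R})$ (entrywise for vectors), $\widehat f(\xi):=\int_{\mathbb{R}}f(x)e^{-i\xi x}\,dx$. $e_\ell\in\mathbb{R}^r$ is the $\ell$th standard column unit vector, $I_r$ is the $r\times r$ identity, and $\boldsymbol{\delta}$ is the sequence with $\boldsymbol{\delta}(0)=1$ and $\boldsymbol{\delta}(k)=0$ for $k\ne0$. $[\phi,\phi',\ldots,\phi^{(r-1)}]$ is the $r\times r$ matrix function with these columns. $\prod_{j=1}^n\widehat a(2^{-j}\xi):=\widehat a(2^{-1}\xi)\widehat a(2^{-2}\xi)\cdots\widehat a(2^{-n}\xi)$. $\widehat f(\xi)=\widehat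 g(\xi)+O(|\xi|^{n+1})$ as $\xi\to0$ means $\widehat f^{(j)}(0)=\widehat g^{(j)}(0)$ for $j=0,\ldots,n$. Subdivision operator: $(\mathcal{S}_a w)(j):=2\sum_{k\in\mathbb{Z}}w(k)a(j-2k)$, $j\in\mathbb{Z}$, for $w\in(l(\mathbb{Z}))^{s\times r}$. Hermite subdivision scheme of order $r$ with mask $a$: for an initial sequence $w_0\in(l(\mathbb{Z}))^{1\times r}$ put $w_n:=(\mathcal{S}_a^n w_0)\mathsf{D}^{-n}$ for $n\in\mathbb{N}$, where $\mathsf{D}:=\mathrm{diag}(1,2^{-1},\ldots,2^{1-r})$. The scheme is convergent with limiting functions in $\mathscr{C}^m(\mathbb{R})$ ($m\ge r-1$) if for every $w_0\in(l(\mathbb{Z}))^{1\times r}$ there is a function $\eta\in\mathscr{C}^m(\mathbb{R})$, $\eta:\mathbb{R}\to\mathbb{C}$, such that for all constants $K>0$, $$\lim_{n\to\infty}\max_{k\in\mathbb{Z}\cap[-2^nK,2^nK]}\big\|w_n(k)-[\eta(2^{-n}k),\eta'(2^{-n}k),\ldots,\eta^{(r-1)}(2^{-n}k)]\big\|_{\ell_\infty}=0.$$ When the scheme converges, the basis vector function $\phi$ (whose $\ell$th entry is the limit function $\eta$ for $w_0=\boldsymbol{\delta}e_\ell^{\mathsf T}$) exists, is compactly supported, lies in $(\mathscr{C}^m(\mathbb{R}))^r$, and satisfies the limit relation displayed in the claim. Sum rules: $a$ has order $m+1$ sum rules with respect to $\upsilon_a\in(l_0(\mathbb{Z}))^{1\times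 r}$ if $\widehat{\upsilon_a}(0)\ne0$ and, as $\xi\to0$, $\widehat{\upsilon_a}(2\xi)\widehat a(\xi)=\widehat{\upsilon_a}(\xi)+O(|\xi|^{m+1})$ and $\widehat{\upsilon_a}(2\xi)\widehat a(\xi+\pi)=O(|\xi|^{m+1})$. *)

theory Defs
  imports
    "HOL-Analysis.Analysis"
    "Jordan_Normal_Form.Char_Poly"
    "Jordan_Normal_Form.VS_Connect"
begin

hide_const (open) Finite_Cartesian_Product.mat Finite_Cartesian_Product.vec
  Finite_Cartesian_Product.row Finite_Cartesian_Product.column
  Determinants.det Coset.order Module.smult
unbundle no vec_syntax

text \<open>
  Matrices and vectors are those of \<open>Jordan_Normal_Form\<close>; all indices start at 0, so
  entry \<open>l\<close> here is entry \<open>l + 1\<close> in one-based numbering.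
  Sums over \<open>\<int>\<close> are written as unconditional sums; in every use below only finitely many terms
  are nonzero.
\<close>

definition seqs :: "nat \<Rightarrow> nat \<Rightarrow> (int \<Rightarrow> complex mat) set" where
  "seqs s r = {u. \<forall>k. u k \<in> carrier_mat s r}"

definition finite_seqs :: "nat \<Rightarrow> nat \<Rightarrow> (int \<Rightarrow> complex mat) set" where
  "finite_seqs s r = {u \<in> seqs s r. finite {k. u k \<noteq> 0\<^sub>m s r}}"

definition scalar_finite_seqs :: "(int \<Rightarrow> complex) set" where
  "scalar_finite_seqs = {c. finite {k. c k \<noteq> 0}}"

definition scalar_symbol :: "(int \<Rightarrow> complex) \<Rightarrow> real \<Rightarrow> complex" where
  "scalar_symbol c \<xi> = (\<Sum>\<^sub>\<infinity>k. c k * exp (- \<i> * of_int k * of_real \<xi>))"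

definition symbol :: "nat \<Rightarrow> nat \<Rightarrow> (int \<Rightarrow> complex mat) \<Rightarrow> real \<Rightarrow> complex mat" where
  "symbol s r u \<xi> = mat s r (\<lambda>(i, j). scalar_symbol (\<lambda>k. u k $$ (i, j)) \<xi>)"

definition fourier_vec :: "nat \<Rightarrow> (real \<Rightarrow> complex vec) \<Rightarrow> real \<Rightarrow> complex vec" where
  "fourier_vec r f \<xi> =
     vec r (\<lambda>i. LINT x|lborel. f x $ i * exp (- \<i> * of_real \<xi> * of_real x))"

definition iter_deriv :: "nat \<Rightarrow> (real \<Rightarrow> complex) \<Rightarrow> real \<Rightarrow> complex" where
  "iter_deriv n f = ((\<lambda>g x. vector_derivative g (at x)) ^^ n) f"

definition C_class :: "nat \<Rightarrow> (real \<Rightarrow> complex) set" where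
  "C_class m = {f. (\<forall>j<m. \<forall>x. iter_deriv j f differentiable (at x)) \<and>
                   continuous_on UNIV (iter_deriv m f)}"

text \<open>\<open>eq_upto_O n f g\<close> renders \<open>f(\<xi>) = g(\<xi>) + O(|\<xi>|^n)\<close> as \<open>\<xi> \<rightarrow> 0\<close>, which for the smooth
  functions considered here is by convention the agreement of all derivatives of order below \<open>n\<close>.\<close>

definition eq_upto_O :: "nat \<Rightarrow> (real \<Rightarrow> complex) \<Rightarrow> (real \<Rightarrow> complex) \<Rightarrow> bool" where
  "eq_upto_O n f g \<longleftrightarrow> (\<forall>j<n. iter_deriv j f 0 = iter_deriv j g 0)"

definition subdiv :: "nat \<Rightarrow> nat \<Rightarrow> (int \<Rightarrow> complex mat) \<Rightarrow> (int \<Rightarrow> complex mat) \<Rightarrow> int \<Rightarrow> complex mat"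
  where
  "subdiv s r a w j = mat s r (\<lambda>(i, l). 2 * (\<Sum>\<^sub>\<infinity>k. (w k * a (j - 2 * k)) $$ (i, l)))"

text \<open>\<open>D_power r p\<close> is the integer power \<open>D\<^sup>p\<close> of \<open>D = diag (1, 2\<^sup>-\<^sup>1, \<dots>, 2\<^sup>1\<^sup>-\<^sup>r)\<close>.\<close>

definition D_power :: "nat \<Rightarrow> int \<Rightarrow> complex mat" where
  "D_power r p = mat_diag r (\<lambda>l. ((1 / 2) ^ l) powi p)"

definition delta_I :: "nat \<Rightarrow> int \<Rightarrow> complex mat" where
  "delta_I r k = (if k = 0 then 1\<^sub>m r else 0\<^sub>m r r)"

text \<open>The \<open>s \<times> r\<close> matrix whose columns are the derivatives of orders \<open>0, \<dots>, r - 1\<close> of the vector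
  function with the entries \<open>f 0, \<dots>, f (s - 1)\<close>.\<close>

definition deriv_mat :: "nat \<Rightarrow> nat \<Rightarrow> (nat \<Rightarrow> real \<Rightarrow> complex) \<Rightarrow> real \<Rightarrow> complex mat" where
  "deriv_mat s r f x = mat s r (\<lambda>(i, l). iter_deriv l (f i) x)"

text \<open>For a row this is the \<open>\<ell>\<^sub>\<infinity>\<close> norm.\<close>

definition max_norm :: "complex mat \<Rightarrow> real" where
  "max_norm A = Max (cmod ` elements_mat A)"

definition hermite_iter :: "nat \<Rightarrow> nat \<Rightarrow> (int \<Rightarrow> complex mat) \<Rightarrow> (int \<Rightarrow> complex mat) \<Rightarrow> nat \<Rightarrow> int \<Rightarrow> complex mat"
  where
  "hermite_iter s r a w n k = ((subdiv s r a ^^ n) w) k * D_power r (- int n)"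

definition hermite_convergent :: "nat \<Rightarrow> nat \<Rightarrow> (int \<Rightarrow> complex mat) \<Rightarrow> bool" where
  "hermite_convergent r m a \<longleftrightarrow>
     (\<forall>w \<in> seqs 1 r. \<exists>\<eta> \<in> C_class m. \<forall>K>0.
        (\<lambda>n. Max ((\<lambda>k. max_norm (hermite_iter 1 r a w n k
                               - deriv_mat 1 r (\<lambda>_. \<eta>) (of_int k / 2 ^ n))) `
                  {k::int. - (2 ^ n * K) \<le> of_int k \<and> of_int k \<le> 2 ^ n * (K::real)}))
          \<longlonglongrightarrow> 0)"

text \<open>The real-valued supremum is over a bounded family: for \<open>r - 1 \<le> m\<close> the derivatives of \<open>\<phi>\<close>
  are continuous with compact support, and the iterates of a finitely supported mask are finitely
  supported.\<close>

definition limiting_basis :: "nat \<Rightarrow> nat \<Rightarrow> (int \<Rightarrow> complex mat) \<Rightarrow> (real \<Rightarrow> complex vec) \<Rightarrow> bool" where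
  "limiting_basis r m a \<phi> \<longleftrightarrow>
     (\<forall>x. \<phi> x \<in> carrier_vec r) \<and>
     compact (closure {x. \<phi> x \<noteq> 0\<^sub>v r}) \<and>
     (\<forall>i<r. (\<lambda>x. \<phi> x $ i) \<in> C_class m) \<and>
     (\<lambda>n. SUP k::int. max_norm (hermite_iter r r a (delta_I r) n k
                      - deriv_mat r r (\<lambda>i x. \<phi> x $ i) (of_int k / 2 ^ n))) \<longlonglongrightarrow> 0"

definition cspan :: "nat \<Rightarrow> complex vec set \<Rightarrow> complex vec set" where
  "cspan r S = LinearCombinations.module.span class_ring (module_vec TYPE(complex) r) S"

definition simple_eigenvalue :: "complex mat \<Rightarrow> complex \<Rightarrow> bool" where
  "simple_eigenvalue A z \<longleftrightarrow> eigenvalue A z \<and> Polynomial.order z (char_poly A) = 1"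

definition sum_rules :: "nat \<Rightarrow> nat \<Rightarrow> (int \<Rightarrow> complex mat) \<Rightarrow> (int \<Rightarrow> complex mat) \<Rightarrow> bool" where
  "sum_rules r N a \<upsilon> \<longleftrightarrow>
     symbol 1 r \<upsilon> 0 \<noteq> 0\<^sub>m 1 r \<and>
     (\<forall>l<r. eq_upto_O N (\<lambda>\<xi>. (symbol 1 r \<upsilon> (2 * \<xi>) * symbol r r a \<xi>) $$ (0, l))
                        (\<lambda>\<xi>. symbol 1 r \<upsilon> \<xi> $$ (0, l))) \<and>
     (\<forall>l<r. eq_upto_O N (\<lambda>\<xi>. (symbol 1 r \<upsilon> (2 * \<xi>) * symbol r r a (\<xi> + pi)) $$ (0, l))
                        (\<lambda>\<xi>. 0))"

definition hermite_moments :: "nat \<Rightarrow> (int \<Rightarrow> complex mat) \<Rightarrow> bool" where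
  "hermite_moments r \<upsilon> \<longleftrightarrow>
     (\<forall>l<r. eq_upto_O (l + 1) (\<lambda>\<xi>. symbol 1 r \<upsilon> \<xi> $$ (0, l)) (\<lambda>\<xi>. (\<i> * of_real \<xi>) ^ l))"

definition hermite_factors :: "nat \<Rightarrow> nat \<Rightarrow> (int \<Rightarrow> complex mat) \<Rightarrow> bool" where
  "hermite_factors r N \<upsilon> \<longleftrightarrow>
     (\<exists>c :: nat \<Rightarrow> int \<Rightarrow> complex. \<forall>l<r.
        c l \<in> scalar_finite_seqs \<and> scalar_symbol (c l) 0 = 1 \<and>
        eq_upto_O N (\<lambda>\<xi>. symbol 1 r \<upsilon> \<xi> $$ (0, l))
                    (\<lambda>\<xi>. (\<i> * of_real \<xi>) ^ l * scalar_symbol (c l) \<xi>))"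

primrec symbol_prod :: "nat \<Rightarrow> (int \<Rightarrow> complex mat) \<Rightarrow> nat \<Rightarrow> real \<Rightarrow> complex mat" where
  "symbol_prod r a 0 \<xi> = 1\<^sub>m r"
| "symbol_prod r a (Suc n) \<xi> = symbol_prod r a n \<xi> * symbol r r a (\<xi> / 2 ^ Suc n)"

end

theory Submission
  imports "HOL-Complex_Analysis.Complex_Analysis" Defs
begin

unbundle no vec_syntax
unbundle no Formal_Power_Series.fps_syntax

text \<open>
  Riemann sums turn the uniform limit relation into convergence of \<open>2\<^sup>l\<^sup>n\<close> times column \<open>l\<close> of the
  product \<open>P\<^sub>n(\<xi>)\<close> of \<open>n\<close> symbols to the Fourier transform \<open>(i\<xi>)\<^sup>l\<close> times that of \<open>\<phi>\<close>, together
  with all derivatives at 0. In particular \<open>P\<^sub>n\<close> tends to the rank-one matrix with first column the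
  transform of \<open>\<phi>\<close>, and applying this to \<open>\<phi>(\<xi>) = P\<^sub>n(\<xi>) \<phi>(2\<^sup>-\<^sup>n \<xi>)\<close> (on the Fourier side) gives the
  normalization and the left eigenvector \<open>e\<^sub>1\<close> of the symbol at 0. By the smoothness of \<open>\<phi>\<close>, all
  derivatives of its transform at \<open>2\<^sup>n 2 \<pi> k\<close>, \<open>k \<noteq> 0\<close>, are \<open>o(2\<^sup>-\<^sup>n\<^sup>m)\<close>, and the spanning condition
  at \<open>2 \<pi> k\<close> turns this decay into the bound on the other eigenvalues.

  Since \<open>2\<^sup>-\<^sup>j\<close> is then no eigenvalue for \<open>1 \<le> j \<le> m\<close>, the equation
  \<open>\<upsilon>(2\<xi>) a(\<xi>) = \<upsilon>(\<xi>) + O(\<xi>\<^sup>m\<^sup>+\<^sup>1)\<close> has a solution with \<open>\<upsilon>(0) = e\<^sub>1\<close>, found coefficient by coefficient.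
  The products \<open>\<upsilon>(\<xi>) \<phi>(\<xi> + 2 \<pi> k)\<close> satisfy a scaling relation under \<open>k \<mapsto> 2 k\<close>, so for \<open>k \<noteq> 0\<close> they
  vanish to order \<open>m + 1\<close> by the decay; for odd \<open>k\<close> the spanning condition at \<open>\<pi> + 2 \<pi> k\<close> yields the
  second sum rule. Finally \<open>\<upsilon>(\<xi>) P\<^sub>n(\<xi>) = \<upsilon>(2\<^sup>-\<^sup>n \<xi>) + O(\<xi>\<^sup>m\<^sup>+\<^sup>1)\<close>, and column \<open>l\<close> scaled by
  \<open>2\<^sup>l\<^sup>n\<close> can only converge if \<open>\<upsilon>\<^sub>l\<close> vanishes at 0 to order \<open>l\<close>, with leading coefficient \<open>i\<^sup>l\<close>.
\<close>

section \<open>Fourier transforms of compactly supported functions\<close>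

definition vanishes_outside :: "real \<Rightarrow> (real \<Rightarrow> complex) \<Rightarrow> bool" where
  "vanishes_outside R g \<longleftrightarrow> (\<forall>x. R \<le> \<bar>x\<bar> \<longrightarrow> g x = 0)"

text \<open>A complex frequency and a fixed compact interval make this an entire function for every
  continuous \<open>g\<close>, so derivatives at real points can be treated as Taylor
  coefficients.\<close>

definition FT :: "real \<Rightarrow> (real \<Rightarrow> complex) \<Rightarrow> complex \<Rightarrow> complex" where
  "FT R g z = integral {-R..R} (\<lambda>x. g x * exp (- \<i> * z * of_real x))"

lemma vanishes_outsideD: "vanishes_outside R g \<Longrightarrow> R \<le> \<bar>x\<bar> \<Longrightarrow> g x = 0"
  by (auto simp: vanishes_outside_def)

lemma vanishes_outside_mult: "vanishes_outside R g \<Longrightarrow> vanishes_outside R (\<lambda>x. g x * h x)"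
  by (auto simp: vanishes_outside_def)

lemma lebesgue_integral_vanishing:
  assumes "continuous_on UNIV g" "vanishes_outside R g"
  shows "integrable lborel g" "(LINT x|lborel. g x) = integral {-R..R} g"
proof -
  have c: "continuous_on {-R..R} g"
    using assms(1) continuous_on_subset by blast
  have si: "set_integrable lborel {-R..R} g"
    using c by (rule borel_integrable_atLeastAtMost')
  have eq: "(\<lambda>x. indicator {-R..R} x *\<^sub>R g x) = g"
    using assms(2) by (auto simp: indicator_def vanishes_outside_def fun_eq_iff)
  show "integrable lborel g" using si unfolding set_integrable_def eq .
  show "(LINT x|lborel. g x) = integral {-R..R} g"
    using set_borel_integral_eq_integral(2)[OF si] unfolding set_lebesgue_integral_def eq .
qed

lemma FT_eq_lebesgue:
  assumes "continuous_on UNIV g" "vanishes_outside R g"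
  shows "FT R g z = (LINT x|lborel. g x * exp (- \<i> * z * of_real x))"
  unfolding FT_def
  by (intro lebesgue_integral_vanishing(2)[symmetric] vanishes_outside_mult assms continuous_intros)

lemma FT_has_field_derivative:
  assumes "continuous_on UNIV g"
  shows "(FT R g has_field_derivative FT R (\<lambda>x. - \<i> * of_real x * g x) z) (at z)"
proof -
  have [continuous_intros]: "continuous_on S g" for S
    using assms continuous_on_subset by blast
  have sn: "continuous_on (UNIV \<times> S) (\<lambda>p. g (snd p))" for S
    by (intro continuous_on_compose2[OF assms] continuous_intros) auto
  have "((\<lambda>z. integral (cbox (-R) R) (\<lambda>x. g x * exp (- \<i> * z * of_real x))) has_field_derivative
      integral (cbox (-R) R) (\<lambda>x. - \<i> * of_real x * g x * exp (- \<i> * z * of_real x))) (at z within UNIV)"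
  proof (rule leibniz_rule_field_derivative)
    fix z :: complex and x
    show "((\<lambda>z. g x * exp (- \<i> * z * of_real x)) has_field_derivative
            - \<i> * of_real x * g x * exp (- \<i> * z * of_real x)) (at z within UNIV)"
      by (auto intro!: derivative_eq_intros simp: algebra_simps)
    show "(\<lambda>x. g x * exp (- \<i> * z * of_real x)) integrable_on cbox (- R) R"
      unfolding cbox_interval by (intro integrable_continuous_real continuous_intros)
  next
    show "continuous_on (UNIV \<times> cbox (- R) R)
       (\<lambda>(z, x). - \<i> * complex_of_real x * g x * exp (- \<i> * z * of_real x))"
      unfolding case_prod_unfold by (intro continuous_intros sn)
  qed auto
  thus ?thesis unfolding FT_def[abs_def] by simp
qed

lemma FT_holomorphic: "continuous_on UNIV g \<Longrightarrow> FT R g holomorphic_on S"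
  by (metis FT_has_field_derivative field_differentiable_at_within field_differentiable_def
      holomorphic_on_def)

lemma higher_deriv_FT:
  assumes "continuous_on UNIV g"
  shows "(deriv ^^ n) (FT R g) = FT R (\<lambda>x. (- \<i> * of_real x) ^ n * g x)"
proof (induction n)
  case (Suc n)
  have "deriv (FT R (\<lambda>x. (- \<i> * of_real x) ^ n * g x)) z
      = FT R (\<lambda>x. - \<i> * of_real x * ((- \<i> * of_real x) ^ n * g x)) z" for z
    by (intro DERIV_imp_deriv FT_has_field_derivative continuous_intros assms)
  hence "deriv (FT R (\<lambda>x. (- \<i> * of_real x) ^ n * g x)) = FT R (\<lambda>x. (- \<i> * of_real x) ^ Suc n * g x)"
    by (simp add: fun_eq_iff mult_ac)
  thus ?case by (simp only: funpow.simps o_apply Suc.IH)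
qed simp

text \<open>Integration by parts; the boundary terms drop out because \<open>g\<close> is zero at
  both endpoints.\<close>

lemma FT_deriv:
  assumes "0 \<le> R" "\<And>x. (g has_vector_derivative g' x) (at x)" "continuous_on UNIV g'"
    and "g (-R) = 0" "g R = 0"
  shows "FT R g' z = \<i> * z * FT R g z"
proof -
  have [continuous_intros]: "continuous_on S g" "continuous_on S g'" for S
    using assms(2) has_vector_derivative_continuous continuous_at_imp_continuous_on apply blast
    using assms(3) continuous_on_subset by blast
  have "((\<lambda>x. g' x * exp (- \<i> * z * of_real x) + g x * (- \<i> * z * exp (- \<i> * z * of_real x)))
      has_integral (g R * exp (- \<i> * z * of_real R) - g (-R) * exp (- \<i> * z * of_real (-R)))) {-R..R}"
  proof (rule fundamental_theorem_of_calculus)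
    fix x
    have "((\<lambda>w. exp (- \<i> * z * w)) has_field_derivative (- \<i> * z * exp (- \<i> * z * of_real x))) (at (of_real x))"
      by (auto intro!: derivative_eq_intros)
    from has_vector_derivative_real_field[OF this]
    have "((\<lambda>x. exp (- \<i> * z * of_real x)) has_vector_derivative (- \<i> * z * exp (- \<i> * z * of_real x)))
       (at x within {- R..R})" by blast
    moreover have "(g has_vector_derivative g' x) (at x within {-R..R})"
      using assms(2) has_vector_derivative_at_within by blast
    ultimately show "((\<lambda>x. g x * exp (- \<i> * z * of_real x)) has_vector_derivative
        g' x * exp (- \<i> * z * of_real x) + g x * (- \<i> * z * exp (- \<i> * z * of_real x))) (at x within {-R..R})"
      using has_vector_derivative_mult by (fastforce simp: algebra_simps)
  qed (use assms in auto)
  hence "((\<lambda>x. g' x * exp (- \<i> * z * of_real x) + (- \<i> * z) * (g x * exp (- \<i> * z * of_real x)))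
      has_integral 0) {-R..R}"
    using assms by (simp add: mult_ac)
  moreover have "((\<lambda>x. g' x * exp (- \<i> * z * of_real x) + (- \<i> * z) * (g x * exp (- \<i> * z * of_real x)))
      has_integral (FT R g' z + (- \<i> * z) * FT R g z)) {-R..R}"
    unfolding FT_def
    by (intro has_integral_add has_integral_mult_right integrable_integral integrable_continuous_real continuous_intros)
  ultimately have "0 = FT R g' z + (- \<i> * z) * FT R g z" by (rule has_integral_unique)
  thus ?thesis by (simp add: algebra_simps)
qed

lemma bounded_vanishing:
  assumes "continuous_on UNIV g" "vanishes_outside R g"
  obtains B where "B > 0" "\<And>x. cmod (g x) \<le> B"
proof -
  have "compact (g ` {-R..R})"
    using assms(1) by (intro compact_continuous_image continuous_on_subset[OF assms(1)]) auto
  then obtain B where B: "B > 0" "\<And>y. y \<in> g ` {-R..R} \<Longrightarrow> norm y \<le> B"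
    using compact_imp_bounded bounded_pos by metis
  have "cmod (g x) \<le> B" for x
  proof (cases "\<bar>x\<bar> \<le> R")
    case True thus ?thesis using B(2)[OF imageI[of x "{-R..R}" g]] by (simp add: abs_le_iff)
  next
    case False thus ?thesis using B(1) assms(2) by (auto simp: vanishes_outside_def)
  qed
  thus ?thesis using that B by blast
qed

text \<open>Translating by half a period flips the sign of the exponential.\<close>
lemma riemann_lebesgue:
  assumes g: "continuous_on UNIV g" "vanishes_outside R g" and \<xi>: "filterlim (\<lambda>n. \<bar>\<xi> n\<bar>) at_top sequentially"
  shows "(\<lambda>n. FT R g (complex_of_real (\<xi> n))) \<longlonglongrightarrow> 0"
proof -
  obtain B where B: "B > 0" "\<And>x. cmod (g x) \<le> B" using bounded_vanishing[OF g] by blast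
  define t where "t n = pi / \<xi> n" for n
  have inf: "filterlim \<xi> at_infinity sequentially"
    using \<xi> by (simp add: filterlim_at_infinity_conv_norm_at_top)
  have t0: "t \<longlonglongrightarrow> 0" unfolding t_def
    by (rule tendsto_divide_0[OF tendsto_const inf])
  have t1: "\<forall>\<^sub>F n in sequentially. \<bar>t n\<bar> \<le> 1"
    using tendstoD[OF t0, of 1] by (auto elim!: eventually_mono)
  have nz: "\<forall>\<^sub>F n in sequentially. \<xi> n \<noteq> 0"
    using filterlim_at_infinity_imp_eventually_ne inf by blast
  have [continuous_intros]: "continuous_on S g" for S
    using assms(1) continuous_on_subset by blast
  \<comment> \<open>From index \<open>N\<close> on, the translates by \<open>t n\<close> vanish
    outside \<open>{-R-1..R+1}\<close>, which gives one dominating function, and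
    \<open>\<xi> n\<close> is nonzero, so \<open>t n\<close> is a genuine half period.\<close>
  obtain N where N: "\<And>n. n \<ge> N \<Longrightarrow> \<bar>t n\<bar> \<le> 1 \<and> \<xi> n \<noteq> 0"
    using eventually_conj[OF t1 nz] by (auto simp: eventually_sequentially)
  \<comment> \<open>The transform is combined with its translated copy: the integral of
    \<open>h n\<close> is twice the transform, while \<open>h n\<close> tends to 0 pointwise by
    continuity of \<open>g\<close>.\<close>
  define h where "h n x = (g x - g (t n + x)) * exp (- \<i> * of_real (\<xi> n) * of_real x)" for n x
  have gt: "continuous_on UNIV (\<lambda>x. g (t n + x))" for n
    by (intro continuous_on_compose2[OF g(1)] continuous_intros) auto
  have vt: "vanishes_outside (R + \<bar>t n\<bar>) (\<lambda>x. g (t n + x))" for n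
    using g(2) unfolding vanishes_outside_def by (auto simp: abs_if split: if_splits)
  have hint: "LINT x|lborel. h n x = 2 * FT R g (\<xi> n)" if "n \<ge> N" for n
  proof -
    have x0: "\<xi> n \<noteq> 0" using N that by auto
    have 1: "FT R g (\<xi> n) = (LINT x|lborel. g x * exp (- \<i> * of_real (\<xi> n) * of_real x))"
      by (rule FT_eq_lebesgue[OF g])
    also have "\<dots> = (LINT x|lborel. g (t n + x) * exp (- \<i> * of_real (\<xi> n) * of_real (t n + x)))"
      using lborel_integral_real_affine[of 1 "\<lambda>x. g x * exp (- \<i> * of_real (\<xi> n) * of_real x)" "t n"] by simp
    also have "\<dots> = (LINT x|lborel. - (g (t n + x) * exp (- \<i> * of_real (\<xi> n) * of_real x)))"
    proof (intro Bochner_Integration.integral_cong refl)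
      fix x
      have "- \<i> * complex_of_real (\<xi> n) * of_real (t n) = - (\<i> * of_real pi)"
        using x0 unfolding t_def by (simp add: field_simps)
      hence "exp (- \<i> * complex_of_real (\<xi> n) * of_real (t n + x))
          = exp (- (\<i> * of_real pi)) * exp (- \<i> * of_real (\<xi> n) * of_real x)"
        by (simp add: exp_add[symmetric] algebra_simps)
      also have "exp (- (\<i> * of_real pi)) = (-1 :: complex)"
        by (simp add: exp_minus)
      finally show "g (t n + x) * exp (- \<i> * of_real (\<xi> n) * of_real (t n + x)) =
         - (g (t n + x) * exp (- \<i> * of_real (\<xi> n) * of_real x))" by simp
    qed
    finally have 2: "FT R g (\<xi> n) = - (LINT x|lborel. g (t n + x) * exp (- \<i> * of_real (\<xi> n) * of_real x))"
      by simp
    have "LINT x|lborel. h n x = (LINT x|lborel. g x * exp (- \<i> * of_real (\<xi> n) * of_real x))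
       - (LINT x|lborel. g (t n + x) * exp (- \<i> * of_real (\<xi> n) * of_real x))"
      unfolding h_def left_diff_distrib
      by (intro Bochner_Integration.integral_diff
          lebesgue_integral_vanishing(1)[where R=R] lebesgue_integral_vanishing(1)[where R="R + \<bar>t n\<bar>"]
          vanishes_outside_mult g vt gt continuous_intros)
    thus ?thesis using 1 2 by simp
  qed
  have "(\<lambda>n. LINT x|lborel. h (n + N) x) \<longlonglongrightarrow> (LINT x|(lborel::real measure). (0::complex))"
  proof (rule integral_dominated_convergence[where s = "\<lambda>n. h (n + N)" and f = "\<lambda>_. 0" and w = "\<lambda>x. 2 * B * indicator {-R-1..R+1} (x::real)"])
    show "(\<lambda>x. h (n + N) x) \<in> borel_measurable lborel" for n
      unfolding h_def measurable_lborel2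
      by (intro borel_measurable_continuous_onI continuous_intros gt)
    show "integrable lborel (\<lambda>x. 2 * B * indicator {-R-1..R+1} (x::real))"
      by (intro integrable_mult_right integrable_real_indicator) (auto simp: emeasure_lborel_Icc_eq)
    show "AE x in lborel. (\<lambda>n. h (n + N) x) \<longlonglongrightarrow> 0"
    proof (rule AE_I2)
      fix x :: real
      have "isCont g x" using g(1) by (simp add: continuous_on_eq_continuous_at)
      moreover have "(\<lambda>n. t n + x) \<longlonglongrightarrow> 0 + x" by (intro tendsto_intros t0)
      ultimately have "(\<lambda>n. g (t n + x)) \<longlonglongrightarrow> g x"
        using isCont_tendsto_compose by fastforce
      hence "(\<lambda>n. g x - g (t n + x)) \<longlonglongrightarrow> g x - g x" by (intro tendsto_intros)
      hence "(\<lambda>n. cmod (g x - g (t n + x))) \<longlonglongrightarrow> 0" using tendsto_norm by fastforce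
      hence "(\<lambda>n. cmod (h n x)) \<longlonglongrightarrow> 0"
        by (simp add: h_def norm_mult)
      hence "(\<lambda>n. h n x) \<longlonglongrightarrow> 0" using tendsto_norm_zero_iff by blast
      thus "(\<lambda>n. h (n + N) x) \<longlonglongrightarrow> 0" by (rule LIMSEQ_ignore_initial_segment)
    qed
    show "AE x in lborel. norm (h (n + N) x) \<le> 2 * B * indicator {-R-1..R+1} (x::real)" for n
    proof (rule AE_I2)
      fix x :: real
      have e: "cmod (exp (- \<i> * of_real (\<xi> (n+N)) * of_real x)) = 1" by simp
      show "norm (h (n + N) x) \<le> 2 * B * indicator {-R-1..R+1} x"
      proof (cases "x \<in> {-R-1..R+1}")
        case True
        have "cmod (g x - g (t (n + N) + x)) \<le> B + B"
          using B(2) by (intro order_trans[OF norm_triangle_ineq4] add_mono) auto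
        thus ?thesis using True e by (simp add: h_def norm_mult)
      next
        case False
        have "\<bar>t (n+N)\<bar> \<le> 1" using N by auto
        hence "g x = 0" "g (t (n+N) + x) = 0"
          using False by (auto intro!: vanishes_outsideD[OF g(2)])
        thus ?thesis using False by (simp add: h_def)
      qed
    qed
  qed simp
  hence "(\<lambda>n. 2 * FT R g (\<xi> (n + N))) \<longlonglongrightarrow> 0" using hint by simp
  hence "(\<lambda>n. FT R g (\<xi> (n + N))) \<longlonglongrightarrow> 0" 
    using tendsto_mult_left_iff[of 2 "\<lambda>n. FT R g (\<xi> (n + N))" 0] by simp
  thus ?thesis by (rule LIMSEQ_offset)
qed

section \<open>Riemann sums on dyadic grids\<close>

lemma dyadic_floor_tendsto: "(\<lambda>n. of_int \<lfloor>2 ^ n * (x::real)\<rfloor> / 2 ^ n) \<longlonglongrightarrow> x"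
proof (rule LIMSEQ_I)
  fix e :: real assume "e > 0"
  then obtain n0 where n0: "(1/2) ^ n0 < e"
    using real_arch_pow_inv[of e "1/2"] by auto
  have "norm (of_int \<lfloor>2 ^ n * x\<rfloor> / 2 ^ n - x) < e" if "n \<ge> n0" for n
  proof -
    have "\<bar>of_int \<lfloor>2 ^ n * x\<rfloor> - 2 ^ n * x\<bar> \<le> 1" by linarith
    hence "\<bar>(of_int \<lfloor>2 ^ n * x\<rfloor> - 2 ^ n * x) / 2 ^ n\<bar> \<le> 1 / 2 ^ n"
      unfolding abs_divide by (simp add: divide_right_mono)
    hence "\<bar>of_int \<lfloor>2 ^ n * x\<rfloor> / 2 ^ n - x\<bar> \<le> (1/2) ^ n"
      by (simp add: diff_divide_distrib power_divide)
    also have "\<dots> \<le> (1/2) ^ n0" using that by (intro power_decreasing) auto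
    finally show ?thesis using n0 by simp
  qed
  thus "\<exists>no. \<forall>n\<ge>no. norm (of_int \<lfloor>2 ^ n * x\<rfloor> / 2 ^ n - x) < e" by blast
qed

text \<open>Riemann sums are integrals of step functions, so dominated convergence applies.\<close>
lemma riemann_sum_limit:
  fixes f :: "real \<Rightarrow> complex" and u :: "nat \<Rightarrow> int \<Rightarrow> complex" and M :: nat
  assumes f: "continuous_on UNIV f" "vanishes_outside M f"
    and supp: "\<And>n k. int M * 2 ^ n < \<bar>k\<bar> \<Longrightarrow> u n k = 0"
    and lim: "\<And>e. e > 0 \<Longrightarrow> \<forall>\<^sub>F n in sequentially. \<forall>k. cmod (u n k - f (of_int k / 2 ^ n)) \<le> e"
  shows "(\<lambda>n. (\<Sum>k\<in>{-(int M * 2 ^ n)..int M * 2 ^ n}. u n k) / 2 ^ n) \<longlonglongrightarrow> integral {-real M..real M} f"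
proof -
  define s where "s n x = u n \<lfloor>2 ^ n * x\<rfloor>" for n and x :: real
  obtain B where B: "B > 0" "\<And>x. cmod (f x) \<le> B" using bounded_vanishing[OF f] by blast
  \<comment> \<open>From index \<open>N\<close> on, the samples differ from those of
    \<open>f\<close> by at most 1, so \<open>B + 1\<close> bounds the step functions.\<close>
  obtain N where N: "\<And>n k. n \<ge> N \<Longrightarrow> cmod (u n k - f (of_int k / 2 ^ n)) \<le> 1"
    using lim[of 1] by (auto simp: eventually_sequentially)
  let ?K = "\<lambda>n. {-(int M * 2 ^ n)..int M * 2 ^ n}"
  let ?I = "\<lambda>n k. {of_int k / 2 ^ n..<(of_int k + 1) / 2 ^ n} :: real set"
  have I: "x \<in> ?I n k \<longleftrightarrow> k = \<lfloor>2 ^ n * x\<rfloor>" for n k x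
    by (auto simp: floor_eq_iff field_simps eq_commute[of k])
  \<comment> \<open>Writing the step function as a finite combination of indicators of grid cells
    gives both its measurability and its integral; samples beyond \<open>?K n\<close> vanish by
    \<open>supp\<close>.\<close>
  have s: "s n x = (\<Sum>k\<in>?K n. u n k * indicator (?I n k) x)" for n x
  proof -
    have "(\<Sum>k\<in>?K n. u n k * indicator (?I n k) x) = (\<Sum>k\<in>?K n. if k = \<lfloor>2 ^ n * x\<rfloor> then u n k else 0)"
      by (intro sum.cong refl) (auto simp: indicator_def simp del: atLeastLessThan_iff simp: I)
    also have "\<dots> = (if \<lfloor>2 ^ n * x\<rfloor> \<in> ?K n then u n \<lfloor>2 ^ n * x\<rfloor> else 0)"
      by (subst sum.delta) auto
    also have "\<dots> = s n x" unfolding s_def using supp[of n "\<lfloor>2 ^ n * x\<rfloor>"] by auto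
    finally show ?thesis ..
  qed
  have ind: "integrable lborel (\<lambda>x. u n k * indicator (?I n k) x)"
    "(LINT x|lborel. u n k * indicator (?I n k) x) = u n k / 2 ^ n" for n k
  proof -
    have e: "emeasure lborel (?I n k) = ennreal (1 / 2 ^ n)"
      by (subst emeasure_lborel_Ico) (auto simp: divide_simps diff_divide_distrib[symmetric])
    have i: "integrable lborel (indicator (?I n k) :: real \<Rightarrow> complex)"
      "integral\<^sup>L lborel (indicator (?I n k) :: real \<Rightarrow> complex) = 1 / 2 ^ n"
    proof -
      have m: "measure lborel (?I n k) = 1 / 2 ^ n" using e by (simp add: measure_def)
      have f: "(\<lambda>x. indicator (?I n k) x *\<^sub>R (1::complex)) = indicator (?I n k)"
        by (auto simp: indicator_def fun_eq_iff)
      have "has_bochner_integral lborel (\<lambda>x. indicator (?I n k) x *\<^sub>R (1::complex)) (measure lborel (?I n k) *\<^sub>R 1)"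
        by (rule has_bochner_integral_indicator) (use e in auto)
      hence h: "has_bochner_integral lborel (indicator (?I n k)) (1 / 2 ^ n :: complex)"
        unfolding m f by (simp add: scaleR_conv_of_real)
      show "integrable lborel (indicator (?I n k) :: real \<Rightarrow> complex)"
        "integral\<^sup>L lborel (indicator (?I n k) :: real \<Rightarrow> complex) = 1 / 2 ^ n"
        using h by (auto simp: has_bochner_integral_iff)
    qed
    show "integrable lborel (\<lambda>x. u n k * indicator (?I n k) x)" using i(1) by simp
    show "(LINT x|lborel. u n k * indicator (?I n k) x) = u n k / 2 ^ n" using i(2) by simp
  qed
  have sint: "(LINT x|lborel. s n x) = (\<Sum>k\<in>?K n. u n k) / 2 ^ n" for n
    unfolding s by (subst Bochner_Integration.integral_sum) (simp_all only: ind sum_divide_distrib)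
  have "(\<lambda>n. LINT x|lborel. s (n + N) x) \<longlonglongrightarrow> (LINT x|lborel. f x)"
  proof (rule integral_dominated_convergence[where w = "\<lambda>x. (B + 1) * indicator {-real M-1..real M+1} (x::real)"])
    show "f \<in> borel_measurable lborel"
      using f(1) by (simp add: borel_measurable_continuous_onI)
    show "s (n + N) \<in> borel_measurable lborel" for n
      unfolding s using ind(1) borel_measurable_integrable by (intro borel_measurable_sum) blast
    show "integrable lborel (\<lambda>x. (B + 1) * indicator {-real M-1..real M+1} (x::real))"
      by (intro integrable_mult_right integrable_real_indicator) (auto simp: emeasure_lborel_Icc_eq)
    show "AE x in lborel. (\<lambda>n. s (n + N) x) \<longlonglongrightarrow> f x"
    proof (rule AE_I2)
      fix x :: real
      note fl = dyadic_floor_tendsto[of x]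
      have "isCont f x" using f(1) by (simp add: continuous_on_eq_continuous_at)
      hence 1: "(\<lambda>n. f (of_int \<lfloor>2 ^ n * x\<rfloor> / 2 ^ n)) \<longlonglongrightarrow> f x"
        using fl isCont_tendsto_compose by fast
      have 2: "(\<lambda>n. s n x - f (of_int \<lfloor>2 ^ n * x\<rfloor> / 2 ^ n)) \<longlonglongrightarrow> 0"
        unfolding tendsto_iff
      proof safe
        fix e :: real assume "e > 0"
        hence "\<forall>\<^sub>F n in sequentially. \<forall>k. cmod (u n k - f (of_int k / 2 ^ n)) \<le> e / 2" using lim[of "e/2"] by simp
        thus "\<forall>\<^sub>F n in sequentially. dist (s n x - f (of_int \<lfloor>2 ^ n * x\<rfloor> / 2 ^ n)) 0 < e"
        proof eventually_elim
          case (elim n)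
          hence "cmod (s n x - f (of_int \<lfloor>2 ^ n * x\<rfloor> / 2 ^ n)) \<le> e / 2" unfolding s_def by blast
          also have "\<dots> < e" using \<open>e > 0\<close> by simp
          finally show ?case by simp
        qed
      qed
      have "(\<lambda>n. s n x) \<longlonglongrightarrow> f x" using tendsto_add[OF 2 1] by simp
      thus "(\<lambda>n. s (n + N) x) \<longlonglongrightarrow> f x" by (rule LIMSEQ_ignore_initial_segment)
    qed
    show "AE x in lborel. norm (s (n + N) x) \<le> (B + 1) * indicator {-real M-1..real M+1} x" for n
    proof (rule AE_I2)
      fix x :: real
      show "norm (s (n + N) x) \<le> (B + 1) * indicator {-real M-1..real M+1} x"
      proof (cases "x \<in> {-real M-1..real M+1}")
        case True
        let ?k = "\<lfloor>2 ^ (n+N) * x\<rfloor>"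
        have "cmod (s (n+N) x) \<le> cmod (f (of_int ?k / 2 ^ (n+N))) + cmod (s (n+N) x - f (of_int ?k / 2 ^ (n+N)))"
          by (rule norm_triangle_sub)
        also have "\<dots> \<le> B + 1" unfolding s_def by (intro add_mono B N) auto
        finally show ?thesis using True by simp
      next
        case False
        \<comment> \<open>The margin of 1 in the dominating interval absorbs the rounding: for such
          \<open>x\<close> the rounded index still lies beyond the support of
          \<open>u\<close>.\<close>
        have "int M * 2 ^ (n+N) < \<bar>\<lfloor>2 ^ (n+N) * x\<rfloor>\<bar>"
        proof (cases "x > 0")
          case True
          hence "x > real M + 1" using False by auto
          hence "2 ^ (n+N) * (real M + 1) < 2 ^ (n+N) * x" by simp
          moreover have "(1::real) \<le> 2 ^ (n+N)" by simp
          moreover have "2 ^ (n+N) * (real M + 1) = real M * 2 ^ (n+N) + 2 ^ (n+N)" by (simp add: algebra_simps)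
          ultimately have "real M * 2 ^ (n+N) + 1 \<le> 2 ^ (n+N) * x" by linarith
          hence "int M * 2 ^ (n+N) + 1 \<le> \<lfloor>2 ^ (n+N) * x\<rfloor>" by (simp add: le_floor_iff)
          thus ?thesis by linarith
        next
          case False
          hence "x < - real M - 1" using \<open>x \<notin> _\<close> by auto
          hence "2 ^ (n+N) * x < 2 ^ (n+N) * (- real M - 1)" by simp
          moreover have "(1::real) \<le> 2 ^ (n+N)" by simp
          moreover have "2 ^ (n+N) * (- real M - 1) = - (real M * 2 ^ (n+N)) - 2 ^ (n+N)" by (simp add: algebra_simps)
          ultimately have "2 ^ (n+N) * x < - (real M * 2 ^ (n+N))" by linarith
          hence "\<lfloor>2 ^ (n+N) * x\<rfloor> < - (int M * 2 ^ (n+N))" by (simp add: floor_less_iff)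
          thus ?thesis by linarith
        qed
        thus ?thesis using supp False by (simp add: s_def)
      qed
    qed
  qed
  hence "(\<lambda>n. LINT x|lborel. s n x) \<longlonglongrightarrow> (LINT x|lborel. f x)" by (rule LIMSEQ_offset)
  thus ?thesis unfolding sint lebesgue_integral_vanishing(2)[OF f] by simp
qed

section \<open>Jets of entire functions as power series\<close>

lemma fps_nth_fps_expansion: "fps_nth (fps_expansion F z) n = (deriv ^^ n) F z / fact n"
  by (simp add: fps_expansion_def)

lemma entire_shift:
  assumes "F holomorphic_on UNIV"
  shows "(\<lambda>w. F (z + c * w)) holomorphic_on UNIV"
  by (rule holomorphic_on_compose_gen[OF _ assms, unfolded o_def]) (auto intro!: holomorphic_intros)

lemma fps_expansion_shift_scale:
  assumes "F holomorphic_on UNIV"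
  shows "fps_nth (fps_expansion (\<lambda>w. F (z + c * w)) 0) n = c ^ n * fps_nth (fps_expansion F z) n"
  using higher_deriv_compose_linear'[OF assms, of UNIV 0 c z n]
  by (simp add: fps_nth_fps_expansion add.commute)

lemma entire_has_fps_expansion:
  assumes "F holomorphic_on UNIV"
  shows "(\<lambda>w. F (z + w)) has_fps_expansion fps_expansion F z"
  by (rule analytic_at_imp_has_fps_expansion) (metis assms analytic_on_def analytic_on_open open_UNIV analytic_on_subset subset_UNIV)

lemma fps_expansion_mult:
  assumes "F holomorphic_on UNIV" "G holomorphic_on UNIV"
  shows "fps_expansion (\<lambda>w. F w * G w) z = fps_expansion F z * fps_expansion G z"
proof -
  have "(\<lambda>w. F (z + w) * G (z + w)) has_fps_expansion fps_expansion (\<lambda>w. F w * G w) z"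
    by (rule entire_has_fps_expansion[of "\<lambda>w. F w * G w"]) (intro holomorphic_intros assms)
  moreover have "(\<lambda>w. F (z + w) * G (z + w)) has_fps_expansion fps_expansion F z * fps_expansion G z"
    by (intro fps_expansion_intros entire_has_fps_expansion assms)
  ultimately show ?thesis using fps_expansion_unique_complex by blast
qed

lemma fps_expansion_add:
  assumes "F holomorphic_on UNIV" "G holomorphic_on UNIV"
  shows "fps_expansion (\<lambda>w. F w + G w) z = fps_expansion F z + fps_expansion G z"
proof -
  have "(\<lambda>w. F (z + w) + G (z + w)) has_fps_expansion fps_expansion (\<lambda>w. F w + G w) z"
    by (rule entire_has_fps_expansion[of "\<lambda>w. F w + G w"]) (intro holomorphic_intros assms)
  moreover have "(\<lambda>w. F (z + w) + G (z + w)) has_fps_expansion fps_expansion F z + fps_expansion G z"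
    by (intro fps_expansion_intros entire_has_fps_expansion assms)
  ultimately show ?thesis using fps_expansion_unique_complex by blast
qed

lemma fps_expansion_const: "fps_expansion (\<lambda>w. c) z = fps_const c"
  by (rule fps_ext) (auto simp: fps_nth_fps_expansion higher_deriv_const)

lemma fps_expansion_cmult:
  assumes "F holomorphic_on UNIV"
  shows "fps_expansion (\<lambda>w. c * F w) z = fps_const c * fps_expansion F z"
  using fps_expansion_mult[of "\<lambda>_. c" F z] assms by (simp add: fps_expansion_const holomorphic_on_const)

lemma fps_expansion_sum:
  assumes "\<And>i. i \<in> I \<Longrightarrow> F i holomorphic_on UNIV"
  shows "fps_expansion (\<lambda>w. \<Sum>i\<in>I. F i w) z = (\<Sum>i\<in>I. fps_expansion (F i) z)"
  using assms
proof (induction I rule: infinite_finite_induct)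
  case (insert x I)
  thus ?case by (simp add: fps_expansion_add holomorphic_on_sum)
qed (simp_all add: fps_expansion_const)

lemma fps_expansion_exp: "fps_expansion (\<lambda>w. exp (c * w)) 0 = fps_exp c"
  by (rule fps_expansion_eqI) (auto intro!: fps_expansion_intros)

lemma fps_expansion_ident: "fps_expansion (\<lambda>w. w) 0 = fps_X"
  by (rule fps_expansion_eqI) (auto intro!: fps_expansion_intros)

lemma fps_expansion_power:
  assumes "F holomorphic_on UNIV"
  shows "fps_expansion (\<lambda>w. F w ^ n) z = fps_expansion F z ^ n"
  by (induction n) (simp_all add: fps_expansion_const fps_expansion_mult holomorphic_on_power assms)

lemma iter_deriv_entire:
  assumes "F holomorphic_on UNIV"
  shows "iter_deriv n (\<lambda>x. F (of_real x)) = (\<lambda>x. (deriv ^^ n) F (of_real x))"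
proof (induction n)
  case 0
  thus ?case by (simp add: iter_deriv_def)
next
  case (Suc n)
  have "iter_deriv (Suc n) (\<lambda>x. F (of_real x)) x = deriv ((deriv ^^ n) F) (of_real x)" for x
  proof -
    have "((deriv ^^ n) F has_field_derivative deriv ((deriv ^^ n) F) (of_real x)) (at (of_real x))"
      using assms holomorphic_higher_deriv[of F UNIV n] by (intro holomorphic_derivI[of _ UNIV]) auto
    hence "((\<lambda>x. (deriv ^^ n) F (of_real x)) has_vector_derivative deriv ((deriv ^^ n) F) (of_real x)) (at x)"
      by (rule has_vector_derivative_real_field)
    hence "vector_derivative (\<lambda>x. (deriv ^^ n) F (of_real x)) (at x) = deriv ((deriv ^^ n) F) (of_real x)"
      by (rule vector_derivative_at)
    thus ?thesis using Suc by (simp add: iter_deriv_def)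
  qed
  thus ?case by (simp add: fun_eq_iff)
qed

text \<open>This translates the asymptotic relations of the theorem into equality of finitely many
  Taylor coefficients, so that they can be proved by power series algebra.\<close>

lemma eq_upto_O_entire:
  assumes "F holomorphic_on UNIV" "G holomorphic_on UNIV"
    and "\<And>x. f x = F (of_real x)" "\<And>x. g x = G (of_real x)"
  shows "eq_upto_O n f g \<longleftrightarrow> (\<forall>j<n. fps_nth (fps_expansion F 0) j = fps_nth (fps_expansion G 0) j)"
proof -
  have "f = (\<lambda>x. F (of_real x))" "g = (\<lambda>x. G (of_real x))" using assms by auto
  thus ?thesis using assms(1,2)
    by (simp add: eq_upto_O_def iter_deriv_entire fps_nth_fps_expansion)
qed

section \<open>Truncated power series and their dilations\<close>

text \<open>Congruence modulo \<open>fps_X ^ n\<close>.\<close>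

definition fps_eq_upto :: "nat \<Rightarrow> complex fps \<Rightarrow> complex fps \<Rightarrow> bool" where
  "fps_eq_upto n F G \<longleftrightarrow> (\<forall>j<n. fps_nth F j = fps_nth G j)"

lemma fps_eq_upto_refl [simp]: "fps_eq_upto n F F"
  by (simp add: fps_eq_upto_def)

lemma fps_eq_upto_sym: "fps_eq_upto n F G \<Longrightarrow> fps_eq_upto n G F"
  by (simp add: fps_eq_upto_def)

lemma fps_eq_upto_trans [trans]: "fps_eq_upto n F G \<Longrightarrow> fps_eq_upto n G H \<Longrightarrow> fps_eq_upto n F H"
  by (simp add: fps_eq_upto_def)

lemma fps_eq_upto_mult: "fps_eq_upto n F G \<Longrightarrow> fps_eq_upto n F' G' \<Longrightarrow> fps_eq_upto n (F * F') (G * G')"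
  unfolding fps_eq_upto_def fps_mult_nth by (auto intro!: sum.cong)

lemma fps_eq_upto_sum: "(\<And>i. i \<in> I \<Longrightarrow> fps_eq_upto n (F i) (G i)) \<Longrightarrow> fps_eq_upto n (sum F I) (sum G I)"
  unfolding fps_eq_upto_def fps_sum_nth by (auto intro!: sum.cong)

text \<open>Substitution of \<open>c * fps_X\<close> for the variable, i.e. the effect on a jet at 0
  of dilating the argument by \<open>c\<close>.\<close>

definition fps_scale :: "complex \<Rightarrow> complex fps \<Rightarrow> complex fps" where
  "fps_scale c F = Abs_fps (\<lambda>n. c ^ n * fps_nth F n)"

lemma fps_scale_nth [simp]: "fps_nth (fps_scale c F) n = c ^ n * fps_nth F n"
  by (simp add: fps_scale_def)

lemma fps_scale_mult: "fps_scale c (F * G) = fps_scale c F * fps_scale c G"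
proof (rule fps_ext)
  fix n
  have "c ^ n * (fps_nth F i * fps_nth G (n - i)) = c ^ i * fps_nth F i * (c ^ (n - i) * fps_nth G (n - i))"
    if "i \<le> n" for i
  proof -
    have "c ^ n = c ^ i * c ^ (n - i)" using that by (simp add: power_add[symmetric])
    thus ?thesis by (simp add: mult_ac)
  qed
  thus "fps_nth (fps_scale c (F * G)) n = fps_nth (fps_scale c F * fps_scale c G) n"
    unfolding fps_mult_nth sum_distrib_left fps_scale_nth by (rule sum.cong[OF refl]) auto
qed

lemma fps_scale_sum: "fps_scale c (sum F I) = (\<Sum>i\<in>I. fps_scale c (F i))"
  by (rule fps_ext) (auto simp: fps_sum_nth sum_distrib_left)

lemma fps_scale_scale: "fps_scale c (fps_scale d F) = fps_scale (c * d) F"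
  by (rule fps_ext) (auto simp: power_mult_distrib)

lemma fps_scale_1 [simp]: "fps_scale 1 F = F"
  by (rule fps_ext) auto

lemma fps_eq_upto_scale: "fps_eq_upto n F G \<Longrightarrow> fps_eq_upto n (fps_scale c F) (fps_scale c G)"
  by (simp add: fps_eq_upto_def)

lemma fps_expansion_scale:
  assumes "F holomorphic_on UNIV"
  shows "fps_expansion (\<lambda>w. F (z + c * w)) 0 = fps_scale c (fps_expansion F z)"
  by (rule fps_ext) (simp add: fps_expansion_shift_scale assms)

section \<open>Trigonometric polynomials and their jets\<close>

text \<open>An entire extension of the symbol of a finitely supported sequence. For infinite support
  the sum is 0 by convention, which is why holomorphy and periodicity are stated for arbitrary
  \<open>c\<close>.\<close>

definition trig_poly :: "(int \<Rightarrow> complex) \<Rightarrow> complex \<Rightarrow> complex" where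
  "trig_poly c z = (\<Sum>k | c k \<noteq> 0. c k * exp (- \<i> * of_int k * z))"

lemma trig_poly_eq:
  assumes "finite K" "\<And>k. k \<notin> K \<Longrightarrow> c k = 0"
  shows "trig_poly c z = (\<Sum>k\<in>K. c k * exp (- \<i> * of_int k * z))"
  unfolding trig_poly_def using assms by (intro sum.mono_neutral_left) auto

lemma scalar_symbol_eq_trig_poly:
  assumes "finite {k. c k \<noteq> 0}"
  shows "scalar_symbol c \<xi> = trig_poly c (of_real \<xi>)"
proof -
  have "scalar_symbol c \<xi> = infsum (\<lambda>k. c k * exp (- \<i> * of_int k * of_real \<xi>)) {k. c k \<noteq> 0}"
    unfolding scalar_symbol_def by (rule infsum_cong_neutral) auto
  thus ?thesis unfolding trig_poly_def by (simp only: infsum_finite[OF assms])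
qed

lemma trig_poly_holomorphic: "trig_poly c holomorphic_on S"
  unfolding trig_poly_def[abs_def] by (intro holomorphic_intros)

lemma trig_poly_periodic: "trig_poly c (z + 2 * of_real pi * of_int k) = trig_poly c z"
proof -
  have "exp (- \<i> * of_int j * (z + 2 * of_real pi * of_int k)) = exp (- \<i> * of_int j * z)" for j
  proof -
    have "- \<i> * of_int j * (z + 2 * of_real pi * of_int k) = - \<i> * of_int j * z + 2 * of_int (- j * k) * of_real pi * \<i>"
      by (simp add: algebra_simps)
    thus ?thesis using exp_plus_2pin[of "- \<i> * of_int j * z" "- j * k"] by (simp add: mult_ac)
  qed
  thus ?thesis unfolding trig_poly_def by simp
qed

text \<open>The jets at 0 of trigonometric polynomials are arbitrary because
  \<open>(1 - exp (- \<i> \<xi>)) ^ j\<close> vanishes there to order exactly \<open>j\<close>.\<close>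
lemma trig_poly_jet_exists:
  "\<exists>c. finite {k. c k \<noteq> 0} \<and> fps_eq_upto n (fps_expansion (trig_poly c) 0) F"
proof -
  define E :: "complex fps" where "E = fps_exp (- \<i>)"
  \<comment> \<open>\<open>ev p\<close> is \<open>p\<close> evaluated at the jet of
    \<open>exp (- \<i> * z)\<close>; multiplicativity turns the polynomial
    \<open>[:1, -1:] ^ n\<close> into \<open>(1 - E) ^ n\<close>.\<close>
  define ev where "ev p = (\<Sum>k\<le>degree p. fps_const (coeff p k) * E ^ k)" for p :: "complex poly"
  have ev: "ev p = poly (map_poly fps_const p) E" for p
    unfolding ev_def poly_altdef
    by (subst degree_map_poly) (auto simp: coeff_map_poly)
  interpret H: map_poly_comm_ring_hom "fps_const :: complex \<Rightarrow> complex fps"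
    by unfold_locales auto
  have ev_add: "ev (p + q) = ev p + ev q" and ev_mult: "ev (p * q) = ev p * ev q" for p q
    unfolding ev by (simp_all add: H.hom_add H.hom_mult)
  have ev_pow: "ev (p ^ k) = ev p ^ k" for p k
    unfolding ev by (simp add: H.hom_power)
  have sub: "subdegree (1 - E) = 1"
    by (rule subdegreeI) (auto simp: E_def)
  have lead: "fps_nth ((1 - E) ^ k) k \<noteq> 0" "j < k \<Longrightarrow> fps_nth ((1 - E) ^ k) j = 0" for j k
  proof -
    have nz: "1 - E \<noteq> 0" using sub by auto
    have "subdegree ((1 - E) ^ k) = k" by (simp only: subdegree_power sub mult_1_right)
    thus "fps_nth ((1 - E) ^ k) k \<noteq> 0" "j < k \<Longrightarrow> fps_nth ((1 - E) ^ k) j = 0"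
      using nz by (metis nth_subdegree_nonzero power_not_zero, metis nth_less_subdegree_zero)
  qed
  have "\<exists>p. fps_eq_upto n (ev p) F"
  proof (induction n)
    case (Suc n)
    then obtain p where p: "fps_eq_upto n (ev p) F" by blast
    \<comment> \<open>The added multiple of \<open>(1 - E) ^ n\<close> corrects coefficient
      \<open>n\<close> and leaves all lower ones alone.\<close>
    define d where "d = (fps_nth F n - fps_nth (ev p) n) / fps_nth ((1 - E) ^ n) n"
    have "ev (p + [:d:] * [:1, -1:] ^ n) = ev p + fps_const d * (1 - E) ^ n"
    proof -
      have "ev [:d:] = fps_const d" "ev [:1, -1:] = 1 - E" by (simp_all add: ev_def flip: fps_const_neg)
      thus ?thesis unfolding ev_add ev_mult ev_pow by (simp only:)
    qed
    moreover have "fps_eq_upto (Suc n) (ev p + fps_const d * (1 - E) ^ n) F"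
      using p lead unfolding fps_eq_upto_def d_def by (auto simp: less_Suc_eq)
    ultimately show ?case by metis
  qed (auto simp: fps_eq_upto_def)
  then obtain p where p: "fps_eq_upto n (ev p) F" by blast
  \<comment> \<open>The coefficients of \<open>p\<close>, placed at the nonnegative integers, form
    the sequence whose trigonometric polynomial has the jet \<open>ev p\<close>.\<close>
  define c where "c k = (if 0 \<le> k then coeff p (nat k) else 0)" for k :: int
  have supp: "c k = 0" if "k \<notin> int ` {..degree p}" for k
  proof (rule ccontr)
    assume "c k \<noteq> 0"
    hence "int (nat k) = k" "nat k \<in> {..degree p}" by (auto simp: c_def le_degree split: if_splits)
    thus False using that by (metis imageI)
  qed
  have fin: "finite {k. c k \<noteq> 0}"
    by (rule finite_subset[of _ "int ` {..degree p}"]) (use supp in auto)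
  have tp: "trig_poly c = (\<lambda>z. \<Sum>k\<le>degree p. coeff p k * exp (- \<i> * z) ^ k)"
  proof
    fix z
    have "trig_poly c z = (\<Sum>k\<in>int ` {..degree p}. c k * exp (- \<i> * of_int k * z))"
      by (rule trig_poly_eq) (use supp in auto)
    also have "\<dots> = (\<Sum>k\<le>degree p. coeff p k * exp (of_nat k * (- \<i> * z)))"
      by (subst sum.reindex) (auto simp: c_def mult_ac)
    finally show "trig_poly c z = (\<Sum>k\<le>degree p. coeff p k * exp (- \<i> * z) ^ k)"
      by (simp only: exp_of_nat_mult)
  qed
  have "fps_expansion (trig_poly c) 0 = ev p"
    unfolding tp ev_def E_def fps_expansion_exp[symmetric]
    by (simp add: fps_expansion_sum fps_expansion_cmult fps_expansion_power holomorphic_intros)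
  thus ?thesis using p fin by auto
qed

section \<open>Iterates of the subdivision operator\<close>

lemma trig_poly_add:
  assumes "finite {k. u k \<noteq> 0}" "finite {k. v k \<noteq> 0}"
  shows "trig_poly (\<lambda>k. u k + v k) z = trig_poly u z + trig_poly v z"
proof -
  have f: "finite ({k. u k \<noteq> 0} \<union> {k. v k \<noteq> 0})" using assms by simp
  show ?thesis
    by (subst (1 2 3) trig_poly_eq[OF f]) (auto simp: sum.distrib algebra_simps)
qed

lemma trig_poly_0 [simp]: "trig_poly (\<lambda>_. 0) z = 0"
  by (simp add: trig_poly_def)

lemma trig_poly_sum:
  assumes "finite Q" "\<And>q. q \<in> Q \<Longrightarrow> finite {k. u q k \<noteq> 0}"
  shows "trig_poly (\<lambda>k. \<Sum>q\<in>Q. u q k) z = (\<Sum>q\<in>Q. trig_poly (u q) z)"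
  using assms
proof (induction Q)
  case (insert x F)
  have "finite {k. (\<Sum>q\<in>F. u q k) \<noteq> 0}"
    by (rule finite_subset[of _ "\<Union>q\<in>F. {k. u q k \<noteq> 0}"]) (use insert in \<open>auto dest: sum.not_neutral_contains_not_neutral\<close>)
  thus ?case using insert by (simp add: trig_poly_add)
qed simp

lemma trig_poly_cmult: "trig_poly (\<lambda>k. c * u k) z = c * trig_poly u z"
  by (cases "c = 0") (simp_all add: trig_poly_def sum_distrib_left mult_ac)

text \<open>Shifting a sequence by \<open>2 * k\<close> multiplies its trigonometric polynomial by
  \<open>exp (- \<i> * of_int k * (2 * z))\<close>; summing over \<open>k\<close> produces the
  doubled frequency. Up to the factor 2 this is one scalar subdivision step.\<close>

lemma trig_poly_subdivision:
  assumes "finite K" "\<And>k. k \<notin> K \<Longrightarrow> u k = 0" "finite {k. v k \<noteq> 0}"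
  shows "trig_poly (\<lambda>j. \<Sum>k\<in>K. u k * v (j - 2 * k)) z = trig_poly u (2 * z) * trig_poly v z"
    and "finite {j. (\<Sum>k\<in>K. u k * v (j - 2 * k)) \<noteq> 0}"
proof -
  let ?V = "{k. v k \<noteq> 0}"
  have *: "trig_poly (\<lambda>j. u k * v (j - 2 * k)) z = u k * exp (- \<i> * of_int k * (2 * z)) * trig_poly v z"
    "finite {j. u k * v (j - 2 * k) \<noteq> 0}" for k
  proof -
    have "trig_poly (\<lambda>j. v (j - 2 * k)) z = (\<Sum>j\<in>(\<lambda>j. j + 2 * k) ` ?V. v (j - 2 * k) * exp (- \<i> * of_int j * z))"
    proof (rule trig_poly_eq)
      fix j assume "j \<notin> (\<lambda>j. j + 2 * k) ` ?V"
      moreover have "j = (j - 2 * k) + 2 * k" by simp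
      ultimately show "v (j - 2 * k) = 0" by blast
    qed (use assms(3) in simp)
    also have "\<dots> = (\<Sum>j\<in>?V. v j * exp (- \<i> * of_int (j + 2 * k) * z))"
      by (subst sum.reindex) (auto simp: inj_on_def)
    also have "\<dots> = (\<Sum>j\<in>?V. exp (- \<i> * of_int k * (2 * z)) * (v j * exp (- \<i> * of_int j * z)))"
    proof (rule sum.cong[OF refl])
      fix j
      have "- \<i> * of_int (j + 2 * k) * z = - \<i> * of_int k * (2 * z) + - \<i> * of_int j * z"
        by (simp add: algebra_simps)
      thus "v j * exp (- \<i> * of_int (j + 2 * k) * z) = exp (- \<i> * of_int k * (2 * z)) * (v j * exp (- \<i> * of_int j * z))"
        by (simp only: exp_add) (simp only: mult_ac)
    qed
    also have "\<dots> = exp (- \<i> * of_int k * (2 * z)) * trig_poly v z"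
      by (simp add: trig_poly_def sum_distrib_left)
    finally show "trig_poly (\<lambda>j. u k * v (j - 2 * k)) z = u k * exp (- \<i> * of_int k * (2 * z)) * trig_poly v z"
      by (simp add: trig_poly_cmult)
    show "finite {j. u k * v (j - 2 * k) \<noteq> 0}"
    proof (rule finite_subset)
      show "{j. u k * v (j - 2 * k) \<noteq> 0} \<subseteq> (\<lambda>j. j + 2 * k) ` ?V"
      proof
        fix j assume "j \<in> {j. u k * v (j - 2 * k) \<noteq> 0}"
        hence "j - 2 * k \<in> ?V" by auto
        moreover have "j = (j - 2 * k) + 2 * k" by simp
        ultimately show "j \<in> (\<lambda>j. j + 2 * k) ` ?V" by blast
      qed
    qed (use assms(3) in simp)
  qed
  show "trig_poly (\<lambda>j. \<Sum>k\<in>K. u k * v (j - 2 * k)) z = trig_poly u (2 * z) * trig_poly v z"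
    using assms(1,2) * by (subst trig_poly_sum) (auto simp: trig_poly_eq[of K] sum_distrib_right)
  show "finite {j. (\<Sum>k\<in>K. u k * v (j - 2 * k)) \<noteq> 0}"
    by (rule finite_subset[of _ "\<Union>k\<in>K. {j. u k * v (j - 2 * k) \<noteq> 0}"])
      (use assms * in \<open>auto dest: sum.not_neutral_contains_not_neutral\<close>)
qed

lemma not_in_box: "k \<notin> {-B..B} \<Longrightarrow> B < \<bar>k\<bar>" for k B :: int
  by (auto simp: abs_if)

lemma finite_support_box:
  fixes c :: "int \<Rightarrow> complex"
  assumes "\<And>k. B < \<bar>k\<bar> \<Longrightarrow> c k = 0"
  shows "finite {k. c k \<noteq> 0}"
proof (rule finite_subset)
  show "{k. c k \<noteq> 0} \<subseteq> {-B..B}" using assms not_in_box by blast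
qed simp

text \<open>\<open>A n\<close> is \<open>S\<^sub>a\<^sup>n (\<delta> I\<^sub>r)\<close>. The entries of the symbol are extended to
  entire functions \<open>a_hat i l\<close>, and \<open>P n i l z\<close> is the corresponding extension of
  \<open>2\<^sup>-\<^sup>n\<close> times the symbol of \<open>A n\<close> at \<open>2\<^sup>-\<^sup>n z\<close>, that is, of the product of the first \<open>n\<close>
  symbols at \<open>z / 2, \<dots>, z / 2\<^sup>n\<close>.\<close>

locale mask =
  fixes r :: nat and a :: "int \<Rightarrow> complex mat" and N :: nat
  assumes a_carrier: "a k \<in> carrier_mat r r"
    and a_supp: "int N < \<bar>k\<bar> \<Longrightarrow> a k = 0\<^sub>m r r"
begin

definition A :: "nat \<Rightarrow> int \<Rightarrow> complex mat" where
  "A n = (subdiv r r a ^^ n) (delta_I r)"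

definition a_hat :: "nat \<Rightarrow> nat \<Rightarrow> complex \<Rightarrow> complex" where
  "a_hat i l = trig_poly (\<lambda>k. a k $$ (i, l))"

definition P :: "nat \<Rightarrow> nat \<Rightarrow> nat \<Rightarrow> complex \<Rightarrow> complex" where
  "P n i l z = trig_poly (\<lambda>k. A n k $$ (i, l)) (z / 2 ^ n) / 2 ^ n"

lemma a_fin: "i < r \<Longrightarrow> l < r \<Longrightarrow> finite {k. a k $$ (i, l) \<noteq> 0}"
  by (rule finite_support_box[of "int N"]) (simp add: a_supp)

lemma subdiv_entry:
  assumes w: "\<And>k. w k \<in> carrier_mat r r" and K: "finite K" "\<And>k. k \<notin> K \<Longrightarrow> w k = 0\<^sub>m r r"
    and il: "i < r" "l < r"
  shows "subdiv r r a w j $$ (i, l) = 2 * (\<Sum>k\<in>K. \<Sum>q<r. w k $$ (i, q) * a (j - 2 * k) $$ (q, l))"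
proof -
  have e: "(w k * a (j - 2 * k)) $$ (i, l) = (\<Sum>q<r. w k $$ (i, q) * a (j - 2 * k) $$ (q, l))" for k
    using w[of k] a_carrier[of "j - 2 * k"] il
    by (auto simp: scalar_prod_def atLeast0LessThan intro!: sum.cong)
  have "(\<Sum>\<^sub>\<infinity>k. (w k * a (j - 2 * k)) $$ (i, l)) = (\<Sum>\<^sub>\<infinity>k\<in>K. (w k * a (j - 2 * k)) $$ (i, l))"
    by (rule infsum_cong_neutral) (unfold e, use K(2) il in auto)
  also have "\<dots> = (\<Sum>k\<in>K. (w k * a (j - 2 * k)) $$ (i, l))"
    by (rule infsum_finite[OF K(1)])
  finally show ?thesis using il by (simp add: subdiv_def e)
qed

lemma A_0: "A 0 = delta_I r" and A_Suc: "A (Suc n) = subdiv r r a (A n)"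
  by (simp_all add: A_def)

lemma A_carrier: "A n k \<in> carrier_mat r r"
  by (cases n) (auto simp: A_0 A_Suc delta_I_def subdiv_def)

text \<open>The radius \<open>N + 2 N + ... + 2 ^ (n - 1) N\<close> makes the induction close:
  doubling it and adding \<open>N\<close> gives the next one. The coarser radius
  \<open>int N * 2 ^ n\<close> would not reproduce itself.\<close>

lemma A_supp: "int N * 2 ^ n - int N < \<bar>k\<bar> \<Longrightarrow> A n k = 0\<^sub>m r r"
proof (induction n arbitrary: k)
  case (Suc n)
  show ?case
  proof (rule eq_matI)
    fix i l assume "i < dim_row (0\<^sub>m r r :: complex mat)" "l < dim_col (0\<^sub>m r r :: complex mat)"
    hence il: "i < r" "l < r" by auto
    let ?K = "{-(int N * 2 ^ n - int N)..int N * 2 ^ n - int N}"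
    have "A (Suc n) k $$ (i, l) = 2 * (\<Sum>j\<in>?K. \<Sum>q<r. A n j $$ (i, q) * a (k - 2 * j) $$ (q, l))"
      unfolding A_Suc using A_carrier Suc.IH il by (intro subdiv_entry) (auto simp: abs_le_iff not_le)
    also have "(\<Sum>j\<in>?K. \<Sum>q<r. A n j $$ (i, q) * a (k - 2 * j) $$ (q, l)) = 0"
    proof (intro sum.neutral ballI)
      fix j q assume j: "j \<in> ?K" and q: "q \<in> {..<r}"
      have "int N < \<bar>k - 2 * j\<bar>" using j Suc.prems by (auto simp: abs_if split: if_splits)
      thus "A n j $$ (i, q) * a (k - 2 * j) $$ (q, l) = 0" using a_supp il q by simp
    qed
    finally show "A (Suc n) k $$ (i, l) = 0\<^sub>m r r $$ (i, l)" using il by simp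
  qed (use A_carrier[of "Suc n" k] in auto)
qed (auto simp: A_0 delta_I_def)

lemma A_supp': "int N * 2 ^ n < \<bar>k\<bar> \<Longrightarrow> A n k = 0\<^sub>m r r"
  by (rule A_supp) auto

lemma A_fin: "i < r \<Longrightarrow> l < r \<Longrightarrow> finite {k. A n k $$ (i, l) \<noteq> 0}"
  by (rule finite_support_box[of "int N * 2 ^ n"]) (simp add: A_supp')

text \<open>Any finite \<open>K\<close> covering the support is allowed, so that the summation range
  can be translated in \<open>A_Suc_entry_left\<close>.\<close>

lemma A_Suc_entry:
  assumes "finite K" "{-(int N * 2 ^ n)..int N * 2 ^ n} \<subseteq> K" "i < r" "l < r"
  shows "A (Suc n) j $$ (i, l) = 2 * (\<Sum>k\<in>K. \<Sum>q<r. A n k $$ (i, q) * a (j - 2 * k) $$ (q, l))"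
  unfolding A_Suc
proof (rule subdiv_entry)
  fix k assume "k \<notin> K"
  hence "int N * 2 ^ n < \<bar>k\<bar>" using assms(2) by (intro not_in_box) blast
  thus "A n k = 0\<^sub>m r r" by (rule A_supp')
qed (use assms A_carrier in auto)

text \<open>The recursion for \<open>A\<close> multiplies the newest mask on the right; exchanging
  the finite sums splits off the first mask on the left instead, at the coarse shift
  \<open>2 ^ n * s\<close>. In the limit this becomes the refinement equation.\<close>

lemma A_Suc_entry_left:
  assumes "i < r" "l < r"
  shows "A (Suc n) j $$ (i, l)
    = 2 * (\<Sum>s\<in>{-int N..int N}. \<Sum>t<r. a s $$ (i, t) * A n (j - 2 ^ n * s) $$ (t, l))"
  using assms
proof (induction n arbitrary: i l j)
  case 0
  have "A (Suc 0) j $$ (i, l) = 2 * (\<Sum>q<r. A 0 0 $$ (i, q) * a j $$ (q, l))"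
    unfolding A_Suc by (subst subdiv_entry[of _ "{0}"]) (use 0 A_carrier in \<open>auto simp: A_0 delta_I_def\<close>)
  also have "(\<Sum>q<r. A 0 0 $$ (i, q) * a j $$ (q, l)) = (\<Sum>q<r. if q = i then a j $$ (q, l) else 0)"
    using 0 by (intro sum.cong) (auto simp: A_0 delta_I_def)
  also have "\<dots> = a j $$ (i, l)" using 0 by simp
  finally have 1: "A (Suc 0) j $$ (i, l) = 2 * a j $$ (i, l)" .
  have "(\<Sum>s\<in>{-int N..int N}. \<Sum>t<r. a s $$ (i, t) * A 0 (j - 2 ^ 0 * s) $$ (t, l))
     = (\<Sum>s\<in>{-int N..int N}. if s = j then a j $$ (i, l) else 0)"
  proof (intro sum.cong refl)
    fix s
    have "(\<Sum>t<r. a s $$ (i, t) * A 0 (j - 2 ^ 0 * s) $$ (t, l)) = (\<Sum>t<r. if t = l then (if s = j then a j $$ (i, l) else 0) else 0)"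
      using 0 by (intro sum.cong) (auto simp: A_0 delta_I_def)
    thus "(\<Sum>t<r. a s $$ (i, t) * A 0 (j - 2 ^ 0 * s) $$ (t, l)) = (if s = j then a j $$ (i, l) else 0)"
      using 0 by simp
  qed
  also have "\<dots> = a j $$ (i, l)"
    using a_supp[of j] 0 by (auto simp: not_le abs_if split: if_splits)
  finally show ?case using 1 by simp
next
  case (Suc n)
  let ?S = "{-int N..int N}"
  let ?K = "{-(int N * 2 ^ Suc n)..int N * 2 ^ Suc n}"
  have inner: "A (Suc n) (j - 2 ^ Suc n * s) $$ (t, l) = 2 * (\<Sum>k\<in>?K. \<Sum>q<r. A n (k - 2 ^ n * s) $$ (t, q) * a (j - 2 * k) $$ (q, l))"
    if s: "s \<in> ?S" and t: "t < r" for s t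
  proof -
    \<comment> \<open>\<open>A n\<close> is summed over a translate of \<open>?K\<close>, which
      covers its support because \<open>s\<close> is at most \<open>N\<close> in modulus; reindexing
      then aligns the factor \<open>a (j - 2 * k)\<close> with the outer sum.\<close>
    have "A (Suc n) (j - 2 ^ Suc n * s) $$ (t, l)
      = 2 * (\<Sum>k\<in>(\<lambda>k. k - 2 ^ n * s) ` ?K. \<Sum>q<r. A n k $$ (t, q) * a (j - 2 ^ Suc n * s - 2 * k) $$ (q, l))"
    proof (rule A_Suc_entry)
      show "{-(int N * 2 ^ n)..int N * 2 ^ n} \<subseteq> (\<lambda>k. k - 2 ^ n * s) ` ?K"
      proof
        fix k assume k: "k \<in> {-(int N * 2 ^ n)..int N * 2 ^ n}"
        have "2 ^ n * s \<le> 2 ^ n * int N" "2 ^ n * (- int N) \<le> 2 ^ n * s"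
          using s by (intro mult_left_mono; simp)+
        moreover have "int N * 2 ^ Suc n = 2 * (2 ^ n * int N)" "2 ^ n * (- int N) = - (2 ^ n * int N)"
          by simp_all
        moreover have "- (2 ^ n * int N) \<le> k" "k \<le> 2 ^ n * int N"
          using k by (simp_all add: mult.commute)
        ultimately have "k + 2 ^ n * s \<in> ?K" unfolding atLeastAtMost_iff by linarith
        moreover have "k = (k + 2 ^ n * s) - 2 ^ n * s" by simp
        ultimately show "k \<in> (\<lambda>k. k - 2 ^ n * s) ` ?K" by blast
      qed
    qed (use t Suc.prems in auto)
    also have "\<dots> = 2 * (\<Sum>k\<in>?K. \<Sum>q<r. A n (k - 2 ^ n * s) $$ (t, q) * a (j - 2 * k) $$ (q, l))"
      by (subst sum.reindex) (auto simp: inj_on_def algebra_simps)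
    finally show ?thesis .
  qed
  have "A (Suc (Suc n)) j $$ (i, l) = 2 * (\<Sum>k\<in>?K. \<Sum>q<r. A (Suc n) k $$ (i, q) * a (j - 2 * k) $$ (q, l))"
    by (rule A_Suc_entry) (use Suc.prems in auto)
  also have "\<dots> = 2 * (\<Sum>k\<in>?K. \<Sum>q<r. \<Sum>s\<in>?S. \<Sum>t<r. a s $$ (i, t) * (2 * (A n (k - 2 ^ n * s) $$ (t, q) * a (j - 2 * k) $$ (q, l))))"
    using Suc.prems by (simp add: Suc.IH sum_distrib_left sum_distrib_right mult_ac)
  also have "\<dots> = 2 * (\<Sum>k\<in>?K. \<Sum>s\<in>?S. \<Sum>t<r. \<Sum>q<r. a s $$ (i, t) * (2 * (A n (k - 2 ^ n * s) $$ (t, q) * a (j - 2 * k) $$ (q, l))))"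
  proof -
    have "(\<Sum>q<r. \<Sum>s\<in>?S. \<Sum>t<r. f q s t) = (\<Sum>s\<in>?S. \<Sum>t<r. \<Sum>q<r. f q s t)" for f :: "nat \<Rightarrow> int \<Rightarrow> nat \<Rightarrow> complex"
      by (subst sum.swap) (intro sum.cong refl sum.swap)
    thus ?thesis by simp
  qed
  also have "\<dots> = 2 * (\<Sum>s\<in>?S. \<Sum>t<r. \<Sum>k\<in>?K. \<Sum>q<r. a s $$ (i, t) * (2 * (A n (k - 2 ^ n * s) $$ (t, q) * a (j - 2 * k) $$ (q, l))))"
  proof -
    have "(\<Sum>k\<in>?K. \<Sum>s\<in>?S. \<Sum>t<r. f k s t) = (\<Sum>s\<in>?S. \<Sum>t<r. \<Sum>k\<in>?K. f k s t)" for f :: "int \<Rightarrow> int \<Rightarrow> nat \<Rightarrow> complex"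
      by (subst sum.swap) (intro sum.cong refl sum.swap)
    thus ?thesis by simp
  qed
  also have "\<dots> = 2 * (\<Sum>s\<in>?S. \<Sum>t<r. a s $$ (i, t) * A (Suc n) (j - 2 ^ Suc n * s) $$ (t, l))"
    using inner by (simp add: sum_distrib_left)
  finally show ?case .
qed

lemma P_0: "i < r \<Longrightarrow> l < r \<Longrightarrow> P 0 i l z = (if i = l then 1 else 0)"
proof -
  assume "i < r" "l < r"
  hence "trig_poly (\<lambda>k. A 0 k $$ (i, l)) z = (\<Sum>k\<in>{0}. A 0 k $$ (i, l) * exp (- \<i> * of_int k * z))"
    by (intro trig_poly_eq) (auto simp: A_0 delta_I_def)
  thus ?thesis using \<open>i < r\<close> \<open>l < r\<close> by (simp add: P_def A_0 delta_I_def)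
qed

lemma P_Suc:
  assumes "i < r" "l < r"
  shows "P (Suc n) i l z = (\<Sum>q<r. P n i q z * a_hat q l (z / 2 ^ Suc n))"
proof -
  let ?K = "{-(int N * 2 ^ n)..int N * 2 ^ n}"
  define w where "w = z / 2 ^ Suc n"
  have w2: "2 * w = z / 2 ^ n" by (simp add: w_def)
  have eq: "(\<lambda>j. A (Suc n) j $$ (i, l)) = (\<lambda>j. 2 * (\<Sum>q<r. \<Sum>k\<in>?K. A n k $$ (i, q) * a (j - 2 * k) $$ (q, l)))"
    by (subst A_Suc_entry[of ?K]) (use assms in \<open>auto intro!: ext sum.swap\<close>)
  have "trig_poly (\<lambda>j. \<Sum>k\<in>?K. A n k $$ (i, q) * a (j - 2 * k) $$ (q, l)) w = trig_poly (\<lambda>k. A n k $$ (i, q)) (2 * w) * a_hat q l w"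
    "finite {j. (\<Sum>k\<in>?K. A n k $$ (i, q) * a (j - 2 * k) $$ (q, l)) \<noteq> 0}"
    if "q < r" for q
    unfolding a_hat_def using assms that a_fin A_supp'[of n]
    by (intro trig_poly_subdivision[of ?K "\<lambda>k. A n k $$ (i, q)" "\<lambda>k. a k $$ (q, l)"]; force)+
  hence "trig_poly (\<lambda>j. A (Suc n) j $$ (i, l)) w = 2 * (\<Sum>q<r. trig_poly (\<lambda>k. A n k $$ (i, q)) (2 * w) * a_hat q l w)"
    unfolding eq trig_poly_cmult by (subst trig_poly_sum) auto
  thus ?thesis unfolding P_def w_def[symmetric] w2[symmetric]
    by (simp add: sum_divide_distrib)
qed

text \<open>The splitting on the left, on the frequency side; its limit is the refinement equation
  for \<open>phi_hat\<close>.\<close>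

lemma P_Suc_left:
  assumes "i < r" "l < r"
  shows "P (Suc n) i l (2 * z) = (\<Sum>q<r. a_hat i q z * P n q l z)"
  using assms
proof (induction n arbitrary: l)
  case 0
  have "P (Suc 0) i l (2 * z) = (\<Sum>q<r. if q = i then a_hat q l z else 0)"
    unfolding P_Suc[OF 0] using 0 by (intro sum.cong) (auto simp: P_0)
  also have "\<dots> = a_hat i l z" using 0 by simp
  also have "\<dots> = (\<Sum>q<r. if q = l then a_hat i q z else 0)" using 0 by simp
  also have "\<dots> = (\<Sum>q<r. a_hat i q z * P 0 q l z)"
    using 0 by (intro sum.cong) (auto simp: P_0)
  finally show ?case .
next
  case (Suc n)
  have z: "2 * z / 2 ^ Suc (Suc n) = z / 2 ^ Suc n" by simp
  have "P (Suc (Suc n)) i l (2 * z) = (\<Sum>t<r. (\<Sum>q<r. a_hat i q z * P n q t z) * a_hat t l (z / 2 ^ Suc n))"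
    unfolding P_Suc[OF Suc.prems, of "Suc n"] z using Suc by simp
  also have "\<dots> = (\<Sum>q<r. \<Sum>t<r. a_hat i q z * (P n q t z * a_hat t l (z / 2 ^ Suc n)))"
    unfolding sum_distrib_right by (subst sum.swap) (simp add: mult.assoc)
  also have "\<dots> = (\<Sum>q<r. a_hat i q z * P (Suc n) q l z)"
    using Suc.prems by (simp add: P_Suc sum_distrib_left)
  finally show ?case .
qed

lemma a_hat_holomorphic: "a_hat i l holomorphic_on S"
  unfolding a_hat_def by (rule trig_poly_holomorphic)

lemma a_hat_periodic: "a_hat i l (z + 2 * of_real pi * of_int k) = a_hat i l z"
  unfolding a_hat_def by (rule trig_poly_periodic)

lemma symbol_entry: "i < r \<Longrightarrow> l < r \<Longrightarrow> symbol r r a \<xi> $$ (i, l) = a_hat i l (of_real \<xi>)"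
  by (simp add: symbol_def a_hat_def scalar_symbol_eq_trig_poly a_fin)

lemma symbol_carrier: "symbol r r a \<xi> \<in> carrier_mat r r"
  by (simp add: symbol_def)

lemma symbol_prod_carrier: "symbol_prod r a n \<xi> \<in> carrier_mat r r"
  by (induction n) (auto simp: symbol_carrier)

lemma symbol_prod_entry:
  "i < r \<Longrightarrow> l < r \<Longrightarrow> symbol_prod r a n \<xi> $$ (i, l) = P n i l (of_real \<xi>)"
proof (induction n arbitrary: l)
  case (Suc n)
  have "symbol_prod r a (Suc n) \<xi> $$ (i, l) = (\<Sum>q<r. symbol_prod r a n \<xi> $$ (i, q) * symbol r r a (\<xi> / 2 ^ Suc n) $$ (q, l))"
    using Suc.prems symbol_prod_carrier[of n \<xi>] symbol_carrier[of "\<xi> / 2 ^ Suc n"]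
    by (auto simp: scalar_prod_def atLeast0LessThan intro!: sum.cong)
  thus ?case using Suc by (simp add: P_Suc symbol_entry del: power_Suc)
qed (simp add: P_0)

text \<open>In this form \<open>P n i l\<close> is a Riemann sum against the exponential on the grid
  of mesh \<open>1 / 2 ^ n\<close>; the range is padded from \<open>N\<close> to \<open>R\<close> so
  that it can match the integration interval of \<open>FT R\<close>.\<close>

lemma P_eq_sum:
  assumes "i < r" "l < r" "N \<le> R"
  shows "P n i l z = (\<Sum>k\<in>{-(int R * 2 ^ n)..int R * 2 ^ n}. A n k $$ (i, l) * exp (- \<i> * z * of_real (of_int k / 2 ^ n))) / 2 ^ n"
proof -
  have "int N * 2 ^ n \<le> int R * 2 ^ n" using assms(3) by simp
  hence "A n k = 0\<^sub>m r r" if "k \<notin> {-(int R * 2 ^ n)..int R * 2 ^ n}" for k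
    using not_in_box[OF that] by (intro A_supp') linarith
  hence "trig_poly (\<lambda>k. A n k $$ (i, l)) (z / 2 ^ n)
      = (\<Sum>k\<in>{-(int R * 2 ^ n)..int R * 2 ^ n}. A n k $$ (i, l) * exp (- \<i> * of_int k * (z / 2 ^ n)))"
    using assms by (intro trig_poly_eq) auto
  thus ?thesis by (simp add: P_def mult_ac)
qed

end

section \<open>Smooth compactly supported limits\<close>

text \<open>\<open>G l\<close> stands for the derivative of order \<open>l\<close> of
  \<open>G 0\<close>. Carrying the derivatives as data allows explicit witnesses for
  products.\<close>

definition Cm_family :: "nat \<Rightarrow> real \<Rightarrow> (nat \<Rightarrow> real \<Rightarrow> complex) \<Rightarrow> bool" where
  "Cm_family m R G \<longleftrightarrow> (\<forall>l<m. \<forall>x. (G l has_vector_derivative G (Suc l) x) (at x)) \<and>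
     (\<forall>l\<le>m. continuous_on UNIV (G l) \<and> vanishes_outside R (G l))"

lemma Cm_familyD:
  assumes "Cm_family m R G"
  shows "l < m \<Longrightarrow> (G l has_vector_derivative G (Suc l) x) (at x)"
    and "l \<le> m \<Longrightarrow> continuous_on UNIV (G l)" and "l \<le> m \<Longrightarrow> vanishes_outside R (G l)"
  using assms by (auto simp: Cm_family_def)

lemma Cm_family_mult_ident:
  assumes "Cm_family m R G"
  shows "\<exists>H. Cm_family m R H \<and> H 0 = (\<lambda>x. - \<i> * of_real x * G 0 x)"
proof -
  \<comment> \<open>The Leibniz rule for the product with \<open>- \<i> * x\<close>; at
    \<open>l = 0\<close> the truncated index \<open>l - 1\<close> is harmless because of the factor
    \<open>of_nat l\<close>.\<close>
  define H where "H l x = - \<i> * (of_real x * G l x + of_nat l * G (l - 1) x)" for l x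
  have "Cm_family m R H" unfolding Cm_family_def
  proof (intro conjI allI impI)
    fix l x assume l: "l < m"
    have 1: "((\<lambda>x. of_real x * G l x) has_vector_derivative (of_real x * G (Suc l) x + 1 * G l x)) (at x)"
      by (intro has_vector_derivative_mult Cm_familyD(1)[OF assms l])
        (use has_vector_derivative_of_real[OF DERIV_ident] in auto)
    have 2: "((\<lambda>x. of_nat l * G (l - 1) x) has_vector_derivative of_nat l * G l x) (at x)"
    proof (cases l)
      case (Suc l')
      thus ?thesis using Cm_familyD(1)[OF assms, of l' x] l
        by (auto intro!: has_vector_derivative_mult_right)
    qed auto
    have "(H l has_vector_derivative - \<i> * (of_real x * G (Suc l) x + 1 * G l x + of_nat l * G l x)) (at x)"
      unfolding H_def[abs_def] by (intro has_vector_derivative_mult_right has_vector_derivative_add 1 2)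
    thus "(H l has_vector_derivative H (Suc l) x) (at x)"
      by (simp add: H_def algebra_simps)
  next
    fix l assume l: "l \<le> m"
    show "continuous_on UNIV (H l)" unfolding H_def[abs_def]
      by (intro continuous_intros Cm_familyD(2)[OF assms]) (use l in auto)
    show "vanishes_outside R (H l)"
      using Cm_familyD(3)[OF assms l] Cm_familyD(3)[OF assms, of "l - 1"] l
      by (auto simp: H_def vanishes_outside_def)
  qed
  thus ?thesis by (intro exI[of _ H]) (auto simp: H_def)
qed

lemma Cm_family_mult_power:
  assumes "Cm_family m R G"
  shows "\<exists>H. Cm_family m R H \<and> H 0 = (\<lambda>x. (- \<i> * of_real x) ^ j * G 0 x)"
proof (induction j)
  case (Suc j)
  then obtain H where H: "Cm_family m R H" "H 0 = (\<lambda>x. (- \<i> * of_real x) ^ j * G 0 x)" by blast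
  from Cm_family_mult_ident[OF H(1)] obtain H' where
    "Cm_family m R H'" "H' 0 = (\<lambda>x. - \<i> * of_real x * H 0 x)" by blast
  thus ?case by (intro exI[of _ H']) (auto simp: H(2) fun_eq_iff)
qed (use assms in auto)

lemma FT_Cm_family:
  assumes "Cm_family m R G" "0 \<le> R" "l \<le> m"
  shows "FT R (G l) z = (\<i> * z) ^ l * FT R (G 0) z"
  using assms(3)
proof (induction l)
  case (Suc l)
  have "FT R (G (Suc l)) z = \<i> * z * FT R (G l) z"
    using Suc.prems assms Cm_familyD[OF assms(1)]
    by (intro FT_deriv vanishes_outsideD[of R]) auto
  thus ?case using Suc by simp
qed simp

text \<open>Up to \<open>fact j\<close>, Taylor coefficient \<open>j\<close> is the transform of
  \<open>(- \<i> * of_real x) ^ j * G 0 x\<close>, which has again \<open>m\<close> continuous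
  derivatives. Then \<open>m\<close> integrations by parts trade the factor
  \<open>2 ^ (n * m)\<close> for the transform of the last derivative, and the Riemann-Lebesgue
  lemma applies.\<close>

lemma FT_decay:
  assumes G: "Cm_family m R G" and R: "0 \<le> R" and k: "k \<noteq> 0"
  shows "(\<lambda>n. 2 ^ (n * m) * fps_nth (fps_expansion (FT R (G 0)) (2 ^ n * (2 * of_real pi * of_int k))) j) \<longlonglongrightarrow> 0"
proof -
  obtain H where H: "Cm_family m R H" "H 0 = (\<lambda>x. (- \<i> * of_real x) ^ j * G 0 x)"
    using Cm_family_mult_power[OF G] by blast
  let ?z = "\<lambda>n. 2 ^ n * (2 * of_real pi * of_int k) :: complex"
  let ?x = "\<lambda>n. 2 ^ n * (2 * pi * of_int k)"
  have nth: "fps_nth (fps_expansion (FT R (G 0)) z) j = FT R (H 0) z / fact j" for z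
    using Cm_familyD(2)[OF G, of 0] by (simp add: fps_nth_fps_expansion higher_deriv_FT H(2))
  have "filterlim (\<lambda>n. 2 ^ n :: real) at_top sequentially"
    using filterlim_realpow_sequentially_gt1[of "2::real"]
    by (simp add: filterlim_at_infinity_conv_norm_at_top norm_power)
  hence "filterlim (\<lambda>n. (2 * pi * \<bar>of_int k\<bar>) * 2 ^ n :: real) at_top sequentially"
    using k by (intro filterlim_tendsto_pos_mult_at_top[OF tendsto_const]) auto
  hence "filterlim (\<lambda>n. \<bar>?x n\<bar>) at_top sequentially"
    by (simp add: abs_mult mult_ac)
  from riemann_lebesgue[OF Cm_familyD(2)[OF H(1) order_refl] Cm_familyD(3)[OF H(1) order_refl] this]
  have "(\<lambda>n. FT R (H m) (?z n)) \<longlonglongrightarrow> 0" by simp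
  hence "(\<lambda>n. inverse ((\<i> * (2 * of_real pi * of_int k)) ^ m * fact j) * FT R (H m) (?z n)) \<longlonglongrightarrow> 0"
    by (rule tendsto_mult_right_zero)
  moreover have "inverse ((\<i> * (2 * of_real pi * of_int k)) ^ m * fact j) * FT R (H m) (?z n)
      = 2 ^ (n * m) * fps_nth (fps_expansion (FT R (G 0)) (?z n)) j" for n
  proof -
    have "(\<i> * (2 * of_real pi * of_int k)) ^ m \<noteq> (0::complex)" using k by simp
    moreover have "FT R (H m) (?z n) = 2 ^ (n * m) * (\<i> * (2 * of_real pi * of_int k)) ^ m * FT R (H 0) (?z n)"
      unfolding FT_Cm_family[OF H(1) R order_refl] by (simp add: power_mult_distrib mult_ac flip: power_mult)
    moreover have "inverse (c * fact j) * (p * c * X) = p * (X / fact j)" if "c \<noteq> 0" for c p X :: complex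
      using that by (simp add: field_simps)
    ultimately show ?thesis unfolding nth by (simp only:)
  qed
  ultimately show ?thesis by simp
qed

section \<open>Passing to the limit in the subdivision iterates and the symbol products\<close>

lemma continuous_eq_on_dyadics:
  fixes f g :: "real \<Rightarrow> 'a::t2_space"
  assumes "continuous_on UNIV f" "continuous_on UNIV g"
    and "\<And>k p. f (of_int k / 2 ^ p) = g (of_int k / 2 ^ p)"
  shows "f x = g x"
proof -
  let ?d = "\<lambda>n. of_int \<lfloor>2 ^ n * x\<rfloor> / 2 ^ n"
  have "(\<lambda>n. f (?d n)) \<longlonglongrightarrow> f x" "(\<lambda>n. g (?d n)) \<longlonglongrightarrow> g x"
    using assms(1,2) dyadic_floor_tendsto[of x]
    by (auto simp: continuous_on_eq_continuous_at intro: isCont_tendsto_compose)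
  thus ?thesis using assms(3) LIMSEQ_unique by simp
qed

text \<open>\<open>F i l\<close> is the derivative of order \<open>l\<close> of entry
  \<open>i\<close> of the basis function, the factor \<open>2 ^ (l * n)\<close> is the effect of
  \<open>D\<close> to the power \<open>-n\<close> on column \<open>l\<close>, and \<open>R\<close>
  bounds the supports of both the mask and the basis function.\<close>

locale hermite_limit = mask +
  fixes m R :: nat and F :: "nat \<Rightarrow> nat \<Rightarrow> real \<Rightarrow> complex"
  assumes r_pos: "0 < r" and r_le: "r \<le> Suc m" and N_le: "N \<le> R"
    and F: "i < r \<Longrightarrow> Cm_family m R (F i)"
    and conv: "i < r \<Longrightarrow> l < r \<Longrightarrow> e > 0 \<Longrightarrow>
      \<forall>\<^sub>F n in sequentially. \<forall>k. cmod (A n k $$ (i, l) * 2 ^ (l * n) - F i l (of_int k / 2 ^ n)) \<le> e"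
begin

definition phi_hat :: "nat \<Rightarrow> complex \<Rightarrow> complex" where
  "phi_hat i = FT R (F i 0)"

lemma phi_hat_holomorphic: "i < r \<Longrightarrow> phi_hat i holomorphic_on S"
  unfolding phi_hat_def by (intro FT_holomorphic Cm_familyD(2)[OF F]) auto

text \<open>Testing the uniform limit relation against a continuous \<open>\<psi>\<close> produces
  Riemann sums. Exponentials as \<open>\<psi>\<close> yield the values of the transforms, monomials
  their Taylor coefficients at 0.\<close>

lemma A_limit:
  assumes \<psi>: "continuous_on UNIV \<psi>" and il: "i < r" "l < r"
  shows "(\<lambda>n. 2 ^ (l * n) * ((\<Sum>k\<in>{-(int R * 2 ^ n)..int R * 2 ^ n}. A n k $$ (i, l) * \<psi> (of_int k / 2 ^ n)) / 2 ^ n))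
    \<longlonglongrightarrow> integral {-real R..real R} (\<lambda>x. F i l x * \<psi> x)"
proof -
  have l: "l \<le> m" using il r_le by simp
  have R2: "int N * 2 ^ n \<le> int R * 2 ^ n" for n using N_le by simp
  define u where "u n k = A n k $$ (i, l) * 2 ^ (l * n) * \<psi> (of_int k / 2 ^ n)" for n and k :: int
  note Fl = Cm_familyD(2,3)[OF F[OF il(1)] l]
  have "compact (\<psi> ` {-real R..real R})"
    by (intro compact_continuous_image continuous_on_subset[OF \<psi>]) auto
  \<comment> \<open>A bound on \<open>[-R, R]\<close> suffices, because outside this interval both
    the sample of \<open>F\<close> and the iterate vanish.\<close>
  then obtain B where B: "B > 0" "\<And>y. y \<in> \<psi> ` {-real R..real R} \<Longrightarrow> norm y \<le> B"
    using compact_imp_bounded bounded_pos by metis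
  have "(\<lambda>n. (\<Sum>k\<in>{-(int R * 2 ^ n)..int R * 2 ^ n}. u n k) / 2 ^ n)
    \<longlonglongrightarrow> integral {-real R..real R} (\<lambda>x. F i l x * \<psi> x)"
  proof (rule riemann_sum_limit)
    show "continuous_on UNIV (\<lambda>x. F i l x * \<psi> x)" by (intro continuous_intros \<psi> Fl)
    show "vanishes_outside R (\<lambda>x. F i l x * \<psi> x)" by (intro vanishes_outside_mult Fl)
    show "u n k = 0" if "int R * 2 ^ n < \<bar>k\<bar>" for n k
      using A_supp'[of n k] that R2[of n] il by (simp add: u_def)
    show "\<forall>\<^sub>F n in sequentially. \<forall>k. cmod (u n k - F i l (of_int k / 2 ^ n) * \<psi> (of_int k / 2 ^ n)) \<le> e"
      if "e > 0" for e
    proof -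
      have "e / B > 0" using that B by simp
      from conv[OF il this] show ?thesis
      proof eventually_elim
        case (elim n)
        show ?case
        proof
          fix k :: int
          let ?x = "of_int k / 2 ^ n :: real"
          have eq: "u n k - F i l ?x * \<psi> ?x = (A n k $$ (i, l) * 2 ^ (l * n) - F i l ?x) * \<psi> ?x"
            by (simp add: u_def algebra_simps)
          show "cmod (u n k - F i l ?x * \<psi> ?x) \<le> e"
          proof (cases "\<bar>?x\<bar> \<le> R")
            case True
            hence "?x \<in> {-real R..real R}" unfolding atLeastAtMost_iff by linarith
            hence "cmod (\<psi> ?x) \<le> B" by (intro B(2) imageI)
            hence "cmod ((A n k $$ (i, l) * 2 ^ (l * n) - F i l ?x) * \<psi> ?x) \<le> e / B * B"
              unfolding norm_mult using elim B(1) \<open>e / B > 0\<close> by (intro mult_mono) auto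
            thus ?thesis using eq B(1) by simp
          next
            case False
            hence "F i l ?x = 0" using Fl(2) by (intro vanishes_outsideD[of R]) auto
            moreover have "real R * 2 ^ n < \<bar>of_int k\<bar>" using False by (simp add: field_simps not_le)
            hence "real_of_int (int R * 2 ^ n) < real_of_int \<bar>k\<bar>" by simp
            hence "int R * 2 ^ n < \<bar>k\<bar>" by (simp only: of_int_less_iff)
            hence "A n k = 0\<^sub>m r r" using R2[of n] by (intro A_supp') linarith
            ultimately show ?thesis using eq il \<open>e > 0\<close> by simp
          qed
        qed
      qed
    qed
  qed
  thus ?thesis by (simp add: u_def sum_distrib_left sum_divide_distrib mult_ac)
qed

lemma P_limit:
  assumes "i < r" "l < r"
  shows "(\<lambda>n. 2 ^ (l * n) * P n i l z) \<longlonglongrightarrow> (\<i> * z) ^ l * phi_hat i z"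
proof -
  have "(\<lambda>n. 2 ^ (l * n) * P n i l z) \<longlonglongrightarrow> FT R (F i l) z"
    unfolding FT_def P_eq_sum[OF assms N_le]
    by (rule A_limit[OF _ assms, of "\<lambda>x. exp (- \<i> * z * of_real x)"]) (intro continuous_intros)
  thus ?thesis unfolding phi_hat_def using FT_Cm_family[OF F[OF assms(1)], of l z] assms r_le by simp
qed

text \<open>Columns \<open>l > 0\<close> tend to 0 because they converge even after multiplication
  by \<open>2 ^ (l * n)\<close>; the limit matrix therefore has rank at most one.\<close>

lemma P_tendsto:
  assumes "i < r" "l < r"
  shows "(\<lambda>n. P n i l z) \<longlonglongrightarrow> (if l = 0 then phi_hat i z else 0)"
proof (cases "l = 0")
  case False
  hence "(\<lambda>n. inverse (2 ^ l) ^ n :: complex) \<longlonglongrightarrow> 0"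
    by (intro LIMSEQ_power_zero) (auto simp: norm_inverse norm_power intro!: inverse_less_1_iff[THEN iffD2] one_less_power)
  from tendsto_mult[OF this P_limit[OF assms, of z]]
  have "(\<lambda>n. inverse (2 ^ l) ^ n * (2 ^ (l * n) * P n i l z)) \<longlonglongrightarrow> 0" by simp
  moreover have "inverse (2 ^ l) ^ n * (2 ^ (l * n) * P n i l z) = P n i l z" for n
    by (simp add: power_mult field_simps)
  ultimately show ?thesis using False by simp
qed (use P_limit[OF assms, of z] in simp)

lemma P_holomorphic: "P n i l holomorphic_on S"
  unfolding P_def[abs_def]
  by (intro holomorphic_intros holomorphic_on_compose_gen[OF _ trig_poly_holomorphic[of _ UNIV], unfolded o_def]) auto

text \<open>Taylor coefficient \<open>j\<close> of the exponential in the frequency is a monomial in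
  \<open>x\<close>, so \<open>A_limit\<close> applies again. The limit series is the jet of
  \<open>(\<i> * z) ^ l * phi_hat i z\<close>.\<close>

lemma P_jet_limit:
  assumes "i < r" "l < r"
  shows "(\<lambda>n. 2 ^ (l * n) * fps_nth (fps_expansion (P n i l) 0) j)
    \<longlonglongrightarrow> fps_nth (fps_const (\<i> ^ l) * fps_X ^ l * fps_expansion (phi_hat i) 0) j"
proof -
  let ?\<psi> = "\<lambda>x::real. (- \<i> * of_real x) ^ j / fact j"
  let ?K = "\<lambda>n. {-(int R * 2 ^ n)..int R * 2 ^ n}"
  have l: "l \<le> m" using assms r_le by simp
  note Fl = Cm_familyD(2)[OF F[OF assms(1)] l]
  have P: "P n i l = (\<lambda>z. \<Sum>k\<in>?K n. (A n k $$ (i, l) / 2 ^ n) * exp ((- \<i> * of_real (of_int k / 2 ^ n)) * z))" for n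
    unfolding P_eq_sum[OF assms N_le, abs_def] by (simp add: sum_divide_distrib mult_ac)
  have "fps_nth (fps_expansion (P n i l) 0) j = (\<Sum>k\<in>?K n. A n k $$ (i, l) * ?\<psi> (of_int k / 2 ^ n)) / 2 ^ n" for n
  proof -
    have "fps_nth (fps_expansion (\<lambda>z. c * exp (d * z)) 0) j = c * (d ^ j / fact j)" for c d
      by (subst fps_expansion_cmult) (auto intro!: holomorphic_intros simp: fps_expansion_exp)
    hence "fps_nth (fps_expansion (P n i l) 0) j = (\<Sum>k\<in>?K n. A n k $$ (i, l) / 2 ^ n * ?\<psi> (of_int k / 2 ^ n))"
      unfolding P by (subst fps_expansion_sum) (intro holomorphic_intros, simp only: fps_sum_nth)
    thus ?thesis by (simp add: sum_divide_distrib mult.commute)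
  qed
  hence "(\<lambda>n. 2 ^ (l * n) * fps_nth (fps_expansion (P n i l) 0) j)
      \<longlonglongrightarrow> integral {-real R..real R} (\<lambda>x. F i l x * ?\<psi> x)"
    by (simp only:) (rule A_limit[OF _ assms], intro continuous_intros, simp)
  moreover have "integral {-real R..real R} (\<lambda>x. F i l x * ?\<psi> x) = fps_nth (fps_expansion (FT R (F i l)) 0) j"
  proof -
    have "integral {-real R..real R} (\<lambda>x. F i l x * ?\<psi> x)
      = integral {-real R..real R} (\<lambda>x. ((- \<i> * of_real x) ^ j * F i l x * exp (- \<i> * 0 * of_real x)) * inverse (fact j))"
      by (simp add: field_simps)
    thus ?thesis unfolding fps_nth_fps_expansion higher_deriv_FT[OF Fl] FT_def
      by (simp only: integral_mult_left divide_inverse)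
  qed
  moreover have "FT R (F i l) = (\<lambda>z. \<i> ^ l * (z ^ l * phi_hat i z))"
    unfolding phi_hat_def using FT_Cm_family[OF F[OF assms(1)], of l] l by (simp add: fun_eq_iff power_mult_distrib)
  hence "fps_expansion (FT R (F i l)) 0 = fps_const (\<i> ^ l) * fps_X ^ l * fps_expansion (phi_hat i) 0"
    using assms by (simp add: fps_expansion_cmult fps_expansion_mult fps_expansion_power fps_expansion_ident
      holomorphic_intros phi_hat_holomorphic mult.assoc)
  ultimately show ?thesis by simp
qed

lemma phi_hat_refinement: 
  assumes "i < r"
  shows "phi_hat i (2 * z) = (\<Sum>q<r. a_hat i q z * phi_hat q z)"
proof (rule LIMSEQ_unique)
  show "(\<lambda>n. P (Suc n) i 0 (2 * z)) \<longlonglongrightarrow> phi_hat i (2 * z)"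
    using P_tendsto[OF assms r_pos, of "2 * z"] by (intro LIMSEQ_Suc) simp
  show "(\<lambda>n. P (Suc n) i 0 (2 * z)) \<longlonglongrightarrow> (\<Sum>q<r. a_hat i q z * phi_hat q z)"
    unfolding P_Suc_left[OF assms r_pos]
    by (intro tendsto_intros) (use P_tendsto[OF _ r_pos] in auto)
qed

lemma phi_hat_eq_P:
  assumes "i < r"
  shows "phi_hat i z = (\<Sum>q<r. P n i q z * phi_hat q (z / 2 ^ n))"
proof (induction n)
  case 0
  have "(\<Sum>q<r. P 0 i q z * phi_hat q (z / 2 ^ 0)) = (\<Sum>q<r. if q = i then phi_hat q z else 0)"
    using assms by (intro sum.cong) (auto simp: P_0)
  thus ?case using assms by simp
next
  case (Suc n)
  have "phi_hat q (z / 2 ^ n) = (\<Sum>t<r. a_hat q t (z / 2 ^ Suc n) * phi_hat t (z / 2 ^ Suc n))" if "q < r" for q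
    using phi_hat_refinement[OF that, of "z / 2 ^ Suc n"] by simp
  hence "phi_hat i z = (\<Sum>q<r. \<Sum>t<r. P n i q z * a_hat q t (z / 2 ^ Suc n) * phi_hat t (z / 2 ^ Suc n))"
    unfolding Suc by (simp add: sum_distrib_left mult.assoc)
  also have "\<dots> = (\<Sum>t<r. P (Suc n) i t z * phi_hat t (z / 2 ^ Suc n))"
    using assms by (subst sum.swap) (simp add: P_Suc sum_distrib_right)
  finally show ?case .
qed

text \<open>In \<open>phi_hat_eq_P\<close> the matrix tends to one with only the first column
  nonzero, while the vector tends to its value at 0. The limit reads
  \<open>phi_hat i z = phi_hat i z * phi_hat 0 0\<close>.\<close>

lemma phi_hat_0_0:
  assumes "i < r" "phi_hat i z \<noteq> 0"
  shows "phi_hat 0 0 = 1"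
proof -
  have "(\<lambda>n. z / 2 ^ n) \<longlonglongrightarrow> 0"
  proof -
    have "(\<lambda>n. z * (1 / 2) ^ n) \<longlonglongrightarrow> 0"
      by (intro tendsto_mult_right_zero LIMSEQ_power_zero) simp
    thus ?thesis by (simp add: power_divide)
  qed
  hence "(\<lambda>n. phi_hat q (z / 2 ^ n)) \<longlonglongrightarrow> phi_hat q 0" if "q < r" for q
    using holomorphic_on_imp_continuous_on[OF phi_hat_holomorphic[OF that, of UNIV]]
    by (intro isCont_tendsto_compose[of 0 "phi_hat q"]) (auto simp: continuous_on_eq_continuous_at)
  hence "(\<lambda>n. \<Sum>q<r. P n i q z * phi_hat q (z / 2 ^ n)) \<longlonglongrightarrow> (\<Sum>q<r. (if q = 0 then phi_hat i z else 0) * phi_hat q 0)"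
    by (intro tendsto_intros P_tendsto assms) auto
  moreover have "(\<Sum>q<r. (if q = 0 then phi_hat i z else 0) * phi_hat q 0) = (\<Sum>q<r. if q = 0 then phi_hat i z * phi_hat q 0 else 0)"
    by (intro sum.cong) auto
  moreover have "\<dots> = phi_hat i z * phi_hat 0 0" using r_pos by simp
  ultimately have "(\<lambda>n. phi_hat i z) \<longlonglongrightarrow> phi_hat i z * phi_hat 0 0"
    unfolding phi_hat_eq_P[OF assms(1), symmetric] by simp
  hence "phi_hat i z = phi_hat i z * phi_hat 0 0" using LIMSEQ_unique tendsto_const by blast
  thus ?thesis using assms by simp
qed

text \<open>Row 0 of \<open>P n\<close> at frequency 0 tends to the first unit row by
  \<open>P_tendsto\<close>. Passing to the limit in \<open>P_Suc\<close> shows that this row is a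
  left eigenvector of the symbol at 0 for the eigenvalue 1.\<close>

lemma a_hat_0_0:
  assumes "phi_hat 0 0 = 1" "l < r"
  shows "a_hat 0 l 0 = (if l = 0 then 1 else 0)"
proof -
  have "(\<lambda>n. P (Suc n) 0 l 0) \<longlonglongrightarrow> (\<Sum>q<r. (if q = 0 then phi_hat 0 0 else 0) * a_hat q l 0)"
    unfolding P_Suc[OF r_pos assms(2)] by (intro tendsto_intros) (use P_tendsto[OF r_pos] in auto)
  moreover have "(\<lambda>n. P (Suc n) 0 l 0) \<longlonglongrightarrow> (if l = 0 then phi_hat 0 0 else 0)"
    by (intro LIMSEQ_Suc P_tendsto r_pos assms)
  ultimately have "(\<Sum>q<r. (if q = 0 then phi_hat 0 0 else 0) * a_hat q l 0) = (if l = 0 then phi_hat 0 0 else 0)"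
    using LIMSEQ_unique by blast
  moreover have "(\<Sum>q<r. (if q = 0 then phi_hat 0 0 else 0) * a_hat q l 0) = (\<Sum>q<r. if q = 0 then a_hat q l 0 else 0)"
    using assms by (intro sum.cong) auto
  ultimately show ?thesis using r_pos assms by simp
qed

text \<open>A dyadic point belongs to all finer grids, so the uniform estimate for column 0 can be
  read off along the indices \<open>k d\<close> at level \<open>d + p\<close>.\<close>

lemma A_column_tendsto:
  assumes "i < r" "\<And>d. of_int (k d) / 2 ^ (d + p) = (x::real)"
  shows "(\<lambda>d. A (d + p) (k d) $$ (i, 0)) \<longlonglongrightarrow> F i 0 x"
proof (rule LIMSEQ_I)
  fix e :: real assume "e > 0"
  hence "e / 2 > 0" by simp
  from conv[OF assms(1) r_pos this] obtain n0 where
    n0: "\<And>n k. n \<ge> n0 \<Longrightarrow> cmod (A n k $$ (i, 0) - F i 0 (of_int k / 2 ^ n)) \<le> e / 2"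
    by (auto simp: eventually_sequentially)
  have "norm (A (d + p) (k d) $$ (i, 0) - F i 0 x) < e" if "d \<ge> n0" for d
    using n0[of "d + p" "k d"] that \<open>e > 0\<close> by (simp add: assms(2))
  thus "\<exists>no. \<forall>d\<ge>no. norm (A (d + p) (k d) $$ (i, 0) - F i 0 x) < e" by blast
qed

text \<open>At dyadic points the equation is the limit of \<open>A_Suc_entry_left\<close> along ever
  finer grids; continuity extends it to all \<open>x\<close>.\<close>

lemma F_refinement:
  assumes "i < r"
  shows "F i 0 x = 2 * (\<Sum>s\<in>{-int N..int N}. \<Sum>t<r. a s $$ (i, t) * F t 0 (2 * x - of_int s))"
proof (rule continuous_eq_on_dyadics[of "F i 0"])
  have c: "continuous_on UNIV (F t 0)" if "t < r" for t
    using Cm_familyD(2)[OF F[OF that], of 0] by simp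
  show "continuous_on UNIV (F i 0)" using c assms by blast
  show "continuous_on UNIV (\<lambda>x. 2 * (\<Sum>s\<in>{-int N..int N}. \<Sum>t<r. a s $$ (i, t) * F t 0 (2 * x - of_int s)))"
    by (intro continuous_intros continuous_on_compose2[OF c]) auto
  fix k :: int and p :: nat
  let ?x = "of_int k / 2 ^ p :: real"
  \<comment> \<open>The index \<open>k * 2 ^ (d + 1)\<close> represents \<open>?x\<close> at level
    \<open>d + Suc p\<close>; after subtracting \<open>2 ^ (d + p) * s\<close> it represents
    \<open>2 * ?x - of_int s\<close> one level lower.\<close>
  have "(\<lambda>d. A (d + Suc p) (k * 2 ^ (d + 1)) $$ (i, 0)) \<longlonglongrightarrow> F i 0 ?x"
    by (rule A_column_tendsto[OF assms]) (simp add: field_simps power_add)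
  moreover have "(\<lambda>d. A (d + p) (k * 2 ^ (d + 1) - 2 ^ (d + p) * s) $$ (t, 0)) \<longlonglongrightarrow> F t 0 (2 * ?x - of_int s)"
    if "t < r" for t s
    by (rule A_column_tendsto[OF that]) (simp add: field_simps power_add)
  hence "(\<lambda>d. 2 * (\<Sum>s\<in>{-int N..int N}. \<Sum>t<r. a s $$ (i, t) * A (d + p) (k * 2 ^ (d + 1) - 2 ^ (d + p) * s) $$ (t, 0)))
     \<longlonglongrightarrow> 2 * (\<Sum>s\<in>{-int N..int N}. \<Sum>t<r. a s $$ (i, t) * F t 0 (2 * ?x - of_int s))"
    by (intro tendsto_intros) auto
  ultimately show "F i 0 ?x = 2 * (\<Sum>s\<in>{-int N..int N}. \<Sum>t<r. a s $$ (i, t) * F t 0 (2 * ?x - of_int s))"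
    by (simp only: add_Suc_right A_Suc_entry_left[OF assms r_pos]) (rule LIMSEQ_unique)
qed

lemma phi_hat_decay:
  assumes "i < r" "k \<noteq> 0"
  shows "(\<lambda>n. 2 ^ (n * m) * fps_nth (fps_expansion (phi_hat i) (2 ^ n * (2 * of_real pi * of_int k))) j) \<longlonglongrightarrow> 0"
  unfolding phi_hat_def by (rule FT_decay[OF F[OF assms(1)] _ assms(2)]) simp

end

section \<open>Sum rules from the spanning conditions\<close>

text \<open>A square matrix with trivial kernel is invertible. The unknowns are a plain family of
  numbers, which fits the determination of Taylor coefficients in \<open>jet_exists\<close>.\<close>

lemma linear_system_solvable:
  fixes M :: "nat \<Rightarrow> nat \<Rightarrow> complex"
  assumes inj: "\<And>y. (\<And>l. l < r \<Longrightarrow> (\<Sum>i<r. M l i * y i) = 0) \<Longrightarrow> (\<And>i. i < r \<Longrightarrow> y i = 0)"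
  shows "\<exists>y. \<forall>l<r. (\<Sum>i<r. M l i * y i) = w l"
proof -
  define A where "A = mat r r (\<lambda>(l, i). M l i)"
  have A: "A \<in> carrier_mat r r" by (simp add: A_def)
  have mv: "(A *\<^sub>v v) $ l = (\<Sum>i<r. M l i * v $ i)" if "v \<in> carrier_vec r" "l < r" for v l
    using that by (auto simp: A_def scalar_prod_def atLeast0LessThan intro!: sum.cong)
  have "det A \<noteq> 0"
  proof
    assume "det A = 0"
    then obtain v where v: "v \<in> carrier_vec r" "v \<noteq> 0\<^sub>v r" "A *\<^sub>v v = 0\<^sub>v r"
      using det_0_iff_vec_prod_zero_field[OF A] by blast
    have "(\<Sum>i<r. M l i * v $ i) = 0" if "l < r" for l
      using mv[OF v(1) that] v(3) that by simp
    hence "v $ i = 0" if "i < r" for i using inj[of "\<lambda>i. v $ i"] that by blast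
    hence "v = 0\<^sub>v r" using v(1) by (intro eq_vecI) auto
    thus False using v(2) by simp
  qed
  then obtain B where B: "B \<in> carrier_mat r r" "A * B = 1\<^sub>m r"
    using det_non_zero_imp_unit[OF A] unfolding Units_def ring_mat_def by auto
  define y where "y = B *\<^sub>v vec r w"
  have y: "y \<in> carrier_vec r" using B by (simp add: y_def)
  have "A *\<^sub>v y = (A * B) *\<^sub>v vec r w"
    unfolding y_def using A B by (intro assoc_mult_mat_vec[symmetric]) auto
  hence "A *\<^sub>v y = vec r w" by (simp add: B(2))
  hence "(\<Sum>i<r. M l i * y $ i) = w l" if "l < r" for l
    using mv[OF y that] that by simp
  thus ?thesis by (intro exI[of _ "\<lambda>i. y $ i"]) blast
qed

lemma cmod_less_1_of_power_tendsto_0: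
  fixes z :: complex
  assumes "(\<lambda>n. z ^ n) \<longlonglongrightarrow> 0"
  shows "cmod z < 1"
proof (rule ccontr)
  assume "\<not> cmod z < 1"
  hence "1 \<le> cmod (z ^ n)" for n by (simp add: norm_power one_le_power)
  moreover have "\<forall>\<^sub>F n in sequentially. cmod (z ^ n) < 1"
    using tendstoD[OF assms, of 1] by simp
  ultimately show False by (metis eventually_happens linorder_not_less trivial_limit_sequentially)
qed

text \<open>The spanning conditions enter in dual form: a linear functional that vanishes on all
  samples is zero.\<close>

locale hermite_limit_span = hermite_limit +
  assumes span_0: "(\<And>k::int. (\<Sum>q<r. h q * phi_hat q (2 * of_real pi * of_int k)) = 0) \<Longrightarrow> q < r \<Longrightarrow> h q = 0"
    and span_pi: "(\<And>k::int. (\<Sum>q<r. h q * phi_hat q (of_real pi + 2 * of_real pi * of_int k)) = 0) \<Longrightarrow> q < r \<Longrightarrow> h q = 0"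
begin

text \<open>The spanning condition at \<open>2 * pi * k\<close> keeps \<open>phi_hat\<close> from
  vanishing identically, and one nonzero value is enough for \<open>phi_hat_0_0\<close>.\<close>

lemma phi_hat_normalized: "phi_hat 0 0 = 1"
proof -
  have "\<exists>q<r. \<exists>z. phi_hat q z \<noteq> 0"
  proof (rule ccontr)
    assume "\<not> ?thesis"
    hence "(1::complex) = 0" by (intro span_0[of "\<lambda>_. 1" 0] sum.neutral r_pos) auto
    thus False by simp
  qed
  thus ?thesis using phi_hat_0_0 by blast
qed

lemma a_hat_row_0: "l < r \<Longrightarrow> a_hat 0 l 0 = (if l = 0 then 1 else 0)"
  by (rule a_hat_0_0[OF phi_hat_normalized])

text \<open>By periodicity of the symbol, the pairing \<open>S k\<close> of \<open>h\<close> with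
  the transform at \<open>2 * pi * k\<close> satisfies \<open>S (2 * k) = z * S k\<close>. Hence
  \<open>S 0 = 0\<close>, and the spanning condition yields some \<open>k\<close> other than 0 with
  \<open>S k\<close> nonzero. As \<open>S (2 ^ n * k) = z ^ n * S k\<close> is
  \<open>o(2 ^ (- n m))\<close> by the decay, \<open>2 ^ m * z\<close> has modulus below 1.\<close>

lemma left_eigenvalue_bound:
  assumes eig: "\<And>l. l < r \<Longrightarrow> (\<Sum>i<r. h i * a_hat i l 0) = z * h l" and nz: "i0 < r" "h i0 \<noteq> 0" and z: "z \<noteq> 1"
  shows "cmod z < 1 / 2 ^ m"
proof -
  define S where "S k = (\<Sum>i<r. h i * phi_hat i (2 * of_real pi * of_int k))" for k
  have S2: "S (2 * k) = z * S k" for k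
  proof -
    define w :: complex where "w = 2 * of_real pi * of_int k"
    have a_hat: "a_hat i q w = a_hat i q 0" for i q using a_hat_periodic[of i q 0 k] by (simp add: w_def)
    have "S (2 * k) = (\<Sum>i<r. h i * phi_hat i (2 * w))" by (simp add: S_def w_def mult_ac)
    also have "\<dots> = (\<Sum>i<r. \<Sum>q<r. h i * a_hat i q 0 * phi_hat q w)"
      by (intro sum.cong refl) (simp add: phi_hat_refinement a_hat sum_distrib_left mult.assoc)
    also have "\<dots> = (\<Sum>q<r. (\<Sum>i<r. h i * a_hat i q 0) * phi_hat q w)"
      by (subst sum.swap) (simp add: sum_distrib_right)
    also have "\<dots> = z * S k" by (simp add: eig S_def w_def sum_distrib_left mult.assoc)
    finally show ?thesis .
  qed
  have "S 0 = z * S 0" using S2[of 0] by simp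
  hence S0: "S 0 = 0" using z by (metis mult_cancel_right1)
  have "\<exists>k. S k \<noteq> 0"
  proof (rule ccontr)
    assume "\<not> (\<exists>k. S k \<noteq> 0)"
    hence "S k = 0" for k by simp
    from span_0[OF this[unfolded S_def] nz(1)] show False using nz(2) by simp
  qed
  then obtain k where k: "S k \<noteq> 0" ..
  have k0: "k \<noteq> 0" using k S0 by auto
  have Sn: "S (2 ^ n * k) = z ^ n * S k" for n
    by (induction n) (simp_all add: S2 mult.assoc)
  have "(\<lambda>n. \<Sum>i<r. h i * (2 ^ (n * m) * fps_nth (fps_expansion (phi_hat i) (2 ^ n * (2 * of_real pi * of_int k))) 0)) \<longlonglongrightarrow> (\<Sum>i<r. h i * 0)"
    by (intro tendsto_intros phi_hat_decay k0) auto
  moreover have "(\<Sum>i<r. h i * (2 ^ (n * m) * fps_nth (fps_expansion (phi_hat i) (2 ^ n * (2 * of_real pi * of_int k))) 0))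
      = (2 ^ m * z) ^ n * S k" for n
  proof -
    have "(\<Sum>i<r. h i * (2 ^ (n * m) * fps_nth (fps_expansion (phi_hat i) (2 ^ n * (2 * of_real pi * of_int k))) 0))
       = 2 ^ (n * m) * S (2 ^ n * k)"
      by (simp add: S_def fps_nth_fps_expansion sum_distrib_left mult_ac)
    thus ?thesis by (simp add: Sn power_mult_distrib power_mult mult.commute[of n m])
  qed
  ultimately have "(\<lambda>n. (2 ^ m * z) ^ n * S k) \<longlonglongrightarrow> 0" by simp
  from tendsto_mult[OF this tendsto_const[of "inverse (S k)"]]
  have "(\<lambda>n. (2 ^ m * z) ^ n) \<longlonglongrightarrow> 0" using k by (simp add: mult.assoc)
  hence "cmod (2 ^ m * z) < 1" by (rule cmod_less_1_of_power_tendsto_0)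
  thus ?thesis by (simp add: norm_mult norm_power field_simps)
qed

text \<open>A fixed vector of the symbol at 0 is fixed by every \<open>P n\<close> at 0, and their
  limit maps it to \<open>v 0\<close> times the vector \<open>phi_hat\<close> at 0.\<close>

lemma fixed_vector_eq_0:
  assumes v: "\<And>i. i < r \<Longrightarrow> (\<Sum>l<r. a_hat i l 0 * v l) = v i" and "v 0 = 0" "i < r"
  shows "v i = 0"
proof -
  have "(\<Sum>l<r. P n i l 0 * v l) = v i" for n
  proof (induction n)
    case 0
    have "(\<Sum>l<r. P 0 i l 0 * v l) = (\<Sum>l<r. if l = i then v l else 0)"
      using assms by (intro sum.cong) (auto simp: P_0)
    thus ?case using assms by simp
  next
    case (Suc n)
    have "(\<Sum>l<r. P (Suc n) i l 0 * v l) = (\<Sum>l<r. \<Sum>q<r. P n i q 0 * (a_hat q l 0 * v l))"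
      using assms by (simp add: P_Suc sum_distrib_right mult.assoc)
    also have "\<dots> = (\<Sum>q<r. P n i q 0 * v q)"
      by (subst sum.swap) (simp add: sum_distrib_left[symmetric] v)
    finally show ?case using Suc by simp
  qed
  moreover have "(\<lambda>n. \<Sum>l<r. P n i l 0 * v l) \<longlonglongrightarrow> (\<Sum>l<r. (if l = 0 then phi_hat i 0 else 0) * v l)"
    by (intro tendsto_intros) (use P_tendsto assms in auto)
  moreover have "(\<Sum>l<r. (if l = 0 then phi_hat i 0 else 0) * v l) = 0"
    using assms by (intro sum.neutral) auto
  ultimately show ?thesis by (simp add: LIMSEQ_const_iff)
qed

section \<open>Jets of the matching filter\<close>

definition a_jet :: "nat \<Rightarrow> nat \<Rightarrow> complex fps" where
  "a_jet i l = fps_expansion (a_hat i l) 0"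

lemma a_jet_nth_0: "fps_nth (a_jet i l) 0 = a_hat i l 0"
  by (simp add: a_jet_def fps_nth_fps_expansion)

text \<open>\<open>Y\<close> is a candidate for the Taylor series of the matching filter: the
  equation is the first sum rule modulo \<open>fps_X ^ n\<close>, with value the first unit row at
  0.\<close>

definition is_jet :: "(nat \<Rightarrow> complex fps) \<Rightarrow> nat \<Rightarrow> bool" where
  "is_jet Y n \<longleftrightarrow> (\<forall>l<r. fps_nth (Y l) 0 = (if l = 0 then 1 else 0) \<and>
     fps_eq_upto n (\<Sum>i<r. fps_scale 2 (Y i) * a_jet i l) (Y l))"

text \<open>The series is built one coefficient at a time. At order \<open>Suc j\<close> the new row
  \<open>y\<close> solves a linear system with matrix the identity minus \<open>2 ^ Suc j\<close>
  times the symbol at 0. A nontrivial kernel would make \<open>1 / 2 ^ Suc j\<close> an eigenvalue,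
  which \<open>left_eigenvalue_bound\<close> excludes for \<open>Suc j \<le> m\<close>.\<close>

lemma jet_exists: "j \<le> m \<Longrightarrow> \<exists>Y. is_jet Y (Suc j)"
proof (induction j)
  case 0
  let ?Y = "\<lambda>l::nat. if l = 0 then 1 else 0 :: complex fps"
  have "fps_nth (\<Sum>i<r. fps_scale 2 (?Y i) * a_jet i l) 0 = fps_nth (?Y l) 0" if "l < r" for l
  proof -
    have "fps_nth (\<Sum>i<r. fps_scale 2 (?Y i) * a_jet i l) 0 = (\<Sum>i<r. if i = 0 then a_hat i l 0 else 0)"
      unfolding fps_sum_nth by (intro sum.cong) (auto simp: a_jet_nth_0)
    thus ?thesis using r_pos a_hat_row_0[OF that] by simp
  qed
  hence "is_jet ?Y (Suc 0)" by (auto simp: is_jet_def fps_eq_upto_def)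
  thus ?case by blast
next
  case (Suc j)
  then obtain Y where Y: "is_jet Y (Suc j)" by auto
  \<comment> \<open>The contribution of the coefficients already found to order
    \<open>Suc j\<close>; the sum stops at \<open>p = j\<close> because the term
    \<open>p = Suc j\<close> carries the unknown \<open>y\<close>.\<close>
  define w where "w l = (\<Sum>i<r. \<Sum>p=0..j. 2 ^ p * fps_nth (Y i) p * fps_nth (a_jet i l) (Suc j - p))" for l
  let ?M = "\<lambda>l i. (if i = l then 1 else 0) - 2 ^ Suc j * a_hat i l 0"
  have M: "(\<Sum>i<r. ?M l i * y i) = y l - (\<Sum>i<r. 2 ^ Suc j * y i * a_hat i l 0)" if "l < r" for l and y :: "nat \<Rightarrow> complex"
  proof -
    have "(\<Sum>i<r. ?M l i * y i) = (\<Sum>i<r. if i = l then y i else 0) - (\<Sum>i<r. 2 ^ Suc j * y i * a_hat i l 0)"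
      unfolding sum_subtractf[symmetric] by (intro sum.cong) (auto simp: algebra_simps)
    thus ?thesis using that by simp
  qed
  have "\<exists>y. \<forall>l<r. (\<Sum>i<r. ?M l i * y i) = w l"
  proof (rule linear_system_solvable)
    fix y i assume 0: "\<And>l. l < r \<Longrightarrow> (\<Sum>i<r. ?M l i * y i) = 0" and i: "i < r"
    show "y i = 0"
    proof (rule ccontr)
      assume "y i \<noteq> 0"
      have eig: "(\<Sum>i<r. y i * a_hat i l 0) = 1 / 2 ^ Suc j * y l" if "l < r" for l
      proof -
        have "y l = 2 ^ Suc j * (\<Sum>i<r. y i * a_hat i l 0)"
          using 0[OF that] M[OF that, of y] by (simp add: sum_distrib_left mult.assoc)
        thus ?thesis by simp
      qed
      have "(1::complex) / 2 ^ Suc j \<noteq> 1"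
      proof -
        have "1 < (2::real) ^ Suc j" by (rule one_less_power) auto
        hence "cmod (1 / 2 ^ Suc j) < 1" by (simp add: norm_divide norm_mult norm_power)
        thus ?thesis by (metis norm_one less_irrefl)
      qed
      from left_eigenvalue_bound[OF eig i \<open>y i \<noteq> 0\<close> this]
      have "1 / 2 ^ Suc j < (1 / 2 ^ m :: real)" by (simp add: norm_divide norm_mult norm_power)
      hence "(2::real) ^ m < 2 ^ Suc j" by (simp add: field_simps)
      hence "m < Suc j" using power_less_imp_less_exp[of "2::real" m "Suc j"] by simp
      thus False using Suc.prems by simp
    qed
  qed
  then obtain y where y0: "\<forall>l<r. (\<Sum>i<r. ?M l i * y i) = w l" by blast
  have y: "y l = (\<Sum>i<r. 2 ^ Suc j * y i * a_hat i l 0) + w l" if "l < r" for l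
  proof -
    have "y l - (\<Sum>i<r. 2 ^ Suc j * y i * a_hat i l 0) = w l"
      using trans[OF M[OF that, of y, symmetric] y0[rule_format, OF that]] .
    thus ?thesis by (simp only: diff_eq_eq add.commute)
  qed
  define Z where "Z l = Abs_fps (\<lambda>p. if p = Suc j then y l else fps_nth (Y l) p)" for l
  have ZY: "fps_eq_upto (Suc j) (Z l) (Y l)" for l
    by (auto simp: Z_def fps_eq_upto_def)
  have "is_jet Z (Suc (Suc j))" unfolding is_jet_def
  proof (intro allI impI conjI)
    fix l assume l: "l < r"
    show "fps_nth (Z l) 0 = (if l = 0 then 1 else 0)" using Y l by (simp add: Z_def is_jet_def)
    have "fps_eq_upto (Suc j) (\<Sum>i<r. fps_scale 2 (Z i) * a_jet i l) (\<Sum>i<r. fps_scale 2 (Y i) * a_jet i l)"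
      by (intro fps_eq_upto_sum fps_eq_upto_mult fps_eq_upto_scale ZY) simp
    also have "fps_eq_upto (Suc j) (\<Sum>i<r. fps_scale 2 (Y i) * a_jet i l) (Y l)" using Y l by (simp add: is_jet_def)
    also have "fps_eq_upto (Suc j) (Y l) (Z l)" by (rule fps_eq_upto_sym[OF ZY])
    finally have 1: "fps_eq_upto (Suc j) (\<Sum>i<r. fps_scale 2 (Z i) * a_jet i l) (Z l)" .
    have "fps_nth (\<Sum>i<r. fps_scale 2 (Z i) * a_jet i l) (Suc j) = (\<Sum>i<r. 2 ^ Suc j * y i * a_hat i l 0) + w l"
      unfolding fps_sum_nth fps_mult_nth w_def sum.distrib[symmetric]
      by (intro sum.cong refl) (simp add: Z_def a_jet_nth_0)
    also have "\<dots> = fps_nth (Z l) (Suc j)" using y[OF l] by (simp add: Z_def)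
    finally show "fps_eq_upto (Suc (Suc j)) (\<Sum>i<r. fps_scale 2 (Z i) * a_jet i l) (Z l)"
      using 1 by (auto simp: fps_eq_upto_def less_Suc_eq)
  qed
  thus ?case by blast
qed

text \<open>Taylor series at \<open>z\<close> of both sides of the refinement equation: doubling the
  argument moves the expansion point to \<open>2 * z\<close> and dilates the local variable.\<close>

lemma phi_hat_expansion_refinement:
  assumes "i < r"
  shows "fps_scale 2 (fps_expansion (phi_hat i) (2 * z)) = (\<Sum>q<r. fps_expansion (a_hat i q) z * fps_expansion (phi_hat q) z)"
proof -
  have "fps_scale 2 (fps_expansion (phi_hat i) (2 * z)) = fps_expansion (\<lambda>w. phi_hat i (2 * z + 2 * w)) 0"
    using fps_expansion_scale[OF phi_hat_holomorphic[OF assms]] by simp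
  also have "(\<lambda>w. phi_hat i (2 * z + 2 * w)) = (\<lambda>w. \<Sum>q<r. a_hat i q (z + 1 * w) * phi_hat q (z + 1 * w))"
    using phi_hat_refinement[OF assms, of "z + _"] by (simp add: distrib_left)
  also have "fps_expansion \<dots> 0 = (\<Sum>q<r. fps_expansion (\<lambda>w. a_hat i q (z + 1 * w) * phi_hat q (z + 1 * w)) 0)"
    by (rule fps_expansion_sum) (intro holomorphic_on_mult entire_shift a_hat_holomorphic phi_hat_holomorphic, simp)
  also have "\<dots> = (\<Sum>q<r. fps_expansion (\<lambda>w. a_hat i q (z + 1 * w)) 0 * fps_expansion (\<lambda>w. phi_hat q (z + 1 * w)) 0)"
    by (intro sum.cong refl fps_expansion_mult entire_shift a_hat_holomorphic phi_hat_holomorphic) simp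
  also have "\<dots> = (\<Sum>q<r. fps_expansion (a_hat i q) z * fps_expansion (phi_hat q) z)"
    by (intro sum.cong refl) (simp only: fps_expansion_scale[OF a_hat_holomorphic] fps_expansion_scale[OF phi_hat_holomorphic] fps_scale_1 lessThan_iff)
  finally show ?thesis .
qed

lemma a_hat_expansion_periodic:
  "fps_expansion (a_hat i q) (z + 2 * of_real pi * of_int k) = fps_expansion (a_hat i q) z"
proof -
  have "fps_expansion (\<lambda>w. a_hat i q ((z + 2 * of_real pi * of_int k) + 1 * w)) 0 = fps_expansion (\<lambda>w. a_hat i q (z + 1 * w)) 0"
    using a_hat_periodic[of i q "z + _" k] by (simp add: add_ac)
  thus ?thesis by (simp only: fps_expansion_scale[OF a_hat_holomorphic] fps_scale_1)
qed

section \<open>Sum rules and moments of a given jet\<close>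

context
  fixes Y :: "nat \<Rightarrow> complex fps"
  assumes Y: "is_jet Y (Suc m)"
begin

text \<open>The jet at 0 of the filter multiplied by the transform shifted by
  \<open>2 * pi * k\<close>.\<close>

definition G :: "int \<Rightarrow> complex fps" where
  "G k = (\<Sum>i<r. Y i * fps_expansion (phi_hat i) (2 * of_real pi * of_int k))"

text \<open>The refinement equation turns the dilated product into filter at doubled frequency times
  symbol times transform; periodicity places the symbol at 0, where the equation for
  \<open>Y\<close> absorbs it.\<close>

lemma G_double: "fps_eq_upto (Suc m) (fps_scale 2 (G (2 * k))) (G k)"
proof -
  define z :: complex where "z = 2 * of_real pi * of_int k"
  have a_hat: "fps_expansion (a_hat i q) z = a_jet i q" for i q
    using a_hat_expansion_periodic[of i q 0 k] by (simp add: a_jet_def z_def)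
  have "fps_scale 2 (G (2 * k)) = (\<Sum>i<r. fps_scale 2 (Y i) * fps_scale 2 (fps_expansion (phi_hat i) (2 * z)))"
    by (simp add: G_def z_def fps_scale_sum fps_scale_mult mult_ac)
  also have "\<dots> = (\<Sum>i<r. \<Sum>q<r. fps_scale 2 (Y i) * a_jet i q * fps_expansion (phi_hat q) z)"
    by (intro sum.cong refl) (simp add: phi_hat_expansion_refinement a_hat sum_distrib_left mult.assoc)
  also have "\<dots> = (\<Sum>q<r. (\<Sum>i<r. fps_scale 2 (Y i) * a_jet i q) * fps_expansion (phi_hat q) z)"
    by (subst sum.swap) (simp add: sum_distrib_right)
  also have "fps_eq_upto (Suc m) \<dots> (\<Sum>q<r. Y q * fps_expansion (phi_hat q) z)"
    using Y by (intro fps_eq_upto_sum fps_eq_upto_mult) (auto simp: is_jet_def)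
  finally show ?thesis by (simp add: G_def z_def)
qed

text \<open>Iterating \<open>G_double\<close> writes coefficient \<open>j\<close> of
  \<open>G k\<close> as \<open>2 ^ (n * j)\<close> times that of \<open>G (2 ^ n * k)\<close>. For
  \<open>j \<le> m\<close> the decay of the transform beats this factor.\<close>

lemma G_eq_0:
  assumes "k \<noteq> 0" "j \<le> m"
  shows "fps_nth (G k) j = 0"
proof -
  have step: "fps_nth (G k) j = 2 ^ (n * j) * fps_nth (G (2 ^ n * k)) j" for n
  proof (induction n)
    case (Suc n)
    have "fps_nth (G (2 ^ n * k)) j = 2 ^ j * fps_nth (G (2 * (2 ^ n * k))) j"
      using G_double[of "2 ^ n * k"] assms(2) by (simp add: fps_eq_upto_def)
    thus ?case using Suc by (simp add: power_add mult_ac)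
  qed simp
  have G: "2 ^ (n * m) * fps_nth (G (2 ^ n * k)) j
     = (\<Sum>i<r. \<Sum>p=0..j. fps_nth (Y i) p * (2 ^ (n * m) * fps_nth (fps_expansion (phi_hat i) (2 ^ n * (2 * of_real pi * of_int k))) (j - p)))" for n
    by (simp add: G_def fps_sum_nth fps_mult_nth sum_distrib_left mult_ac)
  have "(\<lambda>n. 2 ^ (n * m) * fps_nth (G (2 ^ n * k)) j) \<longlonglongrightarrow> (\<Sum>i<r. \<Sum>p=0..j. fps_nth (Y i) p * 0)"
    unfolding G by (intro tendsto_intros phi_hat_decay assms) auto
  hence lim: "(\<lambda>n. 2 ^ (n * m) * fps_nth (G (2 ^ n * k)) j) \<longlonglongrightarrow> 0" by simp
  have "(\<lambda>n. fps_nth (G k) j) \<longlonglongrightarrow> 0"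
  proof (rule Lim_null_comparison[OF _ tendsto_norm_zero[OF lim]], intro always_eventually allI)
    fix n
    have "(2::real) ^ (n * j) \<le> 2 ^ (n * m)" using assms by (intro power_increasing) auto
    thus "norm (fps_nth (G k) j) \<le> norm (2 ^ (n * m) * fps_nth (G (2 ^ n * k)) j)"
      unfolding step[of n] by (simp add: norm_mult norm_power mult_right_mono)
  qed
  thus ?thesis by (simp add: LIMSEQ_const_iff)
qed

text \<open>Multiplying the series \<open>H\<close> by the transform at
  \<open>pi + 2 * pi * k\<close> gives the dilated \<open>G (2 * k + 1)\<close>, whose index is odd
  and so nonzero. Its coefficients up to order \<open>m\<close> vanish, hence the lowest nonzero
  coefficient row of \<open>H\<close> up to that order would annihilate all samples, against
  \<open>span_pi\<close>.\<close>

lemma jet_sum_rule_pi: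
  assumes "q < r" "j \<le> m"
  shows "fps_nth (\<Sum>i<r. fps_scale 2 (Y i) * fps_expansion (a_hat i q) (of_real pi)) j = 0"
proof -
  define H where "H q = (\<Sum>i<r. fps_scale 2 (Y i) * fps_expansion (a_hat i q) (of_real pi))" for q
  let ?z = "\<lambda>k. of_real pi + 2 * of_real pi * of_int k :: complex"
  have HG: "(\<Sum>q<r. H q * fps_expansion (phi_hat q) (?z k)) = fps_scale 2 (G (2 * k + 1))" for k
  proof -
    have "(\<Sum>q<r. H q * fps_expansion (phi_hat q) (?z k))
      = (\<Sum>q<r. \<Sum>i<r. fps_scale 2 (Y i) * fps_expansion (a_hat i q) (?z k) * fps_expansion (phi_hat q) (?z k))"
      unfolding a_hat_expansion_periodic by (simp add: H_def sum_distrib_right)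
    also have "\<dots> = (\<Sum>i<r. fps_scale 2 (Y i) * (\<Sum>q<r. fps_expansion (a_hat i q) (?z k) * fps_expansion (phi_hat q) (?z k)))"
      by (subst sum.swap) (simp add: sum_distrib_left mult.assoc)
    also have "\<dots> = (\<Sum>i<r. fps_scale 2 (Y i) * fps_scale 2 (fps_expansion (phi_hat i) (2 * ?z k)))"
      by (intro sum.cong refl arg_cong2[where f = "(*)"]) (simp only: phi_hat_expansion_refinement lessThan_iff)
    also have "2 * ?z k = 2 * of_real pi * of_int (2 * k + 1)"
      by (simp add: algebra_simps)
    finally show ?thesis by (simp add: G_def fps_scale_sum fps_scale_mult)
  qed
  have "\<forall>q<r. fps_nth (H q) j = 0" using assms(2)
  proof (induction j rule: less_induct)
    case (less j)
    have "(\<Sum>q<r. fps_nth (H q) j * phi_hat q (?z k)) = 0" for k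
    proof -
      have "fps_nth (H q * fps_expansion (phi_hat q) (?z k)) j = fps_nth (H q) j * phi_hat q (?z k)" if "q < r" for q
      proof -
        have "fps_nth (H q * fps_expansion (phi_hat q) (?z k)) j
          = (\<Sum>p=0..j. if p = j then fps_nth (H q) p * fps_nth (fps_expansion (phi_hat q) (?z k)) (j - p) else 0)"
          \<comment> \<open>The lower coefficients of \<open>H\<close> vanish by induction, so only
            the term \<open>p = j\<close> of the Cauchy product survives.\<close>
          unfolding fps_mult_nth using less that by (intro sum.cong) auto
        thus ?thesis by (simp add: fps_nth_fps_expansion)
      qed
      hence "(\<Sum>q<r. fps_nth (H q) j * phi_hat q (?z k)) = fps_nth (\<Sum>q<r. H q * fps_expansion (phi_hat q) (?z k)) j"
        by (simp add: fps_sum_nth)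
      also have "2 * k + 1 \<noteq> 0" by presburger
      hence "fps_nth (\<Sum>q<r. H q * fps_expansion (phi_hat q) (?z k)) j = 0"
        unfolding HG using less.prems by (simp add: G_eq_0)
      finally show ?thesis .
    qed
    thus ?case using span_pi[of "\<lambda>q. fps_nth (H q) j"] by blast
  qed
  thus ?thesis using assms by (simp add: H_def)
qed

text \<open>The first sum rule telescopes along the product: each further symbol halves the argument
  of the filter.\<close>

lemma jet_P:
  assumes "l < r"
  shows "fps_eq_upto (Suc m) (\<Sum>i<r. Y i * fps_expansion (P n i l) 0) (fps_scale (1 / 2 ^ n) (Y l))"
  using assms
proof (induction n arbitrary: l)
  case 0
  have "(\<Sum>i<r. Y i * fps_expansion (P 0 i l) 0) = (\<Sum>i<r. if i = l then Y i else 0)"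
  proof (intro sum.cong refl)
    fix i assume "i \<in> {..<r}"
    hence "P 0 i l = (\<lambda>_. if i = l then 1 else 0)" using P_0 0 by auto
    thus "Y i * fps_expansion (P 0 i l) 0 = (if i = l then Y i else 0)" by (simp add: fps_expansion_const)
  qed
  thus ?case using 0 by simp
next
  case (Suc n)
  let ?c = "1 / 2 ^ Suc n :: complex"
  have P: "fps_expansion (P (Suc n) i l) 0 = (\<Sum>q<r. fps_expansion (P n i q) 0 * fps_scale ?c (a_jet q l))" if "i < r" for i
  proof -
    have "P (Suc n) i l = (\<lambda>z. \<Sum>q<r. P n i q z * a_hat q l (0 + ?c * z))"
      using P_Suc[OF that Suc.prems] by (auto simp: fun_eq_iff)
    hence "fps_expansion (P (Suc n) i l) 0 = (\<Sum>q<r. fps_expansion (\<lambda>z. P n i q z * a_hat q l (0 + ?c * z)) 0)"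
      by (simp only:) (intro fps_expansion_sum holomorphic_on_mult P_holomorphic entire_shift a_hat_holomorphic)
    also have "\<dots> = (\<Sum>q<r. fps_expansion (P n i q) 0 * fps_expansion (\<lambda>z. a_hat q l (0 + ?c * z)) 0)"
      by (intro sum.cong refl fps_expansion_mult P_holomorphic entire_shift a_hat_holomorphic)
    finally show ?thesis by (simp only: a_jet_def fps_expansion_scale[OF a_hat_holomorphic])
  qed
  have "(\<Sum>i<r. Y i * fps_expansion (P (Suc n) i l) 0) = (\<Sum>i<r. \<Sum>q<r. Y i * fps_expansion (P n i q) 0 * fps_scale ?c (a_jet q l))"
    by (intro sum.cong refl) (simp add: P sum_distrib_left mult.assoc)
  also have "\<dots> = (\<Sum>q<r. (\<Sum>i<r. Y i * fps_expansion (P n i q) 0) * fps_scale ?c (a_jet q l))"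
    by (subst sum.swap) (simp add: sum_distrib_right)
  also have "fps_eq_upto (Suc m) \<dots> (\<Sum>q<r. fps_scale (1 / 2 ^ n) (Y q) * fps_scale ?c (a_jet q l))"
    by (intro fps_eq_upto_sum fps_eq_upto_mult Suc.IH) auto
  also have "\<dots> = fps_scale ?c (\<Sum>q<r. fps_scale 2 (Y q) * a_jet q l)"
    by (simp add: fps_scale_sum fps_scale_mult fps_scale_scale)
  also have "fps_eq_upto (Suc m) \<dots> (fps_scale ?c (Y l))"
    using Y Suc.prems by (intro fps_eq_upto_scale) (auto simp: is_jet_def)
  finally show ?case .
qed

text \<open>By \<open>jet_P\<close>, coefficient \<open>j\<close> of the filter times column
  \<open>l\<close> of \<open>P n\<close>, scaled by \<open>2 ^ (l * n)\<close>, is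
  \<open>(2 ^ (l - j)) ^ n\<close> times coefficient \<open>j\<close> of \<open>Y l\<close>. It
  converges by \<open>P_jet_limit\<close>, so it is zero for \<open>j < l\<close>. For
  \<open>j = l\<close> the sequence is constant, and its limit is \<open>\<i> ^ l\<close> times the
  value 1 of filter times transform at 0.\<close>

lemma jet_moments:
  assumes "l < r" "j \<le> l"
  shows "fps_nth (Y l) j = (if j = l then \<i> ^ l else 0)"
proof -
  have jm: "j < Suc m" using assms r_le by simp
  define L where "L = fps_nth (\<Sum>i<r. Y i * (fps_const (\<i> ^ l) * fps_X ^ l * fps_expansion (phi_hat i) 0)) j"
  have "(\<lambda>n. \<Sum>i<r. \<Sum>p=0..j. fps_nth (Y i) p * (2 ^ (l * n) * fps_nth (fps_expansion (P n i l) 0) (j - p)))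
     \<longlonglongrightarrow> (\<Sum>i<r. \<Sum>p=0..j. fps_nth (Y i) p * fps_nth (fps_const (\<i> ^ l) * fps_X ^ l * fps_expansion (phi_hat i) 0) (j - p))"
    by (intro tendsto_intros P_jet_limit assms) auto
  also have "(\<lambda>n. \<Sum>i<r. \<Sum>p=0..j. fps_nth (Y i) p * (2 ^ (l * n) * fps_nth (fps_expansion (P n i l) 0) (j - p)))
     = (\<lambda>n. 2 ^ (l * n) * fps_nth (\<Sum>i<r. Y i * fps_expansion (P n i l) 0) j)"
    by (simp add: fps_sum_nth fps_mult_nth sum_distrib_left mult_ac)
  also have "\<dots> = (\<lambda>n. 2 ^ (l * n) * ((1 / 2 ^ n) ^ j * fps_nth (Y l) j))"
    using jet_P[OF assms(1)] jm by (simp add: fps_eq_upto_def)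
  also have "\<dots> = (\<lambda>n. (2 ^ (l - j)) ^ n * fps_nth (Y l) j)"
  proof
    fix n
    have "(2::complex) ^ (l * n) = 2 ^ ((l - j) * n) * 2 ^ (n * j)"
      using assms(2) by (simp add: power_add[symmetric] algebra_simps)
    thus "2 ^ (l * n) * ((1 / 2 ^ n) ^ j * fps_nth (Y l) j) = (2 ^ (l - j)) ^ n * fps_nth (Y l) j"
      by (simp add: power_divide power_mult)
  qed
  also have "(\<Sum>i<r. \<Sum>p=0..j. fps_nth (Y i) p * fps_nth (fps_const (\<i> ^ l) * fps_X ^ l * fps_expansion (phi_hat i) 0) (j - p)) = L"
    by (simp only: L_def fps_sum_nth fps_mult_nth)
  finally have lim: "(\<lambda>n. (2 ^ (l - j)) ^ n * fps_nth (Y l) j) \<longlonglongrightarrow> L" .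
  show ?thesis
  proof (cases "j = l")
    case True
    have "L = fps_nth (fps_X ^ l * (fps_const (\<i> ^ l) * (\<Sum>i<r. Y i * fps_expansion (phi_hat i) 0))) l"
      unfolding L_def True by (simp add: sum_distrib_left mult_ac)
    also have "\<dots> = \<i> ^ l * (\<Sum>i<r. fps_nth (Y i) 0 * phi_hat i 0)"
      by (simp add: fps_X_power_mult_nth fps_sum_nth fps_nth_fps_expansion)
    also have "(\<Sum>i<r. fps_nth (Y i) 0 * phi_hat i 0) = (\<Sum>i<r. if i = 0 then phi_hat i 0 else 0)"
      using Y by (intro sum.cong) (auto simp: is_jet_def)
    also have "(\<Sum>i<r. if i = 0 then phi_hat i 0 else 0) = 1" using r_pos phi_hat_normalized by simp
    finally show ?thesis using lim True by (simp add: LIMSEQ_const_iff)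
  next
    case False
    hence "(\<lambda>n. (1 / 2 ^ (l - j)) ^ n :: complex) \<longlonglongrightarrow> 0"
      using assms(2) by (intro LIMSEQ_power_zero) (auto simp: norm_divide norm_power)
    from tendsto_mult[OF this lim]
    have "(\<lambda>n. fps_nth (Y l) j) \<longlonglongrightarrow> 0" by (simp add: power_divide)
    thus ?thesis using False by (simp add: LIMSEQ_const_iff)
  qed
qed

end

end

section \<open>Eigenvalues, the matching filter and the refinement equation\<close>

lemma mult_mat_vec_index:
  "M \<in> carrier_mat n k \<Longrightarrow> v \<in> carrier_vec k \<Longrightarrow> i < n \<Longrightarrow> (M *\<^sub>v v) $ i = (\<Sum>l<k. M $$ (i, l) * v $ l)"
  by (auto simp: scalar_prod_def atLeast0LessThan intro!: sum.cong)

text \<open>Expanding the unit vector in the spanning vectors evaluates the functional at coordinate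
  \<open>q\<close>. This passes from \<open>cspan\<close> to the dual conditions of
  \<open>hermite_limit_span\<close>.\<close>

lemma orthogonal_to_cspan:
  assumes span: "cspan r S = carrier_vec r" and S: "S \<subseteq> carrier_vec r"
    and h: "\<And>v. v \<in> S \<Longrightarrow> (\<Sum>q<r. h q * v $ q) = 0" and q: "q < r"
  shows "h q = 0"
proof -
  interpret vec_space "TYPE(complex)" r .
  have "unit_vec r q \<in> span S" using span unfolding cspan_def by simp
  then obtain c X where X: "finite X" "X \<subseteq> S" and u: "unit_vec r q = lincomb c X"
    unfolding span_def by auto
  have "h q = (\<Sum>i<r. if i = q then h i else 0)" using q by simp
  also have "\<dots> = (\<Sum>i<r. h i * unit_vec r q $ i)"
    using q by (intro sum.cong) auto
  also have "\<dots> = (\<Sum>i<r. \<Sum>x\<in>X. c x * (h i * x $ i))"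
    unfolding u using X S by (intro sum.cong refl) (subst lincomb_index, auto simp: sum_distrib_left mult_ac)
  also have "\<dots> = (\<Sum>x\<in>X. c x * (\<Sum>i<r. h i * x $ i))"
    by (subst sum.swap) (simp add: sum_distrib_left)
  also have "\<dots> = 0" using h X by (intro sum.neutral) auto
  finally show ?thesis .
qed

context hermite_limit_span
begin

lemma symbol_mult_vec: "v \<in> carrier_vec r \<Longrightarrow> i < r \<Longrightarrow> (symbol r r a 0 *\<^sub>v v) $ i = (\<Sum>l<r. a_hat i l 0 * v $ l)"
  unfolding mult_mat_vec_index[OF symbol_carrier] by (intro sum.cong) (simp_all add: symbol_entry)

text \<open>The transform at 0 is an eigenvector by the refinement equation at frequency 0; its
  entry 0 is 1.\<close>

lemma eigenvalue_1: "eigenvalue (symbol r r a 0) 1"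
proof -
  define v where "v = vec r (\<lambda>i. phi_hat i 0)"
  have v: "v \<in> carrier_vec r" by (simp add: v_def)
  have "v $ 0 \<noteq> 0\<^sub>v r $ 0" using r_pos phi_hat_normalized by (simp add: v_def)
  hence nz: "v \<noteq> 0\<^sub>v r" by metis
  have "symbol r r a 0 *\<^sub>v v = 1 \<cdot>\<^sub>v v"
  proof (rule eq_vecI)
    fix i assume "i < dim_vec (1 \<cdot>\<^sub>v v)"
    hence i: "i < r" by (simp add: v_def)
    have "(symbol r r a 0 *\<^sub>v v) $ i = (\<Sum>l<r. a_hat i l 0 * phi_hat l 0)"
      using symbol_mult_vec[OF v i] by (simp add: v_def)
    thus "(symbol r r a 0 *\<^sub>v v) $ i = (1 \<cdot>\<^sub>v v) $ i" using phi_hat_refinement[OF i, of 0] i by (simp add: v_def)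
  qed (use symbol_carrier[of 0] in \<open>auto simp: v_def\<close>)
  thus ?thesis using v nz symbol_carrier[of 0] by (auto simp: eigenvalue_def eigenvector_def)
qed

text \<open>The first row of the symbol at 0 is a unit row, so Laplace expansion splits off the
  factor \<open>[:-1, 1:]\<close> and leaves the characteristic polynomial of the block
  \<open>?B\<close>. An eigenvector of \<open>?B\<close> for 1 would extend to a fixed vector with
  entry 0 equal to 0, which \<open>fixed_vector_eq_0\<close> rules out.\<close>

lemma order_char_poly: "Polynomial.order 1 (char_poly (symbol r r a 0)) = 1"
proof -
  let ?M = "symbol r r a 0" and ?C = "char_poly_matrix (symbol r r a 0)"
  let ?B = "mat_delete (symbol r r a 0) 0 0"
  obtain r' where r': "r = Suc r'" using r_pos by (cases r) auto
  have M: "?M \<in> carrier_mat r r" by (rule symbol_carrier)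
  have B: "?B \<in> carrier_mat r' r'" using M r' by (simp add: mat_delete_def)
  have Bij: "?B $$ (i, j) = a_hat (Suc i) (Suc j) 0" if "i < r'" "j < r'" for i j
    using that r' M symbol_entry[of "Suc i" "Suc j" 0] by (simp add: mat_delete_def)
  have C: "?C \<in> carrier_mat r r" using M by simp
  have "mat_delete ?C 0 0 = char_poly_matrix ?B"
  proof (rule eq_matI)
    fix i j assume "i < dim_row (char_poly_matrix ?B)" "j < dim_col (char_poly_matrix ?B)"
    hence "i < r'" "j < r'" using char_poly_matrix_closed[OF B] by auto
    thus "mat_delete ?C 0 0 $$ (i, j) = char_poly_matrix ?B $$ (i, j)"
      using M B r' by (simp add: mat_delete_def char_poly_matrix_def)
  qed (use M B C r' in \<open>auto simp: mat_delete_def char_poly_matrix_def\<close>)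
  hence cof: "cofactor ?C 0 0 = char_poly ?B" by (simp add: cofactor_def char_poly_def)
  have "char_poly ?M = (\<Sum>j<r. ?C $$ (0, j) * cofactor ?C 0 j)"
    unfolding char_poly_def by (rule laplace_expansion_row[OF C r_pos])
  also have "\<dots> = (\<Sum>j<r. if j = 0 then [:-1, 1:] * cofactor ?C 0 0 else 0)"
    using M r_pos by (intro sum.cong) (auto simp: char_poly_matrix_def symbol_entry a_hat_row_0)
  finally have cp: "char_poly ?M = [:-1, 1:] * char_poly ?B" using r_pos cof by simp
  have "poly (char_poly ?B) 1 \<noteq> 0"
  proof
    assume "poly (char_poly ?B) 1 = 0"
    hence "eigenvalue ?B 1" using eigenvalue_root_char_poly[OF B] by simp
    then obtain v where v: "v \<in> carrier_vec r'" "v \<noteq> 0\<^sub>v r'" "?B *\<^sub>v v = v"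
      using B by (auto simp: eigenvalue_def eigenvector_def)
    \<comment> \<open>The eigenvector of \<open>?B\<close> is preceded by a 0; by the shape of row 0
      this is a fixed vector of the whole matrix.\<close>
    define u where "u i = (if i = 0 then 0 else v $ (i - 1))" for i
    have fixed: "(\<Sum>l<r. a_hat i l 0 * u l) = u i" if "i < r" for i
    proof (cases i)
      case 0
      have "(\<Sum>l<r. a_hat i l 0 * u l) = 0" using 0 by (intro sum.neutral) (auto simp: a_hat_row_0 u_def)
      thus ?thesis using 0 by (simp add: u_def)
    next
      case (Suc i')
      hence i': "i' < r'" using that r' by simp
      have "(\<Sum>l<r. a_hat i l 0 * u l) = (\<Sum>l<r'. a_hat (Suc i') (Suc l) 0 * v $ l)"
        unfolding r' sum.lessThan_Suc_shift Suc by (simp add: u_def)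
      also have "\<dots> = (?B *\<^sub>v v) $ i'"
        unfolding mult_mat_vec_index[OF B v(1) i'] using Bij[OF i'] by (intro sum.cong) auto
      finally show ?thesis using v(3) Suc by (simp add: u_def)
    qed
    have "u i = 0" if "i < r" for i
      by (rule fixed_vector_eq_0[OF fixed _ that]) (auto simp: u_def)
    hence "u (Suc i) = 0" if "i < r'" for i using that r' by blast
    hence "v $ i = 0" if "i < r'" for i using that by (simp add: u_def)
    hence "v = 0\<^sub>v r'" using v(1) by (intro eq_vecI) auto
    thus False using v(2) by simp
  qed
  hence "[:-1, 1:] * char_poly ?B \<noteq> 0" "Polynomial.order 1 (char_poly ?B) = 0"
    by (simp only: mult_eq_0_iff, auto, rule order_0I)
  moreover have "Polynomial.order 1 [:-1, 1 :: complex:] = 1"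
    using order_power_n_n[of "1::complex" 1] by simp
  ultimately show ?thesis unfolding cp by (subst Polynomial.order_mult) simp_all
qed

text \<open>A matrix and its transpose share their characteristic polynomial, so each eigenvalue
  also has a left eigenvector, to which \<open>left_eigenvalue_bound\<close> applies.\<close>

lemma other_eigenvalues:
  assumes "eigenvalue (symbol r r a 0) z" "z \<noteq> 1"
  shows "cmod z < 1 / 2 ^ m"
proof -
  let ?M = "symbol r r a 0"
  have M: "?M \<in> carrier_mat r r" by (rule symbol_carrier)
  hence T: "?M\<^sup>T \<in> carrier_mat r r" by simp
  have "eigenvalue (?M\<^sup>T) z"
    using assms(1) eigenvalue_root_char_poly[OF M] eigenvalue_root_char_poly[OF T] M by simp
  then obtain v where v: "v \<in> carrier_vec r" "v \<noteq> 0\<^sub>v r" "?M\<^sup>T *\<^sub>v v = z \<cdot>\<^sub>v v"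
    using T by (auto simp: eigenvalue_def eigenvector_def)
  obtain i0 where i0: "i0 < r" "v $ i0 \<noteq> 0"
    using v(1,2) by (metis carrier_vecD eq_vecI index_zero_vec(1) index_zero_vec(2))
  have "(\<Sum>i<r. v $ i * a_hat i l 0) = z * v $ l" if "l < r" for l
  proof -
    have "(?M\<^sup>T *\<^sub>v v) $ l = (\<Sum>i<r. v $ i * a_hat i l 0)"
      unfolding mult_mat_vec_index[OF T v(1) that] using M that
      by (intro sum.cong) (simp_all add: symbol_entry mult.commute)
    thus ?thesis using v that by simp
  qed
  from left_eigenvalue_bound[OF this i0(1) i0(2) assms(2)] show ?thesis .
qed

text \<open>The claims on the filter involve only Taylor coefficients of order at most
  \<open>m\<close>, so it is enough to realize the formal jet \<open>Y\<close> by trigonometric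
  polynomials.\<close>

lemma sum_rule_sequence_exists:
  "\<exists>\<upsilon> \<in> finite_seqs 1 r. sum_rules r (m + 1) a \<upsilon> \<and> hermite_moments r \<upsilon> \<and> hermite_factors r (m + 1) \<upsilon>"
proof -
  obtain Y where Y: "is_jet Y (Suc m)" using jet_exists[of m] by blast
  note mom = jet_moments[OF Y]
  have "\<forall>l. \<exists>c. finite {k. c k \<noteq> 0} \<and> fps_eq_upto (Suc m) (fps_expansion (trig_poly c) 0) (Y l)"
    using trig_poly_jet_exists by blast
  then obtain c where c_fin: "\<And>l::nat. finite {k. c l k \<noteq> 0}"
    and c: "\<And>l. fps_eq_upto (Suc m) (fps_expansion (trig_poly (c l)) 0) (Y l)" by metis
  have c_nth: "fps_nth (fps_expansion (trig_poly (c l)) 0) j = fps_nth (Y l) j" if "j \<le> m" for l j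
    using c[of l] that by (simp add: fps_eq_upto_def)
  have tp: "trig_poly (c l) holomorphic_on S" for l S by (rule trig_poly_holomorphic)
  define \<upsilon> where "\<upsilon> k = mat 1 r (\<lambda>(_, l). c l k)" for k :: int
  have "{k. \<upsilon> k \<noteq> 0\<^sub>m 1 r} \<subseteq> (\<Union>l<r. {k. c l k \<noteq> 0})"
  proof
    fix k assume "k \<in> {k. \<upsilon> k \<noteq> 0\<^sub>m 1 r}"
    hence "\<exists>l<r. c l k \<noteq> 0" unfolding \<upsilon>_def by (auto simp: mat_eq_iff)
    thus "k \<in> (\<Union>l<r. {k. c l k \<noteq> 0})" by auto
  qed
  hence "finite {k. \<upsilon> k \<noteq> 0\<^sub>m 1 r}" by (rule finite_subset) (use c_fin in auto)
  hence \<upsilon>_fin: "\<upsilon> \<in> finite_seqs 1 r" by (simp add: finite_seqs_def seqs_def \<upsilon>_def)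
  have sym: "symbol 1 r \<upsilon> \<xi> $$ (0, l) = trig_poly (c l) (of_real \<xi>)" if "l < r" for \<xi> l
    using that by (simp add: symbol_def \<upsilon>_def scalar_symbol_eq_trig_poly c_fin)
  have sym_mult: "(symbol 1 r \<upsilon> \<xi> * symbol r r a \<zeta>) $$ (0, l) = (\<Sum>i<r. trig_poly (c i) (of_real \<xi>) * a_hat i l (of_real \<zeta>))"
    if "l < r" for \<xi> \<zeta> l
  proof -
    have "symbol 1 r \<upsilon> \<xi> \<in> carrier_mat 1 r" by (simp add: symbol_def)
    hence "(symbol 1 r \<upsilon> \<xi> * symbol r r a \<zeta>) $$ (0, l) = (\<Sum>i<r. symbol 1 r \<upsilon> \<xi> $$ (0, i) * symbol r r a \<zeta> $$ (i, l))"
      using that symbol_carrier[of \<zeta>] by (auto simp: scalar_prod_def atLeast0LessThan intro!: sum.cong)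
    also have "\<dots> = (\<Sum>i<r. trig_poly (c i) (of_real \<xi>) * a_hat i l (of_real \<zeta>))"
      using that by (intro sum.cong refl) (simp only: sym symbol_entry lessThan_iff)
    finally show ?thesis .
  qed
  \<comment> \<open>The arguments have the shape required by \<open>entire_shift\<close> and
    \<open>fps_expansion_scale\<close>; \<open>z = 0\<close> and \<open>z = pi\<close> give the two
    sum rules.\<close>
  have holo: "(\<lambda>w. trig_poly (c i) (0 + 2 * w) * a_hat i l (z + 1 * w)) holomorphic_on UNIV" for i l z
    by (intro holomorphic_on_mult entire_shift tp a_hat_holomorphic)
  have jet_mult: "fps_expansion (\<lambda>w. \<Sum>i<r. trig_poly (c i) (0 + 2 * w) * a_hat i l (z + 1 * w)) 0
      = (\<Sum>i<r. fps_scale 2 (fps_expansion (trig_poly (c i)) 0) * fps_expansion (a_hat i l) z)" for l z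
  proof -
    have "fps_expansion (\<lambda>w. \<Sum>i<r. trig_poly (c i) (0 + 2 * w) * a_hat i l (z + 1 * w)) 0
      = (\<Sum>i<r. fps_expansion (\<lambda>w. trig_poly (c i) (0 + 2 * w) * a_hat i l (z + 1 * w)) 0)"
      by (rule fps_expansion_sum) (rule holo)
    also have "\<dots> = (\<Sum>i<r. fps_expansion (\<lambda>w. trig_poly (c i) (0 + 2 * w)) 0 * fps_expansion (\<lambda>w. a_hat i l (z + 1 * w)) 0)"
      by (intro sum.cong refl fps_expansion_mult entire_shift tp a_hat_holomorphic)
    finally show ?thesis by (simp only: fps_expansion_scale[OF tp] fps_expansion_scale[OF a_hat_holomorphic] fps_scale_1)
  qed
  have jet_Y: "fps_eq_upto (Suc m) (\<Sum>i<r. fps_scale 2 (fps_expansion (trig_poly (c i)) 0) * fps_expansion (a_hat i l) z)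
      (\<Sum>i<r. fps_scale 2 (Y i) * fps_expansion (a_hat i l) z)" for l z
    by (intro fps_eq_upto_sum fps_eq_upto_mult fps_eq_upto_scale c) simp
  have "sum_rules r (m + 1) a \<upsilon>" unfolding sum_rules_def
  proof (intro conjI allI impI)
    have "symbol 1 r \<upsilon> 0 $$ (0, 0) = fps_nth (Y 0) 0"
      using sym[OF r_pos, of 0] c_nth[of 0 0] by (simp add: fps_nth_fps_expansion del: One_nat_def)
    also have "\<dots> = 1" using Y r_pos by (simp add: is_jet_def)
    finally have "symbol 1 r \<upsilon> 0 $$ (0, 0) \<noteq> 0\<^sub>m 1 r $$ (0, 0)" using r_pos by simp
    thus "symbol 1 r \<upsilon> 0 \<noteq> 0\<^sub>m 1 r" by metis
  next
    fix l assume l: "l < r"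
    have "eq_upto_O (m + 1) (\<lambda>\<xi>. (symbol 1 r \<upsilon> (2 * \<xi>) * symbol r r a \<xi>) $$ (0, l)) (\<lambda>\<xi>. symbol 1 r \<upsilon> \<xi> $$ (0, l))
      \<longleftrightarrow> (\<forall>j<m + 1. fps_nth (fps_expansion (\<lambda>w. \<Sum>i<r. trig_poly (c i) (0 + 2 * w) * a_hat i l (0 + 1 * w)) 0) j
            = fps_nth (fps_expansion (trig_poly (c l)) 0) j)"
      by (rule eq_upto_O_entire) (intro holomorphic_on_sum holo tp, rule tp, simp_all add: sym_mult sym l del: One_nat_def)
    moreover have "fps_eq_upto (Suc m) (\<Sum>i<r. fps_scale 2 (Y i) * fps_expansion (a_hat i l) 0) (Y l)"
      using Y l by (simp add: is_jet_def a_jet_def)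
    hence "fps_eq_upto (Suc m) (fps_expansion (\<lambda>w. \<Sum>i<r. trig_poly (c i) (0 + 2 * w) * a_hat i l (0 + 1 * w)) 0) (fps_expansion (trig_poly (c l)) 0)"
      unfolding jet_mult using jet_Y c fps_eq_upto_trans fps_eq_upto_sym by blast
    ultimately show "eq_upto_O (m + 1) (\<lambda>\<xi>. (symbol 1 r \<upsilon> (2 * \<xi>) * symbol r r a \<xi>) $$ (0, l)) (\<lambda>\<xi>. symbol 1 r \<upsilon> \<xi> $$ (0, l))"
      by (simp only: fps_eq_upto_def Suc_eq_plus1)
  next
    fix l assume l: "l < r"
    have "eq_upto_O (m + 1) (\<lambda>\<xi>. (symbol 1 r \<upsilon> (2 * \<xi>) * symbol r r a (\<xi> + pi)) $$ (0, l)) (\<lambda>\<xi>. 0)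
      \<longleftrightarrow> (\<forall>j<m + 1. fps_nth (fps_expansion (\<lambda>w. \<Sum>i<r. trig_poly (c i) (0 + 2 * w) * a_hat i l (of_real pi + 1 * w)) 0) j
            = fps_nth (fps_expansion (\<lambda>_. 0) 0) j)"
      by (rule eq_upto_O_entire) (intro holomorphic_on_sum holo, rule holomorphic_on_const, simp_all add: sym_mult l add.commute del: One_nat_def)
    moreover have "fps_nth (\<Sum>i<r. fps_scale 2 (fps_expansion (trig_poly (c i)) 0) * fps_expansion (a_hat i l) (of_real pi)) j = 0"
      if "j < Suc m" for j
      using jet_Y[of l "of_real pi"] jet_sum_rule_pi[OF Y l, of j] that unfolding fps_eq_upto_def by simp
    ultimately show "eq_upto_O (m + 1) (\<lambda>\<xi>. (symbol 1 r \<upsilon> (2 * \<xi>) * symbol r r a (\<xi> + pi)) $$ (0, l)) (\<lambda>\<xi>. 0)"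
      unfolding jet_mult by (simp add: fps_expansion_const)
  qed
  moreover have mono: "fps_expansion (\<lambda>z. (\<i> * z) ^ l) 0 = fps_const (\<i> ^ l) * fps_X ^ l" for l
    by (simp add: fps_expansion_power fps_expansion_cmult fps_expansion_ident holomorphic_intros power_mult_distrib
        flip: fps_const_power)
  have "hermite_moments r \<upsilon>" unfolding hermite_moments_def
  proof (intro allI impI)
    fix l assume l: "l < r"
    have "eq_upto_O (l + 1) (\<lambda>\<xi>. symbol 1 r \<upsilon> \<xi> $$ (0, l)) (\<lambda>\<xi>. (\<i> * of_real \<xi>) ^ l)
      \<longleftrightarrow> (\<forall>j<l + 1. fps_nth (fps_expansion (trig_poly (c l)) 0) j = fps_nth (fps_expansion (\<lambda>z. (\<i> * z) ^ l) 0) j)"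
      by (rule eq_upto_O_entire) (rule tp, intro holomorphic_intros, simp_all add: sym l del: One_nat_def)
    moreover have "fps_nth (fps_expansion (trig_poly (c l)) 0) j = fps_nth (fps_const (\<i> ^ l) * fps_X ^ l) j"
      if "j < l + 1" for j
      using that l r_le c_nth[of j l] mom[OF l, of j] by (simp add: fps_X_power_nth)
    ultimately show "eq_upto_O (l + 1) (\<lambda>\<xi>. symbol 1 r \<upsilon> \<xi> $$ (0, l)) (\<lambda>\<xi>. (\<i> * of_real \<xi>) ^ l)"
      unfolding mono by blast
  qed
  moreover have "hermite_factors r (m + 1) \<upsilon>" unfolding hermite_factors_def
  proof -
    \<comment> \<open>The quotient of \<open>Y l\<close> by \<open>(\<i> * fps_X) ^ l\<close>. The
      division is exact with constant coefficient 1 by \<open>jet_moments\<close>.\<close>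
    define Z where "Z l = fps_const (1 / \<i> ^ l) * fps_shift l (Y l)" for l
    have "\<forall>l. \<exists>d. finite {k. d k \<noteq> 0} \<and> fps_eq_upto (Suc m) (fps_expansion (trig_poly d) 0) (Z l)"
      using trig_poly_jet_exists by blast
    then obtain d where d_fin: "\<And>l::nat. finite {k. d l k \<noteq> 0}"
      and d: "\<And>l. fps_eq_upto (Suc m) (fps_expansion (trig_poly (d l)) 0) (Z l)" by metis
    have "d l \<in> scalar_finite_seqs \<and> scalar_symbol (d l) 0 = 1 \<and>
        eq_upto_O (m + 1) (\<lambda>\<xi>. symbol 1 r \<upsilon> \<xi> $$ (0, l)) (\<lambda>\<xi>. (\<i> * of_real \<xi>) ^ l * scalar_symbol (d l) \<xi>)"
      if l: "l < r" for l
    proof (intro conjI)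
      show "d l \<in> scalar_finite_seqs" using d_fin by (simp add: scalar_finite_seqs_def)
      have "scalar_symbol (d l) 0 = fps_nth (fps_expansion (trig_poly (d l)) 0) 0"
        by (simp add: scalar_symbol_eq_trig_poly d_fin fps_nth_fps_expansion)
      also have "\<dots> = fps_nth (Z l) 0" using d[of l] by (simp add: fps_eq_upto_def)
      also have "\<dots> = 1" using mom[OF l, of l] by (simp add: Z_def)
      finally show "scalar_symbol (d l) 0 = 1" .
      have th: "trig_poly (d l) holomorphic_on S" for S by (rule trig_poly_holomorphic)
      have "eq_upto_O (m + 1) (\<lambda>\<xi>. symbol 1 r \<upsilon> \<xi> $$ (0, l)) (\<lambda>\<xi>. (\<i> * of_real \<xi>) ^ l * scalar_symbol (d l) \<xi>)
        \<longleftrightarrow> (\<forall>j<m + 1. fps_nth (fps_expansion (trig_poly (c l)) 0) j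
              = fps_nth (fps_expansion (\<lambda>z. (\<i> * z) ^ l * trig_poly (d l) z) 0) j)"
        by (rule eq_upto_O_entire) (rule tp, intro holomorphic_intros th, simp_all add: sym l scalar_symbol_eq_trig_poly d_fin del: One_nat_def)
      moreover have "fps_expansion (\<lambda>z. (\<i> * z) ^ l * trig_poly (d l) z) 0
          = fps_const (\<i> ^ l) * fps_X ^ l * fps_expansion (trig_poly (d l)) 0"
        using mono[of l] fps_expansion_mult[of "\<lambda>z. (\<i> * z) ^ l" "trig_poly (d l)" 0]
        by (simp add: th holomorphic_intros)
      moreover have "fps_eq_upto (Suc m) (fps_const (\<i> ^ l) * fps_X ^ l * fps_expansion (trig_poly (d l)) 0)
          (fps_const (\<i> ^ l) * fps_X ^ l * Z l)"
        by (intro fps_eq_upto_mult d) simp_all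
      moreover have "fps_const (\<i> ^ l) * fps_X ^ l * Z l = Y l"
      proof (rule fps_ext)
        fix j
        have Z1: "fps_const (\<i> ^ l) * fps_X ^ l * Z l = fps_X ^ l * (fps_const (\<i> ^ l) * Z l)" by (simp add: mult_ac)
        have Z2: "fps_const (\<i> ^ l) * Z l = fps_shift l (Y l)"
          by (rule fps_ext) (simp add: Z_def)
        show "fps_nth (fps_const (\<i> ^ l) * fps_X ^ l * Z l) j = fps_nth (Y l) j"
          unfolding Z1 Z2 using mom[OF l, of j] by (simp add: fps_X_power_mult_nth)
      qed
      ultimately show "eq_upto_O (m + 1) (\<lambda>\<xi>. symbol 1 r \<upsilon> \<xi> $$ (0, l)) (\<lambda>\<xi>. (\<i> * of_real \<xi>) ^ l * scalar_symbol (d l) \<xi>)"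
        using c_nth by (simp add: fps_eq_upto_def less_Suc_eq_le)
    qed
    thus "\<exists>d. \<forall>l<r. d l \<in> scalar_finite_seqs \<and> scalar_symbol (d l) 0 = 1 \<and>
        eq_upto_O (m + 1) (\<lambda>\<xi>. symbol 1 r \<upsilon> \<xi> $$ (0, l)) (\<lambda>\<xi>. (\<i> * of_real \<xi>) ^ l * scalar_symbol (d l) \<xi>)"
      by blast
  qed
  ultimately show ?thesis using \<upsilon>_fin by blast
qed

lemma refinement_vec:
  assumes "\<And>x. \<phi> x \<in> carrier_vec r" "\<And>i x. i < r \<Longrightarrow> \<phi> x $ i = F i 0 x"
  shows "\<phi> x = vec r (\<lambda>i. 2 * (\<Sum>\<^sub>\<infinity>k. (a k *\<^sub>v \<phi> (2 * x - of_int k)) $ i))"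
proof (rule eq_vecI)
  fix i assume "i < dim_vec (vec r (\<lambda>i. 2 * (\<Sum>\<^sub>\<infinity>k. (a k *\<^sub>v \<phi> (2 * x - of_int k)) $ i)))"
  hence i: "i < r" by simp
  have e: "(a k *\<^sub>v \<phi> (2 * x - of_int k)) $ i = (\<Sum>t<r. a k $$ (i, t) * F t 0 (2 * x - of_int k))" for k
    using a_carrier[of k] assms(1)[of "2 * x - of_int k"] i
    by (auto simp: scalar_prod_def atLeast0LessThan assms(2) intro!: sum.cong)
  have "(\<Sum>\<^sub>\<infinity>k. (a k *\<^sub>v \<phi> (2 * x - of_int k)) $ i)
     = (\<Sum>\<^sub>\<infinity>k\<in>{-int N..int N}. \<Sum>t<r. a k $$ (i, t) * F t 0 (2 * x - of_int k))"
    unfolding e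
  proof (rule infsum_cong_neutral)
    fix k assume "k \<in> UNIV - {-int N..int N}"
    hence "a k = 0\<^sub>m r r" by (intro a_supp not_in_box) auto
    thus "(\<Sum>t<r. a k $$ (i, t) * F t 0 (2 * x - of_int k)) = 0" using i by simp
  qed auto
  also have "\<dots> = (\<Sum>k\<in>{-int N..int N}. \<Sum>t<r. a k $$ (i, t) * F t 0 (2 * x - of_int k))"
    by (rule infsum_finite) simp
  finally show "\<phi> x $ i = vec r (\<lambda>i. 2 * (\<Sum>\<^sub>\<infinity>k. (a k *\<^sub>v \<phi> (2 * x - of_int k)) $ i)) $ i"
    using i F_refinement[OF i, of x] by (simp add: assms(2))
qed (simp add: carrier_vecD[OF assms(1)])

lemma symbol_prod_tendsto:
  assumes "i < r"
  shows "(\<lambda>n. (symbol_prod r a n \<xi> *\<^sub>v unit_vec r 0) $ i) \<longlonglongrightarrow> phi_hat i (of_real \<xi>)"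
proof -
  have "(symbol_prod r a n \<xi> *\<^sub>v unit_vec r 0) $ i = P n i 0 (of_real \<xi>)" for n
    using symbol_prod_carrier[of n \<xi>] assms r_pos by (simp add: symbol_prod_entry)
  thus ?thesis using P_tendsto[OF assms r_pos, of "of_real \<xi>"] by simp
qed

end

section \<open>Transfer from the given scheme to the analytic setting\<close>

text \<open>The strict inequality describes an open set, on which the derivative of a vanishing
  function vanishes again.\<close>

lemma iter_deriv_eq_0:
  assumes "\<And>x. b < \<bar>x\<bar> \<Longrightarrow> f x = 0" "b < \<bar>x\<bar>"
  shows "iter_deriv l f x = 0"
  using assms(2)
proof (induction l arbitrary: x)
  case (Suc l)
  have "open {x::real. b < \<bar>x\<bar>}" by (intro open_Collect_less continuous_intros)
  from has_vector_derivative_transform_within_open[OF has_vector_derivative_const[of 0] this,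
      where g = "iter_deriv l f" and x = x]
  have "(iter_deriv l f has_vector_derivative 0) (at x)"
    using Suc.IH Suc.prems by simp
  from vector_derivative_at[OF this] show ?case by (simp add: iter_deriv_def)
qed (use assms(1) in \<open>simp add: iter_deriv_def\<close>)

text \<open>The radius grows from \<open>b\<close> to \<open>R\<close> because
  \<open>vanishes_outside\<close> includes the endpoints, whereas the derivatives are known to
  vanish only strictly beyond \<open>b\<close>.\<close>

lemma Cm_family_iter_deriv:
  assumes f: "f \<in> C_class m" and b: "\<And>x. b < \<bar>x\<bar> \<Longrightarrow> f x = 0" and R: "b < R"
  shows "Cm_family m R (\<lambda>l. iter_deriv l f)"
  unfolding Cm_family_def
proof (intro conjI allI impI)
  have d: "(iter_deriv l f has_vector_derivative iter_deriv (Suc l) f x) (at x)" if "l < m" for l x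
    using f that by (auto simp: C_class_def vector_derivative_works[symmetric] iter_deriv_def)
  show "(iter_deriv l f has_vector_derivative iter_deriv (Suc l) f x) (at x)" if "l < m" for l x
    using d that by blast
  show "continuous_on UNIV (iter_deriv l f)" if "l \<le> m" for l
  proof (cases "l = m")
    case False
    hence "isCont (iter_deriv l f) x" for x
      using has_vector_derivative_continuous[OF d[of l x]] that by simp
    thus ?thesis by (simp add: continuous_at_imp_continuous_on)
  qed (use f in \<open>simp add: C_class_def\<close>)
  show "vanishes_outside R (iter_deriv l f)" for l
    using R by (auto simp: vanishes_outside_def intro!: iter_deriv_eq_0[of b, OF b])
qed

lemma cmod_le_max_norm:
  assumes "X \<in> carrier_mat s t" "i < s" "l < t"
  shows "cmod (X $$ (i, l)) \<le> max_norm X"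
proof -
  have "X $$ (i, l) \<in> elements_mat X" by (rule elements_matI[OF assms refl])
  moreover have "finite (elements_mat X)" by (simp add: elements_mat_def)
  ultimately show ?thesis unfolding max_norm_def by (intro Max_ge finite_imageI imageI)
qed

lemma max_norm_le:
  assumes X: "X \<in> carrier_mat s t" and "0 < s" "0 < t"
    and B: "\<And>i l. i < s \<Longrightarrow> l < t \<Longrightarrow> cmod (X $$ (i, l)) \<le> B"
  shows "max_norm X \<le> B"
proof -
  have "X $$ (0, 0) \<in> elements_mat X" by (rule elements_matI[OF assms(1-3) refl])
  hence "cmod ` elements_mat X \<noteq> {}" by blast
  moreover have "finite (cmod ` elements_mat X)" by (simp add: elements_mat_def)
  moreover have "x \<le> B" if "x \<in> cmod ` elements_mat X" for x
  proof -
    from that obtain y where y: "y \<in> elements_mat X" "x = cmod y" by blast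
    from elements_matD[OF y(1)] X obtain i l where "i < s" "l < t" "y = X $$ (i, l)" by auto
    thus ?thesis using B y(2) by simp
  qed
  ultimately show ?thesis unfolding max_norm_def by (intro Max.boundedI)
qed

theorem theorem1p3:
  fixes r m :: nat and a :: "int \<Rightarrow> complex mat" and \<phi> :: "real \<Rightarrow> complex vec"
  assumes "r \<ge> 1" and "m \<ge> r - 1"
    and "a \<in> finite_seqs r r"
    and "hermite_convergent r m a"
    and "limiting_basis r m a \<phi>"
    and "cspan r {fourier_vec r \<phi> (2 * pi * of_int k) | k. True} = carrier_vec r"
    and "cspan r {fourier_vec r \<phi> (pi + 2 * pi * of_int k) | k. True} = carrier_vec r"
  shows "(simple_eigenvalue (symbol r r a 0) 1 \<and>
          (\<forall>z. eigenvalue (symbol r r a 0) z \<and> z \<noteq> 1 \<longrightarrow> cmod z < 1 / 2 ^ m)) \<and>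
         (\<exists>\<upsilon> \<in> finite_seqs 1 r. sum_rules r (m + 1) a \<upsilon> \<and>
            hermite_moments r \<upsilon> \<and> hermite_factors r (m + 1) \<upsilon>) \<and>
         ((\<forall>x. \<phi> x = vec r (\<lambda>i. 2 * (\<Sum>\<^sub>\<infinity>k. (a k *\<^sub>v \<phi> (2 * x - of_int k)) $ i))) \<and>
          scalar_prod (unit_vec r 0) (fourier_vec r \<phi> 0) = 1 \<and>
          (\<forall>\<xi>. \<forall>i<r. (\<lambda>n. (symbol_prod r a n \<xi> *\<^sub>v unit_vec r 0) $ i)
                        \<longlonglongrightarrow> fourier_vec r \<phi> \<xi> $ i))"
proof -
  have r0: "0 < r" using assms(1) by simp
  have \<phi>_carrier: "\<phi> x \<in> carrier_vec r" and \<phi>_compact: "compact (closure {x. \<phi> x \<noteq> 0\<^sub>v r})"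
    and \<phi>_C: "\<And>i. i < r \<Longrightarrow> (\<lambda>x. \<phi> x $ i) \<in> C_class m" for x
    using assms(5) by (auto simp: limiting_basis_def)
  have a_car: "a k \<in> carrier_mat r r" and a_fin: "finite {k. a k \<noteq> 0\<^sub>m r r}" for k
    using assms(3) by (auto simp: finite_seqs_def seqs_def)
  obtain N where N: "\<And>k. a k \<noteq> 0\<^sub>m r r \<Longrightarrow> nat \<bar>k\<bar> \<le> N"
    using finite_nat_set_iff_bounded_le[of "(\<lambda>k. nat \<bar>k\<bar>) ` {k. a k \<noteq> 0\<^sub>m r r}"] a_fin by auto
  interpret mask r a N
  proof
    show "a k = 0\<^sub>m r r" if "int N < \<bar>k\<bar>" for k using N[of k] that by linarith
  qed (rule a_car)
  obtain b where b: "\<And>x. \<phi> x \<noteq> 0\<^sub>v r \<Longrightarrow> \<bar>x\<bar> \<le> b"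
  proof -
    have "bounded {x. \<phi> x \<noteq> 0\<^sub>v r}"
      using \<phi>_compact compact_imp_bounded bounded_subset closure_subset by blast
    thus ?thesis using that by (auto simp: bounded_iff)
  qed
  have \<phi>_0: "\<phi> x $ i = 0" if "b < \<bar>x\<bar>" "i < r" for x i
    using b[of x] that by (metis index_zero_vec(1) not_le)
  \<comment> \<open>The radius must dominate \<open>N\<close> for the iterates and strictly exceed
    \<open>b\<close> for the basis function.\<close>
  define R where "R = max N (nat \<lceil>b\<rceil> + 1)"
  have bR: "b < real R" unfolding R_def by linarith
  define F where "F i l = iter_deriv l (\<lambda>x. \<phi> x $ i)" for i l
  have F0: "F i 0 x = \<phi> x $ i" for i x by (simp add: F_def iter_deriv_def)
  have F_fam: "Cm_family m R (F i)" if "i < r" for i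
    unfolding F_def using \<phi>_C[OF that] \<phi>_0[OF _ that] bR by (rule Cm_family_iter_deriv)
  define E where "E n k = hermite_iter r r a (delta_I r) n k - deriv_mat r r (\<lambda>i x. \<phi> x $ i) (of_int k / 2 ^ n)" for n and k :: int
  have E_lim: "(\<lambda>n. SUP k. max_norm (E n k)) \<longlonglongrightarrow> 0"
    using assms(5) by (simp add: limiting_basis_def E_def)
  have E_carrier: "E n k \<in> carrier_mat r r" for n k
    unfolding E_def deriv_mat_def by (rule minus_carrier_mat) simp
  have E_entry: "E n k $$ (i, l) = A n k $$ (i, l) * 2 ^ (l * n) - F i l (of_int k / 2 ^ n)"
    if "i < r" "l < r" for n k i l
  proof -
    have "((1 / 2 :: complex) ^ l) ^ n = 1 / 2 ^ (l * n)"
      by (simp only: power_divide power_one power_mult)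
    hence "((1 / 2 :: complex) ^ l) powi (- int n) = 2 ^ (l * n)"
      by (simp add: power_int_minus)
    moreover have "hermite_iter r r a (delta_I r) n k = mat r r (\<lambda>(i, j). A n k $$ (i, j) * ((1 / 2) ^ j) powi (- int n))"
      unfolding hermite_iter_def D_power_def A_def[symmetric] by (rule mat_diag_mult_right[OF A_carrier])
    ultimately show ?thesis using that by (simp add: E_def deriv_mat_def F_def)
  qed
  \<comment> \<open>A real supremum bounds its family only if the family is bounded above. Here the
    iterates take finitely many values and the derivatives of the basis function are continuous with
    compact support.\<close>
  have E_bdd: "bdd_above (range (\<lambda>k. max_norm (E n k)))" for n
  proof -
    have "\<exists>B. \<forall>k. cmod (E n k $$ (i, l)) \<le> B" if il: "i < r" "l < r" for i l
    proof -
      have "l \<le> m" using il assms(2) by simp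
      then obtain B1 where B1: "\<And>x. cmod (F i l x) \<le> B1"
        using bounded_vanishing Cm_familyD(2,3)[OF F_fam[OF il(1)]] by metis
      have "finite (range (\<lambda>k. A n k $$ (i, l)))"
      proof (rule finite_subset)
        show "range (\<lambda>k. A n k $$ (i, l)) \<subseteq> insert 0 ((\<lambda>k. A n k $$ (i, l)) ` {k. A n k $$ (i, l) \<noteq> 0})" by auto
      qed (use A_fin[OF il] in auto)
      then obtain B2 where B2: "\<And>k. cmod (A n k $$ (i, l)) \<le> B2"
        using finite_imp_bounded bounded_iff by (metis rangeI)
      have "cmod (E n k $$ (i, l)) \<le> B2 * 2 ^ (l * n) + B1" for k
      proof -
        have "cmod (E n k $$ (i, l)) \<le> cmod (A n k $$ (i, l) * 2 ^ (l * n)) + cmod (F i l (of_int k / 2 ^ n))"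
          unfolding E_entry[OF il] by (rule norm_triangle_ineq4)
        also have "\<dots> \<le> B2 * 2 ^ (l * n) + B1"
          using B1 B2[of k] by (intro add_mono) (auto simp: norm_mult norm_power mult_right_mono)
        finally show ?thesis .
      qed
      thus ?thesis by blast
    qed
    then obtain B where B: "\<And>i l k. i < r \<Longrightarrow> l < r \<Longrightarrow> cmod (E n k $$ (i, l)) \<le> B i l" by metis
    have "max_norm (E n k) \<le> (\<Sum>i<r. \<Sum>l<r. \<bar>B i l\<bar>)" for k
    proof (rule max_norm_le[OF E_carrier r0 r0])
      fix i l assume il: "i < r" "l < r"
      have "cmod (E n k $$ (i, l)) \<le> \<bar>B i l\<bar>" using B[OF il, of k] by linarith
      also have "\<dots> \<le> (\<Sum>l<r. \<bar>B i l\<bar>)" using il by (intro member_le_sum) auto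
      also have "\<dots> \<le> (\<Sum>i<r. \<Sum>l<r. \<bar>B i l\<bar>)"
        using il by (intro member_le_sum[of i "{..<r}" "\<lambda>i. \<Sum>l<r. \<bar>B i l\<bar>"] sum_nonneg) auto
      finally show "cmod (E n k $$ (i, l)) \<le> (\<Sum>i<r. \<Sum>l<r. \<bar>B i l\<bar>)" .
    qed
    thus ?thesis by (auto simp: bdd_above_def)
  qed
  \<comment> \<open>The uniform entrywise estimate comes from bounding each entry by
    \<open>max_norm\<close> and then by the supremum over \<open>k\<close>.\<close>
  interpret hermite_limit r a N m R F
  proof
    show "r \<le> Suc m" using assms(2) by simp
    show "\<forall>\<^sub>F n in sequentially. \<forall>k. cmod (A n k $$ (i, l) * 2 ^ (l * n) - F i l (of_int k / 2 ^ n)) \<le> e"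
      if "i < r" "l < r" "e > 0" for i l e
    proof -
      have "\<forall>\<^sub>F n in sequentially. (SUP k. max_norm (E n k)) < e"
        using order_tendstoD(2)[OF E_lim that(3)] .
      thus ?thesis
      proof eventually_elim
        case (elim n)
        show ?case
        proof
          fix k
          have "cmod (E n k $$ (i, l)) \<le> max_norm (E n k)"
            by (rule cmod_le_max_norm[OF E_carrier that(1,2)])
          also have "\<dots> \<le> (SUP k. max_norm (E n k))" by (rule cSUP_upper[OF _ E_bdd]) simp
          finally show "cmod (A n k $$ (i, l) * 2 ^ (l * n) - F i l (of_int k / 2 ^ n)) \<le> e"
            using elim E_entry[OF that(1,2)] by simp
        qed
      qed
    qed
  qed (use r0 F_fam in \<open>auto simp: R_def\<close>)
  have fv: "fourier_vec r \<phi> \<xi> $ i = phi_hat i (of_real \<xi>)" if "i < r" for i \<xi>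
    using that FT_eq_lebesgue[of "F i 0" "real R" "of_real \<xi>"] Cm_familyD(2,3)[OF F_fam[OF that], of 0]
    by (simp add: fourier_vec_def phi_hat_def F0)
  have fvc: "fourier_vec r \<phi> \<xi> \<in> carrier_vec r" for \<xi> by (simp add: fourier_vec_def)
  interpret hermite_limit_span r a N m R F
  proof
    fix h q assume h: "\<And>k::int. (\<Sum>q<r. h q * phi_hat q (2 * of_real pi * of_int k)) = 0" and q: "q < r"
    show "h q = 0"
      by (rule orthogonal_to_cspan[OF assms(6) _ _ q]) (use h fvc in \<open>auto simp: fv\<close>)
  next
    fix h q assume h: "\<And>k::int. (\<Sum>q<r. h q * phi_hat q (of_real pi + 2 * of_real pi * of_int k)) = 0" and q: "q < r"
    show "h q = 0"
      by (rule orthogonal_to_cspan[OF assms(7) _ _ q]) (use h fvc in \<open>auto simp: fv\<close>)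
  qed
  show ?thesis unfolding simple_eigenvalue_def
  proof (intro conjI allI impI)
    show "eigenvalue (symbol r r a 0) 1" by (rule eigenvalue_1)
    show "Polynomial.order 1 (char_poly (symbol r r a 0)) = 1" by (rule order_char_poly)
    show "cmod z < 1 / 2 ^ m" if "eigenvalue (symbol r r a 0) z \<and> z \<noteq> 1" for z
      using that other_eigenvalues by blast
    show "\<exists>\<upsilon> \<in> finite_seqs 1 r. sum_rules r (m + 1) a \<upsilon> \<and> hermite_moments r \<upsilon> \<and> hermite_factors r (m + 1) \<upsilon>"
      by (rule sum_rule_sequence_exists)
    show "\<phi> x = vec r (\<lambda>i. 2 * (\<Sum>\<^sub>\<infinity>k. (a k *\<^sub>v \<phi> (2 * x - of_int k)) $ i))" for x
      by (rule refinement_vec) (auto simp: \<phi>_carrier F0)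
    show "scalar_prod (unit_vec r 0) (fourier_vec r \<phi> 0) = 1"
      using fv[OF r0, of 0] phi_hat_normalized fvc r0 by simp
    show "(\<lambda>n. (symbol_prod r a n \<xi> *\<^sub>v unit_vec r 0) $ i) \<longlonglongrightarrow> fourier_vec r \<phi> \<xi> $ i"
      if "i < r" for \<xi> i
      unfolding fv[OF that] by (rule symbol_prod_tendsto[OF that])
  qed
qed

end
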